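(* Consider the randomized urn model $(C_0,(\chi_n,R_n)_{n\ge 1})$ with $K$ colors, configuration vectors $C_n$, total contents $S_n$, count vectors $N_n$ and filtration $(\mathcal F_n)_{n\ge 0}$ as described in the context (including the basic assumptions (i)--(iv) there). Let $H_{n-1}:=\mathbb E(R_n\mid\mathcal F_{n-1})$, $n\ge1$. Assume: (1) There exists a (possibly random) $K\times K$ matrix $H$ with nonnegative entries, almost surely irreducible, such that $\frac1n\sum_{k=0}^{n-1}\rho(H_k-H)\to0$ almost surely. (2) There exist $c\in(0,\infty)$ and a positive random variable $R$ with $\mathbb E(R)<\infty$ and $\mathbb E(R\log_+R)<\infty$ such that $\mathbb P(\rho(R_n)>x)\le c\,\mathbb P(R>x)$ for all $x>0$ and all $n\ge1$. Let $\lambda_H$ be the dominant eigenvalue of $H$ and $\pi_H$ the unique left eigenvector of $H$ for $\lambda_H$ which has all coordinates strictly positive and is normalized to be a probability vector. Then, as $n\to\infty$, both almost surely and in $L^1$, $$\frac{C_n}{S_n}\to\pi_H,\qquad \frac{S_n}{n}\to\lambda_H,\qquad \frac{C_n}{n}\to\lambda_H\pi_H,\qquad \frac{N_n}{n}\to\pi_H .$$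
   Context: Vectors are row vectors; $[K]=\{1,\dots,K\}$; $e_i$ is the $i$-th coordinate vector of $\mathbb R^K$; $\log_+x=\max(\log x,0)$. For a matrix $A$, $\rho(A):=\max_i\sum_j|A_{ij}|$. A square matrix $A$ with nonnegative entries is irreducible if for all $i,j\in[K]$ there is a positive integer $N$ (depending on $i,j$) such that the $(i,j)$ entry of $A^N$ is positive. The dominant eigenvalue of an irreducible matrix is its eigenvalue with largest real part; by Perron--Frobenius it is simple and positive with strictly positive left and right eigenvectors. Urn model: on a probability space, $C_0$ is a random vector in $\mathbb R^K$, $(R_n)_{n\ge1}$ are random $K\times K$ matrices with nonnegative entries (replacement matrices), and $(\chi_n)_{n\ge1}$ are random vectors with values in $\{e_1,\dots,e_K\}$ (the color drawn at trial $n$). The configuration vectors $C_n=(C_{n1},\dots,C_{nK})$ satisfy $C_n=C_{n-1}+\chi_nR_n$ for $n\ge1$; $S_n=\sum_{i=1}^KC_{ni}$; $N_n=\sum_{k=1}^n\chi_k$. $\mathcal F_n$ is the $\sigma$-field generated by $C_0$ and $(R_m,\chi_m)_{m=1}^n$ (so $\mathcal F_0=\sigma(C_0)$). Basic assumptions: (i) $C_0$ is almost surely nonzero with nonnegative entries, and has finite mean; (ii) for $n\ge1$, $i\in[K]$, $\mathbb P(\chi_n=e_i\mid\mathcal F_{n-1})=C_{n-1,i}/S_{n-1}$; (iii) each $R_n$ has finite mean; (iv) for each $n\ge 1$, $\chi_n$ and $R_n$ are conditionally independent given $\mathcal F_{n-1}$. *)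

theory Defs
  imports "HOL-Probability.Probability"
begin

section \<open>Nonnegative matrices\<close>

definition row_sum_norm :: "real^'k^'k \<Rightarrow> real" where
  "row_sum_norm A = (MAX i. \<Sum>j\<in>UNIV. \<bar>A $ i $ j\<bar>)"

definition nonneg_matrix :: "real^'k^'k \<Rightarrow> bool" where
  "nonneg_matrix A \<longleftrightarrow> (\<forall>i j. 0 \<le> A $ i $ j)"

text \<open>The overloaded power on \<^typ>\<open>real^'k^'k\<close> is the entrywise one, so the power with
  respect to the matrix product is introduced separately.\<close>

primrec matrix_power :: "real^'k^'k \<Rightarrow> nat \<Rightarrow> real^'k^'k" where
  "matrix_power A 0 = mat 1"
| "matrix_power A (Suc n) = matrix_power A n ** A"

definition irreducible_matrix :: "real^'k^'k \<Rightarrow> bool" where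
  "irreducible_matrix A \<longleftrightarrow>
     nonneg_matrix A \<and> (\<forall>i j. \<exists>N>0. 0 < matrix_power A N $ i $ j)"

definition complex_eigenvalue :: "real^'k^'k \<Rightarrow> complex \<Rightarrow> bool" where
  "complex_eigenvalue A z \<longleftrightarrow>
     (\<exists>v::complex^'k. v \<noteq> 0 \<and> map_matrix complex_of_real A *v v = z *s v)"

text \<open>The eigenvalue with largest real part among all complex eigenvalues; for an irreducible
  matrix it is real by Perron--Frobenius. The notion, like that of the left Perron vector below,
  is only meant for irreducible matrices. The value 0 elsewhere makes both total functions of
  the matrix.\<close>

definition dominant_eigenvalue :: "real^'k^'k \<Rightarrow> real" where
  "dominant_eigenvalue A =
     (if irreducible_matrix A
      then THE l. complex_eigenvalue A (complex_of_real l) \<and>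
                  (\<forall>z. complex_eigenvalue A z \<longrightarrow> Re z \<le> l)
      else 0)"

definition left_perron_vector :: "real^'k^'k \<Rightarrow> real^'k" where
  "left_perron_vector A =
     (if irreducible_matrix A
      then THE p. p v* A = dominant_eigenvalue A *\<^sub>R p \<and>
                  (\<forall>i. 0 < p $ i) \<and> (\<Sum>i\<in>UNIV. p $ i) = 1
      else 0)"


section \<open>Probabilistic notions\<close>

definition log_plus :: "real \<Rightarrow> real" where
  "log_plus x = max (ln x) 0"

definition cond_indep_var ::
  "'a measure \<Rightarrow> 'a measure \<Rightarrow> 'b measure \<Rightarrow> ('a \<Rightarrow> 'b) \<Rightarrow> 'c measure \<Rightarrow> ('a \<Rightarrow> 'c) \<Rightarrow> bool" where
  "cond_indep_var M F S X T Y \<longleftrightarrow>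
     (\<forall>A\<in>sets S. \<forall>B\<in>sets T. AE \<omega> in M.
        real_cond_exp M F (indicator {\<omega>\<in>space M. X \<omega> \<in> A \<and> Y \<omega> \<in> B}) \<omega> =
        real_cond_exp M F (indicator {\<omega>\<in>space M. X \<omega> \<in> A}) \<omega> *
        real_cond_exp M F (indicator {\<omega>\<in>space M. Y \<omega> \<in> B}) \<omega>)"

text \<open>Entrywise conditional expectation of a random matrix.\<close>

definition matrix_cond_exp ::
  "'a measure \<Rightarrow> 'a measure \<Rightarrow> ('a \<Rightarrow> real^'k^'k) \<Rightarrow> 'a \<Rightarrow> real^'k^'k" where
  "matrix_cond_exp M F X \<omega> = (\<chi> i j. real_cond_exp M F (\<lambda>\<omega>. X \<omega> $ i $ j) \<omega>)"

definition tendsto_AE ::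
  "'a measure \<Rightarrow> (nat \<Rightarrow> 'a \<Rightarrow> 'b::topological_space) \<Rightarrow> ('a \<Rightarrow> 'b) \<Rightarrow> bool" where
  "tendsto_AE M X Y \<longleftrightarrow> (AE \<omega> in M. (\<lambda>n. X n \<omega>) \<longlonglongrightarrow> Y \<omega>)"

definition tendsto_L1 ::
  "'a measure \<Rightarrow> (nat \<Rightarrow> 'a \<Rightarrow> 'b::{banach, second_countable_topology}) \<Rightarrow> ('a \<Rightarrow> 'b) \<Rightarrow> bool" where
  "tendsto_L1 M X Y \<longleftrightarrow>
     (\<forall>n. integrable M (X n)) \<and> integrable M Y \<and>
     (\<lambda>n. \<integral>\<omega>. norm (X n \<omega> - Y \<omega>) \<partial>M) \<longlonglongrightarrow> 0"


section \<open>Urn models\<close>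

text \<open>Colors are the elements of the finite index type \<^typ>\<open>'k\<close>, and \<open>drawn n\<close> is the unit vector
  of the color drawn at trial \<open>n\<close>. Trials start at 1; \<open>drawn 0\<close> and \<open>R 0\<close> are never used.\<close>

primrec urn_config ::
  "('a \<Rightarrow> real^'k) \<Rightarrow> (nat \<Rightarrow> 'a \<Rightarrow> real^'k) \<Rightarrow> (nat \<Rightarrow> 'a \<Rightarrow> real^'k^'k) \<Rightarrow>
   nat \<Rightarrow> 'a \<Rightarrow> real^'k" where
  "urn_config C0 drawn R 0 \<omega> = C0 \<omega>"
| "urn_config C0 drawn R (Suc n) \<omega> = urn_config C0 drawn R n \<omega> + drawn (Suc n) \<omega> v* R (Suc n) \<omega>"

definition urn_total ::
  "('a \<Rightarrow> real^'k) \<Rightarrow> (nat \<Rightarrow> 'a \<Rightarrow> real^'k) \<Rightarrow> (nat \<Rightarrow> 'a \<Rightarrow> real^'k^'k) \<Rightarrow>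
   nat \<Rightarrow> 'a \<Rightarrow> real" where
  "urn_total C0 drawn R n \<omega> = (\<Sum>i\<in>UNIV. urn_config C0 drawn R n \<omega> $ i)"

definition urn_count :: "(nat \<Rightarrow> 'a \<Rightarrow> real^'k) \<Rightarrow> nat \<Rightarrow> 'a \<Rightarrow> real^'k" where
  "urn_count drawn n \<omega> = (\<Sum>k=1..n. drawn k \<omega>)"

definition urn_filtration ::
  "'a measure \<Rightarrow> ('a \<Rightarrow> real^'k) \<Rightarrow> (nat \<Rightarrow> 'a \<Rightarrow> real^'k) \<Rightarrow> (nat \<Rightarrow> 'a \<Rightarrow> real^'k^'k) \<Rightarrow>
   nat \<Rightarrow> 'a measure" where
  "urn_filtration M C0 drawn R n =
     sigma (space M)
       ({C0 -` A \<inter> space M | A. A \<in> sets borel} \<union>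
        {R m -` A \<inter> space M | A m. A \<in> sets borel \<and> m \<in> {1..n}} \<union>
        {drawn m -` A \<inter> space M | A m. A \<in> sets borel \<and> m \<in> {1..n}})"

locale randomized_urn = prob_space M
  for M :: "'a measure"
    and C0 :: "'a \<Rightarrow> real^'k"
    and drawn :: "nat \<Rightarrow> 'a \<Rightarrow> real^'k"
    and R :: "nat \<Rightarrow> 'a \<Rightarrow> real^'k^'k" +
  assumes measurable_C0: "C0 \<in> borel_measurable M"
    and measurable_drawn: "\<And>n. n \<ge> 1 \<Longrightarrow> drawn n \<in> borel_measurable M"
    and measurable_R: "\<And>n. n \<ge> 1 \<Longrightarrow> R n \<in> borel_measurable M"
    and drawn_range: "\<And>n \<omega>. n \<ge> 1 \<Longrightarrow> \<omega> \<in> space M \<Longrightarrow> drawn n \<omega> \<in> range (\<lambda>i. axis i 1)"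
    and R_nonneg: "\<And>n \<omega>. n \<ge> 1 \<Longrightarrow> \<omega> \<in> space M \<Longrightarrow> nonneg_matrix (R n \<omega>)"
    and C0_nonneg: "AE \<omega> in M. C0 \<omega> \<noteq> 0 \<and> (\<forall>i. 0 \<le> C0 \<omega> $ i)"
    and C0_integrable: "integrable M C0"
    and draw_prob: "\<And>n i. n \<ge> 1 \<Longrightarrow> AE \<omega> in M.
          real_cond_exp M (urn_filtration M C0 drawn R (n - 1))
            (indicator {\<omega>\<in>space M. drawn n \<omega> = axis i 1}) \<omega> =
          urn_config C0 drawn R (n - 1) \<omega> $ i / urn_total C0 drawn R (n - 1) \<omega>"
    and R_integrable: "\<And>n. n \<ge> 1 \<Longrightarrow> integrable M (R n)"
    and draw_indep: "\<And>n. n \<ge> 1 \<Longrightarrow>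
          cond_indep_var M (urn_filtration M C0 drawn R (n - 1)) borel (drawn n) borel (R n)"
begin

lemma subalgebra_urn_filtration: "subalgebra M (urn_filtration M C0 drawn R n)"
proof -
  let ?G = "{C0 -` A \<inter> space M | A. A \<in> sets borel} \<union>
        {R m -` A \<inter> space M | A m. A \<in> sets borel \<and> m \<in> {1..n}} \<union>
        {drawn m -` A \<inter> space M | A m. A \<in> sets borel \<and> m \<in> {1..n}}"
  have "?G \<subseteq> sets M"
    using measurable_C0 measurable_drawn measurable_R by (auto intro: measurable_sets)
  moreover from this have "?G \<subseteq> Pow (space M)"
    using sets.space_closed by blast
  ultimately show ?thesis
    unfolding subalgebra_def urn_filtration_def
    by (simp only: space_measure_of sets_measure_of sets.sigma_sets_subset simp_thms)
qed

end

text \<open>The conditional mean replacement matrices; note the shift of index, the \<open>n\<close>-th one being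
  the conditional expectation of \<open>R (n + 1)\<close>.\<close>

definition urn_mean_replacement ::
  "'a measure \<Rightarrow> ('a \<Rightarrow> real^'k) \<Rightarrow> (nat \<Rightarrow> 'a \<Rightarrow> real^'k) \<Rightarrow> (nat \<Rightarrow> 'a \<Rightarrow> real^'k^'k) \<Rightarrow>
   nat \<Rightarrow> 'a \<Rightarrow> real^'k^'k" where
  "urn_mean_replacement M C0 drawn R n =
     matrix_cond_exp M (urn_filtration M C0 drawn R n) (R (Suc n))"

end

theory Submission
  imports Defs
begin

text \<open>
Write \<open>Y\<^sub>k = C\<^sub>k / S\<^sub>k\<close> for the vector of proportions, \<open>H\<^sub>k\<close> for the conditional mean of the matrix
\<open>R\<^sub>k\<^sub>+\<^sub>1\<close> and \<open>x\<^sub>n = (Y\<^sub>0 + \<dots> + Y\<^sub>n\<^sub>-\<^sub>1) / n\<close>. The proof separates the randomness from a deterministic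
recursion.

Given the past, the draw has mean \<open>Y\<^sub>k\<close>, and it is independent of the replacement matrix, so the increment of
the configuration has conditional mean \<open>Y\<^sub>k H\<^sub>k\<close> (\<open>cond_exp_increment\<close>). A strong law for
nonnegative variables centered at their conditional means (\<open>strong_law_conditionally_centered\<close>)
then gives \<open>C\<^sub>n = \<Sum> Y\<^sub>k H\<^sub>k + o(n)\<close> and \<open>N\<^sub>n = \<Sum> Y\<^sub>k + o(n)\<close> almost surely. The Cesaro convergence
of \<open>H\<^sub>k\<close> allows \<open>H\<^sub>k\<close> to be replaced by \<open>H\<close>, so that \<open>C\<^sub>n / n = x\<^sub>n H + o(1)\<close>.

From here on the argument is pathwise (\<open>averaged_urn_limit\<close>). As \<open>Y\<^sub>n\<close> is \<open>C\<^sub>n\<close> normalized to total mass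
one, \<open>x\<^sub>n\<close> is a perturbed Euler scheme with steps \<open>1/n\<close> for \<open>x' = xH / (xH1) - x\<close>. Let \<open>\<lambda>\<close>, \<open>p\<close> and \<open>u\<close> be
the Perron eigenvalue and the positive left and right eigenvectors. In the coordinates
\<open>z = x / (x \<bullet> u)\<close> the flow becomes, up to a positive change of time, the linear flow
\<open>z' = zH - \<lambda>z\<close> on the hyperplane \<open>z \<bullet> u = 1\<close>. Conjugation by \<open>u\<close> turns \<open>H/\<lambda>\<close> into an irreducible
stochastic matrix, and the usual Dirichlet form argument for Markov chains shows that the
quadratic form with weights \<open>u\<^sub>i / p\<^sub>i\<close> contracts towards the multiple of \<open>p\<close> on that hyperplane
(\<open>perron_form_spectral_gap\<close>, \<open>relaxed_iteration_tendsto\<close>). Hence \<open>x\<^sub>n \<rightarrow> p\<close>, and the four almost sure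
limits follow from \<open>C\<^sub>n / n = x\<^sub>n H + o(1)\<close> and \<open>N\<^sub>n / n = x\<^sub>n + o(1)\<close>.

The strong law is proved by truncating the \<open>k\<close>-th variable at level \<open>k\<close>. The centered truncated variables have
variances \<open>v\<^sub>k\<close> with \<open>\<Sum> v\<^sub>k / k\<^sup>2 < \<infinity>\<close>, because the dominating variable has a finite mean, and a maximal
inequality on dyadic blocks finishes this part. The conditional means of the parts cut off are
the reason for the \<open>D log D\<close> moment: the sum of their expectations divided by \<open>k\<close> is
bounded by a multiple of \<open>\<Sum> (1 + log m) P(D > m)\<close>.

Convergence in mean is dominated convergence for the bounded quantities \<open>C\<^sub>n / S\<^sub>n\<close> and \<open>N\<^sub>n / n\<close>. For
\<open>S\<^sub>n / n\<close>, which is at most an average of the norms of the matrices plus the initial content, the part above a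
level \<open>T\<close> has expectation at most a tail of \<open>\<Sum> P(D > m)\<close>, up to the constant, uniformly in \<open>n\<close>
(\<open>tendsto_L1_of_excess_bound\<close>).
\<close>

section \<open>Nonnegative matrices and the probability simplex\<close>

abbreviation mass :: "real^'k \<Rightarrow> real" where
  "mass x \<equiv> \<Sum>i\<in>UNIV. x $ i"

definition prob_simplex :: "(real^'k) set" where
  "prob_simplex = {x. (\<forall>i. 0 \<le> x $ i) \<and> mass x = 1}"

lemma row_le_row_sum_norm: "(\<Sum>j\<in>UNIV. \<bar>A $ i $ j\<bar>) \<le> row_sum_norm A"
  unfolding row_sum_norm_def by (rule Max_ge) auto

lemma entry_le_row_sum_norm: "\<bar>A $ i $ j\<bar> \<le> row_sum_norm A"
  by (rule order_trans[OF _ row_le_row_sum_norm[of A i]]) (rule member_le_sum, auto)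

lemma row_sum_norm_nonneg: "0 \<le> row_sum_norm A"
  using entry_le_row_sum_norm[of A undefined undefined] by linarith

lemma vec_mat_component: "(x v* A) $ j = (\<Sum>i\<in>UNIV. x $ i * A $ i $ j)"
  by (simp add: vector_matrix_mult_def)

lemma mass_vec_mat: "mass (x v* A) = (\<Sum>i\<in>UNIV. x $ i * (\<Sum>j\<in>UNIV. A $ i $ j))"
  unfolding vec_mat_component sum_distrib_left by (rule sum.swap)

lemma mass_linear:
  "mass (x + y) = mass x + mass y" "mass (x - y) = mass x - mass y" "mass (a *\<^sub>R x) = a * mass x"
  by (auto simp: sum.distrib sum_subtractf sum_distrib_left)

lemma prob_simplex_le_1: "x \<in> prob_simplex \<Longrightarrow> x $ i \<le> 1"
  using member_le_sum[of i UNIV "\<lambda>i. x $ i"] by (auto simp: prob_simplex_def)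

lemma prob_simplex_norm_le_1: "x \<in> prob_simplex \<Longrightarrow> norm x \<le> 1"
  using norm_le_l1_cart[of x] by (auto simp: prob_simplex_def)

lemma prob_simplex_nonempty: "prob_simplex \<noteq> {}"
proof -
  have "axis undefined 1 \<in> prob_simplex"
    by (auto simp: prob_simplex_def axis_def)
  then show ?thesis by blast
qed

lemma closed_prob_simplex: "closed (prob_simplex :: (real^'k) set)"
proof -
  have "(prob_simplex :: (real^'k) set) = (\<Inter>i. {x. 0 \<le> x $ i}) \<inter> {x. mass x = 1}"
    by (auto simp: prob_simplex_def)
  moreover have "closed \<dots>"
    by (intro closed_Int closed_INT ballI closed_Collect_le closed_Collect_eq continuous_intros)
  ultimately show ?thesis by simp
qed

lemma compact_prob_simplex: "compact prob_simplex"
  unfolding compact_eq_bounded_closed bounded_iff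
  using closed_prob_simplex prob_simplex_norm_le_1 by blast

lemma convex_prob_simplex: "convex prob_simplex"
  unfolding convex_def prob_simplex_def
  by (auto simp: sum.distrib sum_distrib_left[symmetric])

lemma matrix_power_Suc_left: "matrix_power A (Suc n) = A ** matrix_power A n"
  by (induction n) (simp_all add: matrix_mul_assoc[symmetric])

lemma matrix_power_transpose: "matrix_power (transpose A) n = transpose (matrix_power A n)"
proof (induction n)
  case (Suc n)
  have "matrix_power (transpose A) (Suc n) = transpose (A ** matrix_power A n)"
    using Suc by (simp add: matrix_transpose_mul)
  then show ?case by (simp only: matrix_power_Suc_left)
qed (simp add: transpose_mat)

lemma irreducible_transpose: "irreducible_matrix A \<Longrightarrow> irreducible_matrix (transpose A)"
  unfolding irreducible_matrix_def nonneg_matrix_def matrix_power_transpose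
  by (auto simp: transpose_def)

lemma matrix_power_nonneg: "nonneg_matrix A \<Longrightarrow> 0 \<le> matrix_power A n $ i $ j"
proof (induction n arbitrary: i j)
  case 0
  then show ?case by (simp add: mat_def)
next
  case (Suc n)
  then show ?case by (auto simp: matrix_matrix_mult_def nonneg_matrix_def intro!: sum_nonneg)
qed

lemma irreducible_row_positive:
  assumes "irreducible_matrix A"
  shows "0 < (\<Sum>j\<in>UNIV. A $ i $ j)"
proof -
  have nn: "nonneg_matrix A" using assms by (simp add: irreducible_matrix_def)
  obtain n where "0 < matrix_power A (Suc n) $ i $ i"
    using assms unfolding irreducible_matrix_def by (metis gr0_implies_Suc)
  then have "0 < (\<Sum>j\<in>UNIV. A $ i $ j * matrix_power A n $ j $ i)"
    unfolding matrix_power_Suc_left by (simp add: matrix_matrix_mult_def)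
  then obtain j where "A $ i $ j * matrix_power A n $ j $ i \<noteq> 0"
    using sum.neutral[of UNIV "\<lambda>j. A $ i $ j * matrix_power A n $ j $ i"] by force
  then have "0 < A $ i $ j" using nn by (auto simp: nonneg_matrix_def order_less_le)
  then show ?thesis
    using nn by (intro sum_pos2[where i=j]) (auto simp: nonneg_matrix_def)
qed

lemma eigenvector_matrix_power:
  "p v* A = l *\<^sub>R p \<Longrightarrow> p v* matrix_power A n = l ^ n *\<^sub>R (p::real^'k)"
proof (induction n)
  case (Suc n)
  then show ?case
    by (simp add: vector_matrix_mul_assoc[symmetric] scaleR_vector_matrix_assoc Suc.IH[OF Suc.prems])
qed simp

text \<open>Iterating the eigenvector equation \<open>N\<close> times transports the mass of a positive coordinate \<open>i\<close> to any
coordinate \<open>j\<close> that \<open>i\<close> reaches in \<open>N\<close> steps.\<close>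

lemma nonneg_eigenvector_positive:
  fixes p :: "real^'k"
  assumes A: "irreducible_matrix A" and p: "\<And>i. 0 \<le> p $ i" "p \<noteq> 0" "p v* A = l *\<^sub>R p"
  shows "0 < p $ j"
proof -
  have nn: "nonneg_matrix A" using A by (simp add: irreducible_matrix_def)
  obtain i where i: "0 < p $ i"
    using p(1,2) by (metis order_le_less vec_eq_iff zero_index)
  obtain N where N: "0 < matrix_power A N $ i $ j"
    using A by (auto simp: irreducible_matrix_def)
  have "0 < p $ i * matrix_power A N $ i $ j" using i N by simp
  also have "\<dots> \<le> (p v* matrix_power A N) $ j"
    unfolding vec_mat_component
    by (rule member_le_sum) (auto intro!: mult_nonneg_nonneg p matrix_power_nonneg nn)
  also have "\<dots> = l ^ N * p $ j" using eigenvector_matrix_power[OF p(3)] by simp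
  finally have "p $ j \<noteq> 0" by auto
  then show ?thesis using p(1)[of j] by simp
qed

lemma mass_vec_mat_positive:
  assumes A: "irreducible_matrix A" and x: "x \<in> prob_simplex"
  shows "0 < mass (x v* A)"
proof -
  have "x \<noteq> 0" using x by (auto simp: prob_simplex_def)
  then obtain i where i: "0 < x $ i"
    using x unfolding prob_simplex_def
    by (metis (mono_tags, lifting) mem_Collect_eq order_le_less vec_eq_iff zero_index)
  show ?thesis
    unfolding mass_vec_mat using x i irreducible_row_positive[OF A]
    by (intro sum_pos2[where i=i]) (auto simp: prob_simplex_def less_imp_le)
qed

lemma continuous_on_vec_mat:
  fixes f :: "'b::topological_space \<Rightarrow> real^'k" and A :: "'b \<Rightarrow> real^'k^'k"
  shows "continuous_on S f \<Longrightarrow> continuous_on S A \<Longrightarrow> continuous_on S (\<lambda>x. f x v* A x)"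
  unfolding vector_matrix_mult_def
  by (intro continuous_on_vec_lambda continuous_on_sum continuous_on_mult continuous_on_component)

section \<open>Perron--Frobenius theory\<close>

text \<open>A fixed point, given by Brouwer's theorem, of the normalized map \<open>x \<mapsto> xA / (xA1)\<close> of the simplex
is an eigenvector. Irreducibility makes the denominator positive, and then makes the fixed
point strictly positive.\<close>

lemma exists_left_perron:
  fixes A :: "real^'k^'k"
  assumes A: "irreducible_matrix A"
  obtains l p where "0 < l" "\<And>i. 0 < p $ i" "mass p = 1" "p v* A = l *\<^sub>R p"
proof -
  define g where "g = (\<lambda>x. (1 / mass (x v* A)) *\<^sub>R (x v* A))"
  have "continuous_on prob_simplex g"
    unfolding g_def
    apply (intro continuous_on_scaleR continuous_on_divide continuous_on_const continuous_on_sum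
        continuous_on_component continuous_on_vec_mat continuous_on_id ballI)
    apply (drule mass_vec_mat_positive[OF A], simp)
    done
  moreover have "g \<in> prob_simplex \<rightarrow> prob_simplex"
  proof
    fix x :: "real^'k" assume x: "x \<in> prob_simplex"
    have "mass (g x) = 1"
      unfolding g_def mass_linear using mass_vec_mat_positive[OF A x] by simp
    moreover have "0 \<le> g x $ i" for i
    proof -
      have "0 \<le> (x v* A) $ i"
        unfolding vec_mat_component using x A
        by (intro sum_nonneg mult_nonneg_nonneg)
          (auto simp: prob_simplex_def irreducible_matrix_def nonneg_matrix_def)
      then show ?thesis unfolding g_def using mass_vec_mat_positive[OF A x] by simp
    qed
    ultimately show "g x \<in> prob_simplex" by (simp add: prob_simplex_def)
  qed
  ultimately obtain p where p: "p \<in> prob_simplex" "g p = p"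
    using brouwer[OF compact_prob_simplex convex_prob_simplex prob_simplex_nonempty] by blast
  let ?l = "mass (p v* A)"
  have l: "0 < ?l" by (rule mass_vec_mat_positive[OF A p(1)])
  have eig: "p v* A = ?l *\<^sub>R p"
  proof -
    have "?l *\<^sub>R p = ?l *\<^sub>R g p" using p by simp
    also have "\<dots> = p v* A" unfolding g_def using l by simp
    finally show ?thesis by simp
  qed
  have "p \<noteq> 0" using p by (auto simp: prob_simplex_def)
  show thesis
    using p(1) l eig nonneg_eigenvector_positive[OF A _ \<open>p \<noteq> 0\<close> eig]
    by (intro that[of ?l p]) (auto simp: prob_simplex_def)
qed

locale perron_triple =
  fixes A :: "real^'k^'k" and l :: real and p u :: "real^'k"
  assumes A: "irreducible_matrix A"
    and l: "0 < l"
    and p: "\<And>i. 0 < p $ i" and u: "\<And>i. 0 < u $ i"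
    and mass_p: "mass p = 1"
    and left: "p v* A = l *\<^sub>R p" and right: "A *v u = l *\<^sub>R u"

text \<open>The right eigenvector is a left eigenvector of the transpose. Both eigenvalues are equal, since
pairing the two vectors through \<open>A\<close> gives \<open>l (p \<bullet> u) = m (p \<bullet> u)\<close> with \<open>p \<bullet> u > 0\<close>.\<close>

lemma exists_perron_triple:
  assumes A: "irreducible_matrix A"
  obtains l p u where "perron_triple A l p u"
proof -
  obtain l p where 1: "0 < l" "\<And>i. 0 < p $ i" "mass p = 1" "p v* A = l *\<^sub>R p"
    using exists_left_perron[OF A] by blast
  obtain m u where 2: "0 < m" "\<And>i. 0 < u $ i" "mass u = 1" "u v* transpose A = m *\<^sub>R u"
    using exists_left_perron[OF irreducible_transpose[OF A]] by blast
  have "0 < p \<bullet> u"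
    unfolding inner_vec_def using 1(2) 2(2) by (intro sum_pos) auto
  moreover have "l * (p \<bullet> u) = m * (p \<bullet> u)"
    using dot_lmul_matrix[of p A u] 1(4) 2(4) by simp
  ultimately have "l = m" by simp
  then show thesis
    using 1 2 A by (intro that[of l p u]) (auto simp: perron_triple_def)
qed

context perron_triple
begin

lemma nonneg: "0 \<le> A $ i $ j"
  using A by (simp add: irreducible_matrix_def nonneg_matrix_def)

lemma left_sum: "(\<Sum>i\<in>UNIV. p $ i * A $ i $ j) = l * p $ j"
  using arg_cong[OF left, of "\<lambda>x. x $ j"] by (simp add: vec_mat_component)

lemma right_sum: "(\<Sum>j\<in>UNIV. A $ i $ j * u $ j) = l * u $ i"
  using arg_cong[OF right, of "\<lambda>x. x $ i"] by (simp add: matrix_vector_mult_def)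

text \<open>Pairing with \<open>u\<close> identifies the eigenvalue. For the vector, subtract the largest multiple \<open>t p\<close> of \<open>p\<close> that stays
below \<open>q\<close>: the difference is a nonnegative eigenvector with a vanishing coordinate, hence zero.\<close>

lemma left_eigenvector_unique:
  assumes q: "\<And>i. 0 \<le> q $ i" "mass q = 1" "q v* A = m *\<^sub>R q"
  shows "q = p" "m = l"
proof -
  have q0: "q \<noteq> 0" using q by auto
  have qpos: "0 < q $ i" for i by (rule nonneg_eigenvector_positive[OF A q(1) q0 q(3)])
  have "0 < q \<bullet> u" unfolding inner_vec_def using qpos u by (intro sum_pos) auto
  moreover have "m * (q \<bullet> u) = l * (q \<bullet> u)"
    using dot_lmul_matrix[of q A u] right q(3) by simp
  ultimately show "m = l" by simp
  define t where "t = Min (range (\<lambda>i. q $ i / p $ i))"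
  have t: "t * p $ i \<le> q $ i" for i
  proof -
    have "t \<le> q $ i / p $ i" unfolding t_def by (rule Min_le) auto
    then show ?thesis using p[of i] by (simp add: field_simps)
  qed
  have "t \<in> range (\<lambda>i. q $ i / p $ i)" unfolding t_def by (rule Min_in) auto
  then obtain i where "t = q $ i / p $ i" by blast
  then have i: "q $ i - t * p $ i = 0" using p[of i] by simp
  have "(q - t *\<^sub>R p) v* A = l *\<^sub>R (q - t *\<^sub>R p)"
    using q(3) left \<open>m = l\<close>
    by (simp add: vector_matrix_mult_diff_distrib scaleR_vector_matrix_assoc algebra_simps)
  then have "q - t *\<^sub>R p = 0"
    using nonneg_eigenvector_positive[OF A, of "q - t *\<^sub>R p" l i] t i
    by (cases "q - t *\<^sub>R p = 0") auto
  then have "q = t *\<^sub>R p" by simp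
  moreover have "t = 1" using q(2) mass_p unfolding \<open>q = t *\<^sub>R p\<close> mass_linear by simp
  ultimately show "q = p" by simp
qed

text \<open>The vector of absolute values satisfies \<open>|z| |v| \<le> A |v|\<close> coordinatewise; pairing with the positive
left eigenvector \<open>p\<close> turns this into \<open>|z| \<le> l\<close>.\<close>

lemma complex_eigenvalue_bound:
  assumes "complex_eigenvalue A z"
  shows "cmod z \<le> l"
proof -
  obtain v :: "complex^'k" where v: "v \<noteq> 0" "map_matrix complex_of_real A *v v = z *s v"
    using assms by (auto simp: complex_eigenvalue_def)
  have "cmod z * cmod (v $ i) \<le> (\<Sum>j\<in>UNIV. A $ i $ j * cmod (v $ j))" for i
  proof -
    have "z * v $ i = (\<Sum>j\<in>UNIV. complex_of_real (A $ i $ j) * v $ j)"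
      using arg_cong[OF v(2), of "\<lambda>x. x $ i"] by (simp add: matrix_vector_mult_def map_matrix_def)
    then have "cmod z * cmod (v $ i) = cmod (\<Sum>j\<in>UNIV. complex_of_real (A $ i $ j) * v $ j)"
      by (metis norm_mult)
    also have "\<dots> \<le> (\<Sum>j\<in>UNIV. A $ i $ j * cmod (v $ j))"
      by (rule order_trans[OF norm_sum]) (simp add: norm_mult nonneg)
    finally show ?thesis .
  qed
  then have "(\<Sum>i\<in>UNIV. p $ i * (cmod z * cmod (v $ i)))
      \<le> (\<Sum>i\<in>UNIV. p $ i * (\<Sum>j\<in>UNIV. A $ i $ j * cmod (v $ j)))"
    using p by (intro sum_mono mult_left_mono) (auto simp: less_imp_le)
  also have "\<dots> = (\<Sum>j\<in>UNIV. (\<Sum>i\<in>UNIV. p $ i * A $ i $ j) * cmod (v $ j))"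
    unfolding sum_distrib_left sum_distrib_right by (subst sum.swap) (simp add: mult_ac)
  also have "\<dots> = l * (\<Sum>i\<in>UNIV. p $ i * cmod (v $ i))"
    by (simp add: left_sum sum_distrib_left mult_ac)
  finally have le: "cmod z * (\<Sum>i\<in>UNIV. p $ i * cmod (v $ i)) \<le> l * (\<Sum>i\<in>UNIV. p $ i * cmod (v $ i))"
    by (simp add: sum_distrib_left mult_ac)
  obtain i where "v $ i \<noteq> 0" using v(1) by (metis vec_eq_iff zero_index)
  then have "0 < (\<Sum>i\<in>UNIV. p $ i * cmod (v $ i))"
    using p by (intro sum_pos2[where i=i]) (auto simp: less_imp_le)
  then show ?thesis using le by simp
qed

lemma complex_eigenvalue_l: "complex_eigenvalue A (complex_of_real l)"
proof -
  let ?v = "(\<chi> i. complex_of_real (u $ i))"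
  have "map_matrix complex_of_real A *v ?v = complex_of_real l *s ?v"
    by (simp add: vec_eq_iff matrix_vector_mult_def map_matrix_def right_sum
        flip: of_real_mult of_real_sum)
  moreover have "?v $ undefined \<noteq> 0" using u[of undefined] by simp
  then have "?v \<noteq> 0" by (metis zero_index)
  ultimately show ?thesis unfolding complex_eigenvalue_def by blast
qed

lemma dominant_eigenvalue_eq: "dominant_eigenvalue A = l"
proof -
  have "(THE l. complex_eigenvalue A (complex_of_real l) \<and>
                  (\<forall>z. complex_eigenvalue A z \<longrightarrow> Re z \<le> l)) = l"
  proof (rule the_equality)
    show "complex_eigenvalue A (complex_of_real l) \<and> (\<forall>z. complex_eigenvalue A z \<longrightarrow> Re z \<le> l)"
      using complex_eigenvalue_l complex_eigenvalue_bound complex_Re_le_cmod order_trans by blast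
  next
    fix m assume m: "complex_eigenvalue A (complex_of_real m) \<and> (\<forall>z. complex_eigenvalue A z \<longrightarrow> Re z \<le> m)"
    then have "l \<le> m" using complex_eigenvalue_l by force
    moreover have "m \<le> l" using m complex_eigenvalue_bound[of "complex_of_real m"] by simp
    ultimately show "m = l" by simp
  qed
  then show ?thesis using A by (simp add: dominant_eigenvalue_def)
qed

lemma left_perron_vector_eq: "left_perron_vector A = p"
proof -
  have "(THE q. q v* A = l *\<^sub>R q \<and> (\<forall>i. 0 < q $ i) \<and> mass q = 1) = p"
    using left p mass_p by (intro the_equality) (auto simp: less_imp_le intro: left_eigenvector_unique(1))
  then show ?thesis using A by (simp add: left_perron_vector_def dominant_eigenvalue_eq)
qed

section \<open>Relaxation to the Perron vector\<close>

text \<open>A perturbation that vanishes in the limit is eventually absorbed by the contraction as long as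
\<open>V \<ge> r / 2\<close>. The positive part of \<open>V - r / 2\<close> then shrinks by the factors \<open>1 - a / (n + 1)\<close>, whose
product is zero because the harmonic series diverges.\<close>

lemma (in -) relaxation_tendsto_0:
  fixes V :: "nat \<Rightarrow> real"
  assumes nonneg: "\<And>n. 0 \<le> V n" and a: "0 < a" and h: "h \<longlonglongrightarrow> 0"
    and rec: "\<And>n. n \<ge> 1 \<Longrightarrow> V (Suc n) \<le> (1 - a / (real n + 1)) * V n + h n / (real n + 1)"
  shows "V \<longlonglongrightarrow> 0"
proof (rule LIMSEQ_I)
  fix r :: real assume r: "0 < r"
  have "\<forall>\<^sub>F n in sequentially. h n < a * (r / 2)"
    using r a by (intro order_tendstoD(2)[OF h]) simp
  then obtain N1 where N1: "\<And>n. n \<ge> N1 \<Longrightarrow> h n < a * (r / 2)"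
    by (auto simp: eventually_sequentially)
  \<comment> \<open>From \<open>N2\<close> on the contraction factor is nonnegative.\<close>
  obtain N2 :: nat where N2: "a \<le> N2" using real_arch_simple by blast
  define N where "N = max (max N1 N2) 1"
  define U where "U = (\<lambda>n. max 0 (V n - r / 2))"
  have U: "U (Suc n) \<le> (1 - a / (real n + 1)) * U n" if n: "n \<ge> N" for n
  proof -
    have f: "0 \<le> 1 - a / (real n + 1)" using n N2 by (simp add: N_def)
    have "h n / (real n + 1) \<le> a * (r / 2) / (real n + 1)"
      using N1[of n] n by (intro divide_right_mono) (auto simp: N_def less_imp_le)
    moreover have "V (Suc n) \<le> (1 - a / (real n + 1)) * V n + h n / (real n + 1)"
      using n by (intro rec) (simp add: N_def)
    ultimately have "V (Suc n) - r / 2 \<le> (1 - a / (real n + 1)) * V n + a * (r / 2) / (real n + 1) - r / 2"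
      by linarith
    also have "\<dots> = (1 - a / (real n + 1)) * (V n - r / 2)" by (simp add: algebra_simps)
    also have "\<dots> \<le> (1 - a / (real n + 1)) * U n" using f by (intro mult_left_mono) (auto simp: U_def)
    finally show ?thesis using f by (simp add: U_def)
  qed
  have decay: "U (N + k) \<le> U N * exp (- a * (\<Sum>i<k. 1 / real (N + i + 1)))" for k
  proof (induction k)
    case (Suc k)
    have "U (N + Suc k) \<le> (1 - a / real (N + k + 1)) * U (N + k)" using U[of "N + k"] by (simp add: add_ac)
    also have "\<dots> \<le> exp (- a / real (N + k + 1)) * (U N * exp (- a * (\<Sum>i<k. 1 / real (N + i + 1))))"
      using Suc exp_ge_add_one_self[of "- a / real (N + k + 1)"]
      by (intro mult_mono) (auto simp: U_def)
    also have "\<dots> = U N * exp (- a * (\<Sum>i<Suc k. 1 / real (N + i + 1)))"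
      by (simp add: exp_add[symmetric] algebra_simps)
    finally show ?case .
  qed simp
  have "(\<Sum>i<k. 1 / real (i + (N + 1))) = - harm N + harm (k + N)" for k
    by (induction k) (simp_all add: harm_Suc inverse_eq_divide add_ac)
  moreover have "filterlim (\<lambda>k. - harm N + harm (k + N) :: real) at_top sequentially"
    by (intro filterlim_tendsto_add_at_top[OF tendsto_const] filterlim_compose[OF harm_at_top]
        filterlim_add_const_nat_at_top)
  ultimately have "filterlim (\<lambda>k. \<Sum>i<k. 1 / real (i + (N + 1))) at_top sequentially"
    by simp
  then have "filterlim (\<lambda>k. a * (\<Sum>i<k. 1 / real (i + (N + 1)))) at_top sequentially"
    using a by (intro filterlim_tendsto_pos_mult_at_top[OF tendsto_const])
  then have "filterlim (\<lambda>k. - (a * (\<Sum>i<k. 1 / real (i + (N + 1))))) at_bot sequentially"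
    by (simp add: filterlim_uminus_at_top)
  then have "(\<lambda>k. exp (- (a * (\<Sum>i<k. 1 / real (i + (N + 1)))))) \<longlonglongrightarrow> 0"
    by (intro filterlim_compose[OF exp_at_bot])
  then have "(\<lambda>k. U N * exp (- (a * (\<Sum>i<k. 1 / real (i + (N + 1)))))) \<longlonglongrightarrow> U N * 0"
    by (intro tendsto_intros)
  then have "\<forall>\<^sub>F k in sequentially. U N * exp (- (a * (\<Sum>i<k. 1 / real (i + (N + 1))))) < r / 2"
    using r by (intro order_tendstoD(2)) auto
  then obtain k0 where k0: "\<And>k. k \<ge> k0 \<Longrightarrow> U N * exp (- (a * (\<Sum>i<k. 1 / real (i + (N + 1))))) < r / 2"
    by (auto simp: eventually_sequentially)
  have "V n < r" if n: "n \<ge> N + k0" for n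
  proof -
    have "U n \<le> U N * exp (- (a * (\<Sum>i<n - N. 1 / real (i + (N + 1)))))"
      using decay[of "n - N"] n by (simp add: add_ac)
    also have "\<dots> < r / 2" using n by (intro k0) simp
    finally show ?thesis unfolding U_def by linarith
  qed
  then show "\<exists>no. \<forall>n\<ge>no. norm (V n - 0) < r" using nonneg by auto
qed

text \<open>The inner product in \<open>L\<^sup>2(\<mu>)\<close> of the densities \<open>x\<^sub>i / p\<^sub>i\<close> and \<open>y\<^sub>i / p\<^sub>i\<close>, where \<open>\<mu>\<^sub>i = p\<^sub>i u\<^sub>i\<close> is an invariant
measure of the Markov chain with transition matrix \<open>A\<^sub>i\<^sub>j u\<^sub>j / (l u\<^sub>i)\<close>.\<close>

definition perron_form :: "real^'k \<Rightarrow> real^'k \<Rightarrow> real" where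
  "perron_form x y = (\<Sum>i\<in>UNIV. u $ i / p $ i * x $ i * y $ i)"

lemma bounded_bilinear_perron_form: "bounded_bilinear perron_form"
proof -
  have "bilinear perron_form"
    unfolding bilinear_def perron_form_def
    by (auto intro!: linearI simp: distrib_left distrib_right sum.distrib sum_distrib_left
        add_divide_distrib mult_ac)
  then show ?thesis by (simp add: bilinear_conv_bounded_bilinear)
qed

lemma perron_form_commute: "perron_form x y = perron_form y x"
  by (simp add: perron_form_def mult_ac)

lemma perron_form_nonneg: "0 \<le> perron_form x x"
  unfolding perron_form_def using p u by (intro sum_nonneg) (simp add: less_imp_le mult.assoc)

lemma perron_form_pos: "x \<noteq> 0 \<Longrightarrow> 0 < perron_form x x"
proof -
  assume "x \<noteq> 0"
  then obtain i where "x $ i \<noteq> 0" by (metis vec_eq_iff zero_index)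
  then have "0 < u $ i / p $ i * x $ i * x $ i"
    unfolding mult.assoc using p[of i] u[of i] not_real_square_gt_zero[of "x $ i"]
    by (intro mult_pos_pos[of "u $ i / p $ i"] divide_pos_pos) blast+
  then show ?thesis
    unfolding perron_form_def using p u
    by (intro sum_pos2[where i=i]) (auto simp: less_imp_le mult.assoc)
qed

text \<open>The Dirichlet form identity. The matrix \<open>m\<^sub>i\<^sub>j = p\<^sub>i A\<^sub>i\<^sub>j u\<^sub>j\<close> has row and column sums \<open>l p\<^sub>i u\<^sub>i\<close>, so expanding
\<open>\<Sum> m\<^sub>i\<^sub>j (f\<^sub>i - f\<^sub>j)\<^sup>2\<close> produces both terms on the left.\<close>

lemma perron_form_drift:
  "perron_form v (v v* A - l *\<^sub>R v) =
     - (1/2) * (\<Sum>i\<in>UNIV. \<Sum>j\<in>UNIV. p $ i * A $ i $ j * u $ j * (v $ i / p $ i - v $ j / p $ j)\<^sup>2)"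
proof -
  define f where "f = (\<lambda>i. v $ i / p $ i)"
  define m where "m = (\<lambda>i j. p $ i * A $ i $ j * u $ j)"
  have v: "v $ i = p $ i * f i" for i using p[of i] by (simp add: f_def)
  have row: "(\<Sum>j\<in>UNIV. m i j) = l * p $ i * u $ i" for i
    using right_sum[of i] by (simp add: m_def mult.assoc sum_distrib_left[symmetric])
  have col: "(\<Sum>i\<in>UNIV. m i j) = l * p $ j * u $ j" for j
    using left_sum[of j] by (simp add: m_def sum_distrib_right[symmetric])
  have p0: "p $ i \<noteq> 0" for i using p[of i] by simp
  have a: "perron_form v (v v* A) = (\<Sum>i\<in>UNIV. \<Sum>j\<in>UNIV. m i j * (f i * f j))"
    unfolding perron_form_def vec_mat_component sum_distrib_left
    by (subst sum.swap) (simp add: v m_def p0 mult_ac)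
  have b: "perron_form v (l *\<^sub>R v) = (\<Sum>i\<in>UNIV. l * p $ i * u $ i * (f i)\<^sup>2)"
    unfolding perron_form_def by (simp add: v p0 power2_eq_square mult_ac)
  have c: "(\<Sum>i\<in>UNIV. \<Sum>j\<in>UNIV. m i j * (f i)\<^sup>2) = perron_form v (l *\<^sub>R v)"
    by (simp add: b row sum_distrib_right[symmetric])
  have d: "(\<Sum>i\<in>UNIV. \<Sum>j\<in>UNIV. m i j * (f j)\<^sup>2) = perron_form v (l *\<^sub>R v)"
    by (subst sum.swap) (simp add: b col sum_distrib_right[symmetric])
  have "(\<Sum>i\<in>UNIV. \<Sum>j\<in>UNIV. m i j * (f i - f j)\<^sup>2) =
      (\<Sum>i\<in>UNIV. \<Sum>j\<in>UNIV. m i j * (f i)\<^sup>2) + (\<Sum>i\<in>UNIV. \<Sum>j\<in>UNIV. m i j * (f j)\<^sup>2)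
      - 2 * (\<Sum>i\<in>UNIV. \<Sum>j\<in>UNIV. m i j * (f i * f j))"
    unfolding sum.distrib[symmetric] sum_subtractf[symmetric] sum_distrib_left
    by (intro sum.cong) (auto simp: power2_diff algebra_simps)
  also have "\<dots> = 2 * perron_form v (l *\<^sub>R v) - 2 * perron_form v (v v* A)"
    unfolding a c d by simp
  finally show ?thesis
    unfolding bounded_bilinear.diff_right[OF bounded_bilinear_perron_form]
    by (simp add: m_def f_def diff_divide_distrib)
qed

text \<open>If the Dirichlet form vanishes, \<open>f\<^sub>i = v\<^sub>i / p\<^sub>i\<close> is constant along edges, hence constant by irreducibility, so
\<open>v\<close> is a multiple of \<open>p\<close>; the condition \<open>v \<bullet> u = 0\<close> leaves only \<open>v = 0\<close>.\<close>

lemma perron_form_drift_neg: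
  assumes v: "v \<bullet> u = 0" "v \<noteq> 0"
  shows "perron_form v (v v* A - l *\<^sub>R v) < 0"
proof (rule ccontr)
  let ?e = "\<lambda>i j. p $ i * A $ i $ j * u $ j * (v $ i / p $ i - v $ j / p $ j)\<^sup>2"
  assume "\<not> ?thesis"
  then have "(\<Sum>i\<in>UNIV. \<Sum>j\<in>UNIV. ?e i j) \<le> 0" unfolding perron_form_drift by simp
  moreover have e: "0 \<le> ?e i j" for i j
    using p u nonneg by (simp add: less_imp_le)
  ultimately have "(\<Sum>i\<in>UNIV. \<Sum>j\<in>UNIV. ?e i j) = 0"
    by (meson order_antisym sum_nonneg)
  then have "\<forall>i. (\<Sum>j\<in>UNIV. ?e i j) = 0"
    using e by (subst (asm) sum_nonneg_eq_0_iff) (auto intro: sum_nonneg)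
  then have "?e i j = 0" for i j
    using e[of i] by (metis (no_types, lifting) UNIV_I finite sum_nonneg_eq_0_iff)
  then have edge: "v $ i / p $ i = v $ j / p $ j" if "0 < A $ i $ j" for i j
    using that p[of i] u[of j] by (metis (no_types, lifting) less_irrefl mult_eq_0_iff power_eq_0_iff eq_iff_diff_eq_0)
  have path: "v $ i / p $ i = v $ j / p $ j" if "0 < matrix_power A n $ i $ j" for n i j
    using that
  proof (induction n arbitrary: j)
    case 0
    then show ?case by (simp add: mat_def split: if_splits)
  next
    case (Suc n)
    then have "0 < (\<Sum>k\<in>UNIV. matrix_power A n $ i $ k * A $ k $ j)"
      by (simp add: matrix_matrix_mult_def)
    then obtain k where "matrix_power A n $ i $ k * A $ k $ j \<noteq> 0"
      using sum.neutral[of UNIV "\<lambda>k. matrix_power A n $ i $ k * A $ k $ j"] by force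
    moreover have "0 \<le> matrix_power A n $ i $ k" "0 \<le> A $ k $ j"
      using A nonneg by (auto intro!: matrix_power_nonneg simp: irreducible_matrix_def)
    ultimately have "0 < matrix_power A n $ i $ k" "0 < A $ k $ j" by auto
    then show ?case using Suc.IH edge by metis
  qed
  define c where "c = v $ undefined / p $ undefined"
  have c: "v $ i / p $ i = c" for i
    using path A unfolding c_def irreducible_matrix_def by metis
  have vc: "v $ i = c * p $ i" for i using c[of i] p[of i] by (simp add: field_simps)
  have "0 = c * (\<Sum>i\<in>UNIV. p $ i * u $ i)"
    using v(1) by (simp add: inner_vec_def vc sum_distrib_left mult_ac)
  moreover have "0 < (\<Sum>i\<in>UNIV. p $ i * u $ i)" using p u by (intro sum_pos) auto
  ultimately have "c = 0" by auto
  then have "v = 0" using vc by (simp add: vec_eq_iff)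
  then show False using v(2) by simp
qed

lemma perron_form_coercive:
  obtains m where "0 < m" "\<And>x. m * (norm x)\<^sup>2 \<le> perron_form x x"
proof -
  define m where "m = Min (range (\<lambda>i. u $ i / p $ i))"
  have "m \<in> range (\<lambda>i. u $ i / p $ i)" unfolding m_def by (rule Min_in) auto
  then have "0 < m" using p u by auto
  moreover have "m * (norm x)\<^sup>2 \<le> perron_form x x" for x
  proof -
    have "m * (norm x)\<^sup>2 = (\<Sum>i\<in>UNIV. m * (x $ i * x $ i))"
      unfolding power2_norm_eq_inner inner_vec_def by (simp add: sum_distrib_left)
    also have "\<dots> \<le> perron_form x x"
      unfolding perron_form_def mult.assoc
      by (intro sum_mono mult_right_mono) (auto simp: m_def)
    finally show ?thesis .
  qed
  ultimately show thesis using that by blast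
qed

text \<open>By homogeneity it is enough to bound the quotient of the two quadratic forms on the unit sphere of the
hyperplane, where it attains its minimum.\<close>

lemma perron_form_spectral_gap:
  obtains g where "0 < g" "\<And>v. v \<bullet> u = 0 \<Longrightarrow> perron_form v (v v* A - l *\<^sub>R v) \<le> - g * perron_form v v"
proof -
  let ?S = "sphere 0 1 \<inter> {v. v \<bullet> u = 0}"
  let ?q = "\<lambda>v. - perron_form v (v v* A - l *\<^sub>R v) / perron_form v v"
  show thesis
  \<comment> \<open>The hyperplane is trivial when there is only one color.\<close>
  proof (cases "?S = {}")
    case True
    have "v = 0" if "v \<bullet> u = 0" for v
    proof (rule ccontr)
      assume "v \<noteq> 0"
      then have "v /\<^sub>R norm v \<in> ?S" using that by simp
      then show False using True by blast
    qed
    then have "perron_form v (v v* A - l *\<^sub>R v) \<le> - 1 * perron_form v v" if "v \<bullet> u = 0" for v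
      using that by (metis perron_form_nonneg bounded_bilinear.zero_left[OF bounded_bilinear_perron_form] mult_zero_right order_refl)
    then show thesis by (intro that[of 1]) auto
  next
    case False
    have W0: "perron_form v v \<noteq> 0" if "v \<in> ?S" for v using that perron_form_pos[of v] by force
    have "compact ?S"
      by (intro compact_Int_closed compact_sphere closed_Collect_eq continuous_intros)
    moreover have "continuous_on ?S ?q"
      using W0 by (intro continuous_on_divide continuous_on_minus continuous_on_diff continuous_on_scaleR continuous_on_const
          continuous_on_id continuous_on_vec_mat bounded_bilinear.continuous_on[OF bounded_bilinear_perron_form]) auto
    ultimately obtain w where w: "w \<in> ?S" "\<And>v. v \<in> ?S \<Longrightarrow> ?q w \<le> ?q v"
      using continuous_attains_inf[of ?S ?q] False by blast
    have w0: "w \<noteq> 0" using w by auto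
    have pos: "0 < ?q w" using perron_form_drift_neg[of w] perron_form_pos[OF w0] w w0 by (intro divide_pos_pos) auto
    have "perron_form v (v v* A - l *\<^sub>R v) \<le> - ?q w * perron_form v v" if v: "v \<bullet> u = 0" for v
    proof (cases "v = 0")
      case True then show ?thesis by (simp add: perron_form_def)
    next
      case v0: False
      define r where "r = 1 / norm v"
      have r: "r \<noteq> 0" using v0 by (simp add: r_def)
      have "r *\<^sub>R v \<in> ?S" using v v0 by (simp add: r_def)
      then have "?q w \<le> ?q (r *\<^sub>R v)" by (rule w)
      also have "(r *\<^sub>R v) v* A - l *\<^sub>R (r *\<^sub>R v) = r *\<^sub>R (v v* A - l *\<^sub>R v)"
        by (simp add: scaleR_vector_matrix_assoc algebra_simps)
      also have "- perron_form (r *\<^sub>R v) (r *\<^sub>R (v v* A - l *\<^sub>R v)) / perron_form (r *\<^sub>R v) (r *\<^sub>R v) = ?q v"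
        using r by (simp add: bounded_bilinear.scaleR_left[OF bounded_bilinear_perron_form]
            bounded_bilinear.scaleR_right[OF bounded_bilinear_perron_form] del: scaleR_right_diff_distrib)
      finally show ?thesis using perron_form_pos[OF v0] by (simp add: field_simps)
    qed
    then show thesis using pos by (intro that[of "?q w"]) auto
  qed
qed

text \<open>The squared distance \<open>V\<close> to the limit, measured by \<open>perron_form\<close>, satisfies the hypothesis of
\<open>relaxation_tendsto_0\<close>: the spectral gap gives the contraction, and all remaining terms of the expanded square
carry a second factor \<open>1 / (n + 1)\<close> or the vanishing error \<open>e\<close>.\<close>

lemma relaxed_iteration_tendsto:
  assumes normalized: "\<And>n. n \<ge> 1 \<Longrightarrow> z n \<bullet> u = 1"
    and bounded: "\<And>n. n \<ge> 1 \<Longrightarrow> norm (z n) \<le> r"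
    and step: "\<And>n. n \<ge> 1 \<Longrightarrow>
      z (Suc n) = z n + (b n / (real n + 1)) *\<^sub>R (z n v* A - l *\<^sub>R z n) + (1 / (real n + 1)) *\<^sub>R e n"
    and b: "0 < a" "\<And>n. n \<ge> 1 \<Longrightarrow> a \<le> b n" "\<And>n. n \<ge> 1 \<Longrightarrow> b n \<le> B"
    and e: "e \<longlonglongrightarrow> 0"
  shows "z \<longlonglongrightarrow> p /\<^sub>R (p \<bullet> u)"
proof -
  interpret perron_form: bounded_bilinear perron_form by (rule bounded_bilinear_perron_form)
  obtain g where g: "0 < g" "\<And>v. v \<bullet> u = 0 \<Longrightarrow> perron_form v (v v* A - l *\<^sub>R v) \<le> - g * perron_form v v"
    using perron_form_spectral_gap by blast
  obtain K where K: "0 < K" "\<And>x y. norm (perron_form x y) \<le> norm x * norm y * K"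
    using perron_form.pos_bounded by blast
  define L where "L = (\<lambda>x. x v* A - l *\<^sub>R x)"
  have linL: "linear L"
    unfolding L_def by (intro linearI) (auto simp: algebra_simps scaleR_vector_matrix_assoc)
  obtain KL where KL: "0 < KL" "\<And>x. norm (L x) \<le> KL * norm x"
    using linear_bounded_pos[OF linL] by blast
  define q where "q = p /\<^sub>R (p \<bullet> u)"
  have pu: "0 < p \<bullet> u" unfolding inner_vec_def using p u by (intro sum_pos) auto
  have qu: "q \<bullet> u = 1" using pu by (simp add: q_def)
  have Lq: "L q = 0" by (simp add: L_def q_def scaleR_vector_matrix_assoc left)
  define v where "v = (\<lambda>n. z n - q)"
  have Lv: "L (v n) = L (z n)" for n
    unfolding v_def by (simp add: linear_diff[OF linL] Lq)
  have vu: "v n \<bullet> u = 0" if "n \<ge> 1" for n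
    using normalized[OF that] qu by (simp add: v_def inner_diff_left)
  define V where "V = (\<lambda>n. perron_form (v n) (v n))"
  define s where "s = r + norm q"
  have vb: "norm (v n) \<le> s" if "n \<ge> 1" for n
    unfolding v_def s_def using bounded[OF that] norm_triangle_ineq4[of "z n" q] by simp
  have Lb: "norm (L (v n)) \<le> KL * s" if "n \<ge> 1" for n
    using KL(2)[of "v n"] vb[OF that] KL(1) by (meson mult_left_mono less_imp_le order_trans)
  have bpos: "0 \<le> b n" if "n \<ge> 1" for n using b(1) b(2)[OF that] by simp
  have B0: "0 \<le> B" using b(3)[of 1] bpos[of 1] by simp
  define h where "h = (\<lambda>n. B\<^sup>2 * (K * (KL * s)\<^sup>2) / (real n + 1)
      + 2 * (K * (s + B * (KL * s))) * norm (e n) + K * (norm (e n))\<^sup>2)"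
  have "(\<lambda>n. B\<^sup>2 * (K * (KL * s)\<^sup>2) / (real n + 1)) \<longlonglongrightarrow> 0"
    by real_asymp
  then have h: "h \<longlonglongrightarrow> B\<^sup>2 * (K * (KL * s)\<^sup>2) * 0 + 2 * (K * (s + B * (KL * s))) * norm (0::real^'k) + K * (norm (0::real^'k))\<^sup>2"
    unfolding h_def by (intro tendsto_intros e) (simp add: add.commute)
  have rec: "V (Suc n) \<le> (1 - 2 * g * a / (real n + 1)) * V n + h n / (real n + 1)" if n: "n \<ge> 1" for n
  proof -
    let ?t = "1 / (real n + 1)"
    have t: "0 < ?t" "?t \<le> 1" by auto
    have vS: "v (Suc n) = v n + (b n * ?t) *\<^sub>R L (v n) + ?t *\<^sub>R e n"
      unfolding Lv using step[OF n] by (simp add: v_def L_def)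
    let ?x = "v n + (b n * ?t) *\<^sub>R L (v n)"
    have "V (Suc n) = perron_form ?x ?x + 2 * ?t * perron_form ?x (e n) + ?t\<^sup>2 * perron_form (e n) (e n)"
      unfolding V_def vS
      by (simp only: perron_form.add_left perron_form.add_right perron_form.scaleR_left perron_form.scaleR_right real_scaleR_def)
         (simp add: perron_form_commute[of "e n" "v n"] perron_form_commute[of "e n" "L (v n)"] power2_eq_square algebra_simps)
    also have "perron_form ?x ?x = V n + 2 * (b n * ?t) * perron_form (v n) (L (v n)) + (b n * ?t)\<^sup>2 * perron_form (L (v n)) (L (v n))"
      unfolding V_def
      by (simp only: perron_form.add_left perron_form.add_right perron_form.scaleR_left perron_form.scaleR_right real_scaleR_def)
         (simp add: perron_form_commute[of "L (v n)" "v n"] power2_eq_square algebra_simps)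
    finally have VS: "V (Suc n) = V n + 2 * (b n * ?t) * perron_form (v n) (L (v n))
       + ((b n)\<^sup>2 * ?t * perron_form (L (v n)) (L (v n)) + 2 * perron_form ?x (e n) + ?t * perron_form (e n) (e n)) * ?t"
      by (simp add: power2_eq_square algebra_simps)
    have "2 * (b n * ?t) * perron_form (v n) (L (v n)) \<le> 2 * (b n * ?t) * (- g * V n)"
      using g(2)[OF vu[OF n]] bpos[OF n] t unfolding V_def L_def by (intro mult_left_mono) auto
    also have "\<dots> = - (b n * (2 * ?t * g * V n))" by simp
    also have "\<dots> \<le> - (a * (2 * ?t * g * V n))"
      using b(2)[OF n] t g(1) perron_form_nonneg[of "v n"] unfolding V_def
      by (intro le_imp_neg_le mult_right_mono mult_nonneg_nonneg) auto
    finally have 1: "2 * (b n * ?t) * perron_form (v n) (L (v n)) \<le> - (2 * g * a * ?t * V n)"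
      by (simp add: mult_ac)
    have Kb: "perron_form x y \<le> K * (c * d)" if "norm x \<le> c" "norm y \<le> d" for x y c d
    proof -
      have "perron_form x y \<le> norm x * norm y * K" using K(2)[of x y] by simp
      also have "\<dots> \<le> c * d * K"
        using that K(1) norm_ge_zero[of x] norm_ge_zero[of y]
        by (intro mult_right_mono mult_mono) linarith+
      finally show ?thesis by (simp add: mult_ac)
    qed
    have "(b n)\<^sup>2 * ?t * perron_form (L (v n)) (L (v n)) \<le> B\<^sup>2 * ?t * (K * (KL * s * (KL * s)))"
      using Kb[OF Lb[OF n] Lb[OF n]] b(3)[OF n] bpos[OF n] perron_form_nonneg t
      by (intro mult_mono power_mono) auto
    moreover have "norm ?x \<le> s + B * (KL * s)"
    proof -
      have "norm ?x \<le> norm (v n) + norm ((b n * ?t) *\<^sub>R L (v n))" by (rule norm_triangle_ineq)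
      also have "norm ((b n * ?t) *\<^sub>R L (v n)) = b n * ?t * norm (L (v n))"
        using bpos[OF n] t by simp
      also have "\<dots> \<le> B * 1 * (KL * s)"
        using Lb[OF n] b(3)[OF n] bpos[OF n] t B0 by (intro mult_mono) auto
      finally show ?thesis using vb[OF n] by simp
    qed
    then have "perron_form ?x (e n) \<le> K * ((s + B * (KL * s)) * norm (e n))" by (rule Kb) simp
    moreover have "?t * perron_form (e n) (e n) \<le> 1 * (K * (norm (e n) * norm (e n)))"
      using perron_form_nonneg[of "e n"] t K(1) Kb[of "e n" "norm (e n)" "e n" "norm (e n)"]
      by (intro mult_mono) auto
    ultimately have "(b n)\<^sup>2 * ?t * perron_form (L (v n)) (L (v n)) + 2 * perron_form ?x (e n) + ?t * perron_form (e n) (e n) \<le> h n"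
      unfolding h_def power2_eq_square by (simp add: algebra_simps)
    then have "((b n)\<^sup>2 * ?t * perron_form (L (v n)) (L (v n)) + 2 * perron_form ?x (e n) + ?t * perron_form (e n) (e n)) * ?t \<le> h n * ?t"
      using t by (intro mult_right_mono) auto
    then show ?thesis using VS 1 by (simp add: algebra_simps)
  qed
  have "V \<longlonglongrightarrow> 0"
    using h by (intro relaxation_tendsto_0[of V "2 * g * a" h]) (use rec g(1) b(1) perron_form_nonneg in \<open>auto simp: V_def\<close>)
  obtain m where m: "0 < m" "\<And>x. m * (norm x)\<^sup>2 \<le> perron_form x x"
    using perron_form_coercive by blast
  have "(\<lambda>n. norm (v n)) \<longlonglongrightarrow> 0"
  proof -
    have "(\<lambda>n. (norm (v n))\<^sup>2) \<longlonglongrightarrow> 0"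
    proof (rule tendsto_sandwich[OF _ _ tendsto_const])
      show "(\<lambda>n. V n / m) \<longlonglongrightarrow> 0" using tendsto_divide[OF \<open>V \<longlonglongrightarrow> 0\<close> tendsto_const[of m]] m by simp
      show "\<forall>\<^sub>F n in sequentially. (norm (v n))\<^sup>2 \<le> V n / m"
        using m by (auto simp: V_def field_simps)
    qed auto
    then show ?thesis using tendsto_real_sqrt[of "\<lambda>n. (norm (v n))\<^sup>2" 0] by simp
  qed
  then show ?thesis unfolding v_def q_def tendsto_norm_zero_iff by (simp add: LIM_zero_iff)
qed


text \<open>With \<open>t\<^sub>n = x\<^sub>n \<bullet> u\<close>, \<open>s\<^sub>n = x\<^sub>n A 1\<close> and \<open>z\<^sub>n = x\<^sub>n / t\<^sub>n\<close>, the rule \<open>(n + 1) x\<^sub>n\<^sub>+\<^sub>1 = n x\<^sub>n + Y\<^sub>n\<close> becomes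
\<open>z\<^sub>n\<^sub>+\<^sub>1 - z\<^sub>n = (Y\<^sub>n - (Y\<^sub>n \<bullet> u) z\<^sub>n) / ((n + 1) t\<^sub>n\<^sub>+\<^sub>1)\<close>. This is an exact identity, and
inserting \<open>Y\<^sub>n = x\<^sub>n A / s\<^sub>n + o(1)\<close> makes the main term a multiple of \<open>z\<^sub>n A - l z\<^sub>n\<close>, the drift in
\<open>relaxed_iteration_tendsto\<close>. The step sizes are comparable to \<open>1/n\<close> because \<open>t\<close> and \<open>s\<close> are bounded away from
zero and infinity on the simplex.\<close>

lemma averaged_urn_limit:
  fixes C Y :: "nat \<Rightarrow> real^'k"
  defines "x \<equiv> \<lambda>n. (\<Sum>k<n. Y k) /\<^sub>R real n"
  assumes Y: "\<And>n. Y n \<in> prob_simplex"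
    and C: "\<And>n. C n = mass (C n) *\<^sub>R Y n" "\<And>n. 0 < mass (C n)"
    and lim: "(\<lambda>n. C n /\<^sub>R real n - x n v* A) \<longlonglongrightarrow> 0"
  shows "x \<longlonglongrightarrow> p" "Y \<longlonglongrightarrow> p" "(\<lambda>n. mass (C n) / real n) \<longlonglongrightarrow> l"
proof -
  have xs: "x n \<in> prob_simplex" if "n \<ge> 1" for n
  proof -
    have "mass (\<Sum>k<n. Y k) = (\<Sum>k<n. mass (Y k))"
      unfolding sum_component by (rule sum.swap)
    also have "\<dots> = real n" using Y by (simp add: prob_simplex_def)
    finally show ?thesis
      using Y that unfolding x_def prob_simplex_def mem_Collect_eq mass_linear
      by (auto simp: prob_simplex_def intro!: mult_nonneg_nonneg sum_nonneg)
  qed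
  have xS: "(real n + 1) *\<^sub>R x (Suc n) = real n *\<^sub>R x n + Y n" for n
    unfolding x_def by (cases "n = 0") (simp_all add: add.commute)
  have cont: "continuous_on prob_simplex (\<lambda>y. y \<bullet> u)" "continuous_on prob_simplex (\<lambda>y. mass (y v* A))"
    by (intro continuous_on_inner continuous_on_const continuous_on_id continuous_on_sum
        continuous_on_component continuous_on_vec_mat)+
  have pos: "0 < y \<bullet> u" if "y \<in> prob_simplex" for y
  proof -
    have "y \<noteq> 0" using that by (auto simp: prob_simplex_def)
    then obtain i where "y $ i \<noteq> 0" by (metis vec_eq_iff zero_index)
    then show ?thesis
      unfolding inner_vec_def using that u
      by (intro sum_pos2[where i=i]) (auto simp: prob_simplex_def less_imp_le order_less_le)
  qed
  obtain a1 where a1: "a1 \<in> prob_simplex" "\<And>y. y \<in> prob_simplex \<Longrightarrow> a1 \<bullet> u \<le> y \<bullet> u"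
    using continuous_attains_inf[OF compact_prob_simplex prob_simplex_nonempty cont(1)] by blast
  obtain a2 where a2: "a2 \<in> prob_simplex" "\<And>y. y \<in> prob_simplex \<Longrightarrow> y \<bullet> u \<le> a2 \<bullet> u"
    using continuous_attains_sup[OF compact_prob_simplex prob_simplex_nonempty cont(1)] by blast
  obtain d1 where d1: "d1 \<in> prob_simplex" "\<And>y. y \<in> prob_simplex \<Longrightarrow> mass (d1 v* A) \<le> mass (y v* A)"
    using continuous_attains_inf[OF compact_prob_simplex prob_simplex_nonempty cont(2)] by blast
  obtain d2 where d2: "d2 \<in> prob_simplex" "\<And>y. y \<in> prob_simplex \<Longrightarrow> mass (y v* A) \<le> mass (d2 v* A)"
    using continuous_attains_sup[OF compact_prob_simplex prob_simplex_nonempty cont(2)] by blast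
  define m where "m = a1 \<bullet> u"
  define m' where "m' = a2 \<bullet> u"
  define d where "d = mass (d1 v* A)"
  define d' where "d' = mass (d2 v* A)"
  have m: "0 < m" "0 < m'" using pos a1 a2 by (auto simp: m_def m'_def)
  have d: "0 < d" "0 < d'"
    using mass_vec_mat_positive[OF A] d1(1) d2(1) unfolding d_def d'_def by blast+
  define t where "t = (\<lambda>n. x n \<bullet> u)"
  define s where "s = (\<lambda>n. mass (x n v* A))"
  have t: "m \<le> t n" "t n \<le> m'" if "n \<ge> 1" for n
    using a1(2)[OF xs[OF that]] a2(2)[OF xs[OF that]] by (auto simp: t_def m_def m'_def)
  have s: "d \<le> s n" "s n \<le> d'" if "n \<ge> 1" for n
    using d1(2)[OF xs[OF that]] d2(2)[OF xs[OF that]] by (auto simp: s_def d_def d'_def)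
  define c where "c = (\<lambda>n. C n /\<^sub>R real n)"
  have cY: "c n = mass (c n) *\<^sub>R Y n" for n
    using C(1)[of n] unfolding c_def mass_linear by (metis scaleR_scaleR)
  define err where "err = (\<lambda>n. Y n - (1 / s n) *\<^sub>R (x n v* A))"
  have lim': "(\<lambda>n. c n - x n v* A) \<longlonglongrightarrow> 0" using lim by (simp add: c_def)
  have limT: "(\<lambda>n. mass (c n - x n v* A)) \<longlonglongrightarrow> 0"
    using tendsto_sum[of UNIV "\<lambda>i n. (c n - x n v* A) $ i" "\<lambda>i. 0"] tendsto_vec_nth[OF lim']
    by fastforce
  have "err \<longlonglongrightarrow> 0"
  proof (rule Lim_null_comparison)
    show "(\<lambda>n. (norm (c n - x n v* A) + \<bar>mass (c n - x n v* A)\<bar>) / d) \<longlonglongrightarrow> 0"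
      using tendsto_divide[OF tendsto_add[OF tendsto_norm[OF lim'] tendsto_rabs[OF limT]] tendsto_const[of d]] d
      by simp
    have "norm (err n) \<le> (norm (c n - x n v* A) + \<bar>mass (c n - x n v* A)\<bar>) / d" if n: "n \<ge> 1" for n
    proof -
      have s0: "0 < s n" using s(1)[OF n] d by simp
      \<comment> \<open>As \<open>Y\<^sub>n\<close> is \<open>c\<^sub>n\<close> divided by its mass, \<open>s\<^sub>n err\<^sub>n\<close> involves only the vanishing vector \<open>c\<^sub>n - x\<^sub>n A\<close> and its mass.\<close>
      have "s n *\<^sub>R err n = (c n - x n v* A) - mass (c n - x n v* A) *\<^sub>R Y n"
        unfolding mass_linear s_def[symmetric] err_def using s0
        by (subst cY) (simp add: algebra_simps s_def)
      then have "s n * norm (err n) = norm ((c n - x n v* A) - mass (c n - x n v* A) *\<^sub>R Y n)"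
        using s0 by (metis abs_of_pos norm_scaleR)
      also have "\<dots> \<le> norm (c n - x n v* A) + \<bar>mass (c n - x n v* A)\<bar> * norm (Y n)"
        by (metis norm_triangle_ineq4 norm_scaleR)
      also have "\<dots> \<le> norm (c n - x n v* A) + \<bar>mass (c n - x n v* A)\<bar>"
        using prob_simplex_norm_le_1[OF Y[of n]] by (simp add: mult_left_le)
      finally have "s n * norm (err n) \<le> norm (c n - x n v* A) + \<bar>mass (c n - x n v* A)\<bar>" .
      moreover have "d * norm (err n) \<le> s n * norm (err n)"
        using s(1)[OF n] by (intro mult_right_mono) auto
      ultimately show ?thesis using d by (simp add: field_simps)
    qed
    then show "\<forall>\<^sub>F n in sequentially. norm (err n) \<le> (norm (c n - x n v* A) + \<bar>mass (c n - x n v* A)\<bar>) / d"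
      using eventually_sequentially by blast
  qed
  define z where "z = (\<lambda>n. (1 / t n) *\<^sub>R x n)"
  define b where "b = (\<lambda>n. t n / (s n * t (Suc n)))"
  define e where "e = (\<lambda>n. (1 / t (Suc n)) *\<^sub>R (err n - (err n \<bullet> u) *\<^sub>R z n))"
  have t0: "0 < t n" if "n \<ge> 1" for n using t(1)[OF that] m by simp
  have s0: "0 < s n" if "n \<ge> 1" for n using s(1)[OF that] d by simp
  have xz: "x n = t n *\<^sub>R z n" if "n \<ge> 1" for n using t0[OF that] by (simp add: z_def)
  have zb: "norm (z n) \<le> 1 / m" if "n \<ge> 1" for n
  proof -
    have "norm (z n) = norm (x n) / t n" using t0[OF that] by (simp add: z_def)
    also have "\<dots> \<le> 1 / m"
      using prob_simplex_norm_le_1[OF xs[OF that]] t(1)[OF that] m by (intro frac_le) auto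
    finally show ?thesis .
  qed
  have "z \<longlonglongrightarrow> p /\<^sub>R (p \<bullet> u)"
  proof (rule relaxed_iteration_tendsto)
    show "z n \<bullet> u = 1" if "n \<ge> 1" for n
      using t0[OF that] by (simp add: z_def t_def)
    show "norm (z n) \<le> 1 / m" if "n \<ge> 1" for n by (rule zb[OF that])
    show "0 < m / (d' * m')" using m d by simp
    show "m / (d' * m') \<le> b n" if n: "n \<ge> 1" for n
      unfolding b_def using m d t[OF n] s[OF n] t[of "Suc n"]
      by (intro frac_le mult_mono mult_pos_pos) auto
    show "b n \<le> m' / (d * m)" if n: "n \<ge> 1" for n
      unfolding b_def using m d t[OF n] s[OF n] t[of "Suc n"]
      by (intro frac_le mult_mono mult_pos_pos) auto
    show "e \<longlonglongrightarrow> 0"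
    proof (rule Lim_null_comparison)
      show "(\<lambda>n. (1 / m) * (norm (err n) + norm (err n) * norm u * (1 / m))) \<longlonglongrightarrow> 0"
      proof -
        have "(\<lambda>n. (1 / m) * (norm (err n) + norm (err n) * norm u * (1 / m)))
            \<longlonglongrightarrow> (1 / m) * (norm (0::real^'k) + norm (0::real^'k) * norm u * (1 / m))"
          by (intro tendsto_mult tendsto_add tendsto_const tendsto_norm \<open>err \<longlonglongrightarrow> 0\<close>)
        then show ?thesis by simp
      qed
      have "norm (e n) \<le> (1 / m) * (norm (err n) + norm (err n) * norm u * (1 / m))" if n: "n \<ge> 1" for n
      proof -
        have "norm (e n) = (1 / t (Suc n)) * norm (err n - (err n \<bullet> u) *\<^sub>R z n)"
          using t0[of "Suc n"] by (simp add: e_def)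
        also have "\<dots> \<le> (1 / m) * (norm (err n) + norm ((err n \<bullet> u) *\<^sub>R z n))"
          using t(1)[of "Suc n"] m by (intro mult_mono frac_le norm_triangle_ineq4) auto
        also have "norm ((err n \<bullet> u) *\<^sub>R z n) \<le> norm (err n) * norm u * (1 / m)"
          unfolding norm_scaleR using zb[OF n] Cauchy_Schwarz_ineq2[of "err n" u]
          by (intro mult_mono) auto
        finally show ?thesis using m by (simp add: divide_right_mono)
      qed
      then show "\<forall>\<^sub>F n in sequentially. norm (e n) \<le> (1 / m) * (norm (err n) + norm (err n) * norm u * (1 / m))"
        using eventually_sequentially by blast
    qed
    show "z (Suc n) = z n + (b n / (real n + 1)) *\<^sub>R (z n v* A - l *\<^sub>R z n) + (1 / (real n + 1)) *\<^sub>R e n"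
      if n: "n \<ge> 1" for n
    proof -
      let ?T = "(real n + 1) * t (Suc n)"
      have T: "0 < ?T" using t0[of "Suc n"] by simp
      have tS: "?T = real n * t n + Y n \<bullet> u"
        using arg_cong[OF xS[of n], of "\<lambda>v. v \<bullet> u"] by (simp add: t_def inner_add_left)
      have Yn: "Y n = (t n / s n) *\<^sub>R (z n v* A) + err n"
        unfolding err_def xz[OF n] by (simp add: scaleR_vector_matrix_assoc)
      have "z n \<bullet> u = 1" using t0[OF n] by (simp add: z_def t_def)
      then have Ynu: "Y n \<bullet> u = l * (t n / s n) + err n \<bullet> u"
        unfolding Yn by (simp add: inner_add_left dot_lmul_matrix right)
      have drift: "Y n - (Y n \<bullet> u) *\<^sub>R z n
          = (t n / s n) *\<^sub>R (z n v* A - l *\<^sub>R z n) + (err n - (err n \<bullet> u) *\<^sub>R z n)"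
        unfolding Ynu by (subst Yn) (simp add: algebra_simps)
      have "?T *\<^sub>R z (Suc n) = (real n + 1) *\<^sub>R x (Suc n)" by (simp add: xz)
      also have "\<dots> = ?T *\<^sub>R z n + (Y n - (Y n \<bullet> u) *\<^sub>R z n)"
        unfolding xS tS xz[OF n] by (simp add: algebra_simps)
      also note drift
      finally have "?T *\<^sub>R z (Suc n) = ?T *\<^sub>R z n
          + ((t n / s n) *\<^sub>R (z n v* A - l *\<^sub>R z n) + (err n - (err n \<bullet> u) *\<^sub>R z n))" .
      then have "(1 / ?T) *\<^sub>R (?T *\<^sub>R z (Suc n)) = (1 / ?T) *\<^sub>R (?T *\<^sub>R z n
          + ((t n / s n) *\<^sub>R (z n v* A - l *\<^sub>R z n) + (err n - (err n \<bullet> u) *\<^sub>R z n)))"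
        by simp
      then have "z (Suc n) = z n + ((1 / ?T) *\<^sub>R ((t n / s n) *\<^sub>R (z n v* A - l *\<^sub>R z n))
          + (1 / ?T) *\<^sub>R (err n - (err n \<bullet> u) *\<^sub>R z n))"
        using T t0[of "Suc n"] by (simp only: scaleR_add_right scaleR_scaleR) simp
      moreover have "(1 / ?T) *\<^sub>R ((t n / s n) *\<^sub>R (z n v* A - l *\<^sub>R z n))
          = (b n / (real n + 1)) *\<^sub>R (z n v* A - l *\<^sub>R z n)"
        unfolding scaleR_scaleR by (simp add: b_def mult_ac)
      moreover have "(1 / ?T) *\<^sub>R (err n - (err n \<bullet> u) *\<^sub>R z n) = (1 / (real n + 1)) *\<^sub>R e n"
        unfolding e_def scaleR_scaleR by simp
      ultimately show ?thesis by (simp add: add.assoc)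
    qed
  qed
  then have z: "z \<longlonglongrightarrow> (1 / (p \<bullet> u)) *\<^sub>R p" by (simp add: inverse_eq_divide)
  have pu: "0 < p \<bullet> u" unfolding inner_vec_def using p u by (intro sum_pos) auto
  have "(\<lambda>n. (1 / mass (z n)) *\<^sub>R z n) \<longlonglongrightarrow> (1 / mass ((1 / (p \<bullet> u)) *\<^sub>R p)) *\<^sub>R ((1 / (p \<bullet> u)) *\<^sub>R p)"
    using pu by (intro tendsto_intros z) (subst mass_linear, simp add: mass_p)
  moreover have "(1 / mass ((1 / (p \<bullet> u)) *\<^sub>R p)) *\<^sub>R ((1 / (p \<bullet> u)) *\<^sub>R p) = p"
    unfolding mass_linear using pu by (simp add: mass_p)
  moreover have "(1 / mass (z n)) *\<^sub>R z n = x n" if "n \<ge> 1" for n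
  proof -
    have "mass (x n) = 1" using xs[OF that] by (simp add: prob_simplex_def)
    then show ?thesis unfolding z_def mass_linear using t0[OF that] by simp
  qed
  then have "\<forall>\<^sub>F n in sequentially. (1 / mass (z n)) *\<^sub>R z n = x n"
    using eventually_sequentially by blast
  ultimately show x: "x \<longlonglongrightarrow> p" using Lim_transform_eventually by fastforce
  have "(\<lambda>n. x n v* A) \<longlonglongrightarrow> p v* A"
    using continuous_on_tendsto_compose[OF continuous_on_vec_mat[OF continuous_on_id continuous_on_const] x, of UNIV A]
    by simp
  from tendsto_add[OF lim' this] have c: "c \<longlonglongrightarrow> l *\<^sub>R p" by (simp add: left)
  have "(\<lambda>n. mass (c n)) \<longlonglongrightarrow> mass (l *\<^sub>R p)"
    by (intro tendsto_sum tendsto_vec_nth c)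
  then have T: "(\<lambda>n. mass (c n)) \<longlonglongrightarrow> l" unfolding mass_linear mass_p by simp
  then show "(\<lambda>n. mass (C n) / real n) \<longlonglongrightarrow> l"
    unfolding c_def mass_linear by (simp add: field_simps)
  have "(\<lambda>n. (1 / mass (c n)) *\<^sub>R c n) \<longlonglongrightarrow> (1 / l) *\<^sub>R (l *\<^sub>R p)"
    using l by (intro tendsto_intros c T) auto
  moreover have "(1 / mass (c n)) *\<^sub>R c n = Y n" if "n \<ge> 1" for n
  proof -
    have "0 < mass (c n)" unfolding c_def mass_linear using C(2)[of n] that by simp
    then show ?thesis by (subst (2) cY) simp
  qed
  then have "\<forall>\<^sub>F n in sequentially. (1 / mass (c n)) *\<^sub>R c n = Y n"
    using eventually_sequentially by blast
  ultimately show "Y \<longlonglongrightarrow> p" using l Lim_transform_eventually by fastforce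
qed

end


section \<open>Measurability of the Perron data\<close>

lemma continuous_on_matrix_power: "continuous_on UNIV (\<lambda>A :: real^'k^'k. matrix_power A n)"
proof (induction n)
  case (Suc n)
  then show ?case
    unfolding matrix_power.simps matrix_matrix_mult_def
    by (intro continuous_on_vec_lambda continuous_on_sum continuous_on_mult continuous_on_component
        continuous_on_id)
qed simp

lemma borel_irreducible: "{A :: real^'k^'k. irreducible_matrix A} \<in> sets borel"
proof -
  have c: "closed {A :: real^'k^'k. 0 \<le> A $ i $ j}" for i j
    by (intro closed_Collect_le continuous_on_const continuous_on_component continuous_on_id)
  have o: "open {A :: real^'k^'k. 0 < matrix_power A N $ i $ j}" for N i j
    by (intro open_Collect_less continuous_on_const continuous_on_component continuous_on_matrix_power)
  have eq: "{A :: real^'k^'k. irreducible_matrix A} =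
      (\<Inter>i. \<Inter>j. {A. 0 \<le> A $ i $ j}) \<inter> (\<Inter>i. \<Inter>j. \<Union>N\<in>{0<..}. {A. 0 < matrix_power A N $ i $ j})"
    by (auto simp: irreducible_matrix_def nonneg_matrix_def Bex_def)
  have "closed (\<Inter>i. \<Inter>j. {A :: real^'k^'k. 0 \<le> A $ i $ j})"
    by (intro closed_INT ballI c)
  moreover have "open (\<Inter>i. \<Inter>j. \<Union>N\<in>{0<..}. {A :: real^'k^'k. 0 < matrix_power A N $ i $ j})"
    by (intro open_INT open_UN ballI finite o)
  ultimately show ?thesis unfolding eq by (intro sets.Int borel_closed borel_open)
qed

text \<open>This form of the defining property is a closed relation between \<open>q\<close> and \<open>A\<close> which does not mention the
eigenvalue.\<close>

lemma left_perron_vector_characterization: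
  assumes A: "irreducible_matrix A" and q: "q \<in> prob_simplex"
  shows "q v* A = mass (q v* A) *\<^sub>R q \<longleftrightarrow> q = left_perron_vector A"
proof -
  obtain l p u where "perron_triple A l p u" using exists_perron_triple[OF A] .
  then interpret perron_triple A l p u .
  have "mass (p v* A) = l" unfolding left mass_linear mass_p by simp
  then show ?thesis
    using q left left_eigenvector_unique(1)[of q] by (auto simp: left_perron_vector_eq prob_simplex_def)
qed

lemma left_perron_vector_in_simplex: "irreducible_matrix A \<Longrightarrow> left_perron_vector A \<in> prob_simplex"
proof -
  assume A: "irreducible_matrix A"
  obtain l p u where "perron_triple A l p u" using exists_perron_triple[OF A] .
  then interpret perron_triple A l p u .
  show ?thesis using p mass_p by (simp add: left_perron_vector_eq prob_simplex_def less_imp_le)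
qed

text \<open>The preimage of a closed set is, within the irreducible matrices, the projection of a closed set of pairs
along the compact simplex, hence closed there.\<close>

lemma measurable_left_perron_vector: "left_perron_vector \<in> borel_measurable (borel :: (real^'k^'k) measure)"
proof (rule borel_measurableI)
  fix S :: "(real^'k) set" assume S: "open S"
  define G :: "((real^'k) \<times> (real^'k^'k)) set" where "G = {(q, A). q v* A = mass (q v* A) *\<^sub>R q}"
  have "closed G"
    unfolding G_def case_prod_unfold
    by (intro closed_Collect_eq continuous_on_vec_mat continuous_on_scaleR continuous_on_sum
        continuous_on_component continuous_on_fst continuous_on_snd continuous_on_id)
  then have "closed {A. \<exists>q. q \<in> prob_simplex \<inter> - S \<and> (q, A) \<in> G}"
    using S by (intro closed_compact_projection compact_Int_closed compact_prob_simplex) auto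
  then have C: "{A. \<exists>q. q \<in> prob_simplex \<inter> - S \<and> (q, A) \<in> G} \<in> sets borel" by (rule borel_closed)
  let ?I = "{A :: real^'k^'k. irreducible_matrix A}"
  have "A \<in> {A. \<exists>q. q \<in> prob_simplex \<inter> - S \<and> (q, A) \<in> G} \<longleftrightarrow> left_perron_vector A \<notin> S"
    if "irreducible_matrix A" for A
    using left_perron_vector_characterization[OF that] left_perron_vector_in_simplex[OF that]
    by (auto simp: G_def)
  moreover have "left_perron_vector A = 0" if "\<not> irreducible_matrix A" for A :: "real^'k^'k"
    using that by (simp add: left_perron_vector_def)
  ultimately have "left_perron_vector -` S \<inter> space borel =
      (?I - {A. \<exists>q. q \<in> prob_simplex \<inter> - S \<and> (q, A) \<in> G}) \<union> (if 0 \<in> S then UNIV - ?I else {})"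
    by (fastforce split: if_splits)
  also have "\<dots> \<in> sets borel" using C borel_irreducible by auto
  finally show "left_perron_vector -` S \<inter> space borel \<in> sets borel" .
qed

text \<open>The eigenvalue is the mass of \<open>p A = l p\<close>, so its measurability reduces to that of the vector. Off the
irreducible matrices both sides are zero.\<close>

lemma dominant_eigenvalue_eq_mass: "dominant_eigenvalue A = mass (left_perron_vector A v* A)"
proof (cases "irreducible_matrix A")
  case True
  obtain l p u where "perron_triple A l p u" using exists_perron_triple[OF True] .
  then interpret perron_triple A l p u .
  show ?thesis unfolding dominant_eigenvalue_eq left_perron_vector_eq left mass_linear mass_p by simp
qed (simp add: dominant_eigenvalue_def left_perron_vector_def)

lemma measurable_vec_nth: "f \<in> borel_measurable M \<Longrightarrow> (\<lambda>x. f x $ i :: 'b::euclidean_space) \<in> borel_measurable M"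
  by (rule borel_measurable_continuous_on[of "\<lambda>x. x $ i"])
     (auto intro: continuous_on_component continuous_on_id)

lemma measurable_dominant_eigenvalue: "dominant_eigenvalue \<in> borel_measurable (borel :: (real^'k^'k) measure)"
  unfolding dominant_eigenvalue_eq_mass[abs_def] vec_mat_component
  by (intro borel_measurable_sum borel_measurable_times measurable_vec_nth measurable_left_perron_vector
      measurable_ident_sets[OF refl])

section \<open>A strong law for square summable martingale differences\<close>

locale discrete_filtration = prob_space M
  for M :: "'a measure" and F :: "nat \<Rightarrow> 'a measure" +
  assumes subalg: "\<And>n. subalgebra M (F n)"
    and mono: "\<And>n. sets (F n) \<subseteq> sets (F (Suc n))"
begin

lemma finite_measure_subalgebra: "finite_measure_subalgebra M (F n)"
  by (unfold_locales) (rule subalg)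

lemma sigma_finite_subalgebra: "sigma_finite_subalgebra M (F n)"
proof -
  interpret finite_measure_subalgebra M "F n" by (rule finite_measure_subalgebra)
  show ?thesis by unfold_locales
qed

lemma measurable_lift:
  assumes "f \<in> borel_measurable (F m)" "m \<le> n"
  shows "f \<in> borel_measurable (F n)"
proof -
  have "sets (F m) \<subseteq> sets (F n)"
    by (rule lift_Suc_mono_le[OF _ assms(2)]) (rule mono)
  moreover have "space (F m) = space (F n)" using subalg by (metis subalgebra_def)
  ultimately show ?thesis using assms(1) by (auto simp: measurable_def)
qed

lemma measurable_base: "f \<in> borel_measurable (F m) \<Longrightarrow> f \<in> borel_measurable M"
  by (rule measurable_from_subalg[OF subalg])

lemma integrable_AE_bounded:
  fixes f :: "'a \<Rightarrow> real"
  assumes "f \<in> borel_measurable M" "AE \<omega> in M. \<bar>f \<omega>\<bar> \<le> B"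
  shows "integrable M f"
  using assms by (intro integrable_const_bound[of _ B]) auto

lemma integral_predictable_zero:
  assumes g: "g \<in> borel_measurable (F n)" and d: "d \<in> borel_measurable M"
    and int: "integrable M (\<lambda>\<omega>. g \<omega> * d \<omega>)"
    and zero: "AE \<omega> in M. real_cond_exp M (F n) d \<omega> = 0"
  shows "(\<integral>\<omega>. g \<omega> * d \<omega> \<partial>M) = 0"
proof -
  interpret sigma_finite_subalgebra M "F n" by (rule sigma_finite_subalgebra)
  have "(\<integral>\<omega>. g \<omega> * d \<omega> \<partial>M) = (\<integral>\<omega>. g \<omega> * real_cond_exp M (F n) d \<omega> \<partial>M)"
    using int g d by (rule real_cond_exp_intg(2)[symmetric])
  also have "\<dots> = (\<integral>\<omega>. 0 \<partial>M)"
    using zero measurable_base[OF g] by (intro integral_cong_AE) (auto intro: measurable_base[of _ n])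
  finally show ?thesis by simp
qed

text \<open>The weights \<open>h\<close> are predictable, so the weighted variables are again martingale differences and the
cross terms vanish. They will be indicators that stop the sum.\<close>

lemma martingale_difference_orthogonal:
  assumes d: "\<And>n. d n \<in> borel_measurable (F (Suc n))"
    and bd: "\<And>n. AE \<omega> in M. \<bar>d n \<omega>\<bar> \<le> B n"
    and zero: "\<And>n. AE \<omega> in M. real_cond_exp M (F n) (d n) \<omega> = 0"
    and h: "\<And>n. h n \<in> borel_measurable (F n)" "\<And>n \<omega>. \<bar>h n \<omega>\<bar> \<le> 1"
  shows "integrable M (\<lambda>\<omega>. (\<Sum>k<n. h k \<omega> * d k \<omega>)\<^sup>2) \<and>
    (\<integral>\<omega>. (\<Sum>k<n. h k \<omega> * d k \<omega>)\<^sup>2 \<partial>M) \<le> (\<Sum>k<n. \<integral>\<omega>. (d k \<omega>)\<^sup>2 \<partial>M)"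
proof (induction n)
  case (Suc n)
  let ?T = "\<lambda>n \<omega>. \<Sum>k<n. h k \<omega> * d k \<omega>"
  have hF: "h k \<in> borel_measurable (F n)" if "k \<le> n" for k using h(1) that by (rule measurable_lift)
  have dF: "d k \<in> borel_measurable (F n)" if "k < n" for k using d that by (intro measurable_lift[OF d]) simp
  have TF: "?T n \<in> borel_measurable (F n)"
    using hF dF by (intro borel_measurable_sum borel_measurable_times) auto
  have m[measurable]: "?T n \<in> borel_measurable M" "h n \<in> borel_measurable M" "d n \<in> borel_measurable M"
    using measurable_base[OF TF] measurable_base[OF h(1)] measurable_base[OF d] by auto
  have bd1: "AE \<omega> in M. \<bar>h k \<omega> * d k \<omega>\<bar> \<le> B k" for k
    using bd[of k]
  proof eventually_elim
    case (elim \<omega>)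
    have "\<bar>h k \<omega>\<bar> * \<bar>d k \<omega>\<bar> \<le> 1 * B k" using h(2) elim by (intro mult_mono) auto
    then show ?case by (simp add: abs_mult)
  qed
  have "AE \<omega> in M. \<forall>k\<in>{..<n}. \<bar>h k \<omega> * d k \<omega>\<bar> \<le> B k"
    by (intro AE_finite_allI bd1) simp
  then have bT: "AE \<omega> in M. \<bar>?T n \<omega>\<bar> \<le> (\<Sum>k<n. B k)"
    by eventually_elim (intro order_trans[OF sum_abs] sum_mono, simp)
  have bTd: "AE \<omega> in M. \<bar>(?T n \<omega> * h n \<omega>) * d n \<omega>\<bar> \<le> (\<Sum>k<n. B k) * B n"
    using bT bd1[of n]
  proof eventually_elim
    case (elim \<omega>)
    have "\<bar>?T n \<omega>\<bar> * \<bar>h n \<omega> * d n \<omega>\<bar> \<le> (\<Sum>k<n. B k) * B n"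
      using elim by (intro mult_mono) (auto intro: order_trans[OF abs_ge_zero])
    then show ?case by (simp add: abs_mult mult.assoc)
  qed
  have iTd: "integrable M (\<lambda>\<omega>. (?T n \<omega> * h n \<omega>) * d n \<omega>)"
    by (rule integrable_AE_bounded[OF _ bTd]) measurable
  have "AE \<omega> in M. \<bar>(h n \<omega> * d n \<omega>)\<^sup>2\<bar> \<le> (B n)\<^sup>2"
    using bd1[of n] by eventually_elim (metis abs_ge_zero abs_power2 power2_abs power_mono)
  then have ihd: "integrable M (\<lambda>\<omega>. (h n \<omega> * d n \<omega>)\<^sup>2)"
    by (rule integrable_AE_bounded[rotated]) measurable
  have "AE \<omega> in M. \<bar>(d n \<omega>)\<^sup>2\<bar> \<le> (B n)\<^sup>2"
    using bd[of n] by eventually_elim (metis abs_ge_zero abs_power2 power2_abs power_mono)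
  then have id: "integrable M (\<lambda>\<omega>. (d n \<omega>)\<^sup>2)"
    by (rule integrable_AE_bounded[rotated]) measurable
  have zero': "(\<integral>\<omega>. (?T n \<omega> * h n \<omega>) * d n \<omega> \<partial>M) = 0"
    using TF h(1) iTd zero by (intro integral_predictable_zero[where n=n]) auto
  have eq: "(?T (Suc n) \<omega>)\<^sup>2 = (?T n \<omega>)\<^sup>2 + 2 * ((?T n \<omega> * h n \<omega>) * d n \<omega>) + (h n \<omega> * d n \<omega>)\<^sup>2" for \<omega>
    by (simp add: power2_sum algebra_simps)
  have "(\<integral>\<omega>. (h n \<omega> * d n \<omega>)\<^sup>2 \<partial>M) \<le> (\<integral>\<omega>. (d n \<omega>)\<^sup>2 \<partial>M)"
  proof (rule integral_mono[OF ihd id])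
    fix \<omega>
    have "(h n \<omega>)\<^sup>2 * (d n \<omega>)\<^sup>2 \<le> 1 * (d n \<omega>)\<^sup>2"
      using h(2)[of n \<omega>] by (intro mult_right_mono) (auto simp: abs_square_le_1)
    then show "(h n \<omega> * d n \<omega>)\<^sup>2 \<le> (d n \<omega>)\<^sup>2" by (simp add: power_mult_distrib)
  qed
  then show ?case
    unfolding eq using Suc iTd ihd zero' by simp
qed simp

text \<open>Stop the sum when it first reaches \<open>e\<close> in absolute value. On the event in question the stopped sum still has
absolute value at least \<open>e\<close> at time \<open>n\<close>, so Chebyshev's inequality for the stopped sum suffices.\<close>

lemma maximal_inequality:
  assumes d: "\<And>n. d n \<in> borel_measurable (F (Suc n))"
    and bd: "\<And>n. AE \<omega> in M. \<bar>d n \<omega>\<bar> \<le> B n"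
    and zero: "\<And>n. AE \<omega> in M. real_cond_exp M (F n) (d n) \<omega> = 0"
    and e: "0 < e"
  shows "prob {\<omega>\<in>space M. \<exists>m\<le>n. e \<le> \<bar>\<Sum>k<m. d k \<omega>\<bar>} \<le> (\<Sum>k<n. \<integral>\<omega>. (d k \<omega>)\<^sup>2 \<partial>M) / e\<^sup>2"
proof -
  let ?S = "\<lambda>m \<omega>. \<Sum>k<m. d k \<omega>"
  define h :: "nat \<Rightarrow> 'a \<Rightarrow> real" where "h = (\<lambda>k \<omega>. if \<forall>m\<le>k. \<bar>?S m \<omega>\<bar> < e then 1 else 0)"
  have dM[measurable]: "d k \<in> borel_measurable M" for k by (rule measurable_base[OF d])
  have hF: "h k \<in> borel_measurable (F k)" for k
  proof -
    have S[measurable]: "?S m \<in> borel_measurable (F k)" if "m \<le> k" for m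
      using that by (intro borel_measurable_sum measurable_lift[OF d]) auto
    have "h k = (\<lambda>\<omega>. \<Prod>m\<in>{..k}. if \<bar>?S m \<omega>\<bar> < e then 1 else 0)"
      by (auto simp: h_def fun_eq_iff)
    moreover have "\<dots> \<in> borel_measurable (F k)"
      by (intro borel_measurable_prod measurable_If borel_measurable_const) (use S in measurable)
    ultimately show ?thesis by simp
  qed
  have hM[measurable]: "h k \<in> borel_measurable M" for k by (rule measurable_base[OF hF])
  let ?T = "\<lambda>\<omega>. \<Sum>k<n. h k \<omega> * d k \<omega>"
  have T: "integrable M (\<lambda>\<omega>. (?T \<omega>)\<^sup>2)"
      "(\<integral>\<omega>. (?T \<omega>)\<^sup>2 \<partial>M) \<le> (\<Sum>k<n. \<integral>\<omega>. (d k \<omega>)\<^sup>2 \<partial>M)"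
    using martingale_difference_orthogonal[where h=h, OF d bd zero hF, of n] by (auto simp: h_def)
  have "{\<omega>\<in>space M. \<exists>m\<le>n. e \<le> \<bar>?S m \<omega>\<bar>} \<subseteq> {\<omega>\<in>space M. e\<^sup>2 \<le> (?T \<omega>)\<^sup>2}"
  proof safe
    fix \<omega> m assume "m \<le> n" "e \<le> \<bar>?S m \<omega>\<bar>"
    define t where "t = (LEAST m. e \<le> \<bar>?S m \<omega>\<bar>)"
    have t: "e \<le> \<bar>?S t \<omega>\<bar>" unfolding t_def by (rule LeastI[of "\<lambda>m. e \<le> \<bar>?S m \<omega>\<bar>", OF \<open>e \<le> _\<close>])
    have "t \<le> m" unfolding t_def by (rule Least_le) fact
    then have tn: "t \<le> n" using \<open>m \<le> n\<close> by simp
    have h1: "h k \<omega> = (if k < t then 1 else 0)" for k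
    proof (cases "k < t")
      case True
      then have "\<bar>?S m \<omega>\<bar> < e" if "m \<le> k" for m
        using not_less_Least[of m "\<lambda>m. e \<le> \<bar>?S m \<omega>\<bar>"] that unfolding t_def by force
      then show ?thesis using True by (simp add: h_def)
    next
      case False
      then have "\<not> (\<forall>m\<le>k. \<bar>?S m \<omega>\<bar> < e)" using t by (auto simp: not_less)
      then show ?thesis using False by (simp add: h_def)
    qed
    have "?T \<omega> = (\<Sum>k<n. if k < t then d k \<omega> else 0)"
      by (intro sum.cong) (auto simp: h1)
    also have "\<dots> = ?S t \<omega>"
      using tn by (subst sum.inter_filter[symmetric]) (auto intro!: sum.cong)
    finally have "?T \<omega> = ?S t \<omega>" .
    then show "e\<^sup>2 \<le> (?T \<omega>)\<^sup>2" using t e by (metis less_imp_le power2_abs power_mono)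
  qed
  then have "prob {\<omega>\<in>space M. \<exists>m\<le>n. e \<le> \<bar>?S m \<omega>\<bar>} \<le> prob {\<omega>\<in>space M. e\<^sup>2 \<le> (?T \<omega>)\<^sup>2}"
    by (intro finite_measure_mono) auto
  also have "\<dots> \<le> (\<integral>\<omega>. (?T \<omega>)\<^sup>2 \<partial>M) / e\<^sup>2"
    using T(1) e by (intro integral_Markov_inequality_measure[where A="{}"]) auto
  also have "\<dots> \<le> (\<Sum>k<n. \<integral>\<omega>. (d k \<omega>)\<^sup>2 \<partial>M) / e\<^sup>2"
    using T(2) by (intro divide_right_mono) auto
  finally show ?thesis .
qed

text \<open>Passing from one dyadic block to the next multiplies the average by \<open>1/4\<close> and adds at most
\<open>4 \<Sum> v\<^sub>k / (k + 1)\<^sup>2\<close> over the new block. Keeping \<open>4/3\<close> times the last term on the left makes the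
induction for the partial sums close.\<close>

lemma (in -) summable_dyadic_blocks:
  fixes v :: "nat \<Rightarrow> real"
  assumes v: "\<And>k. 0 \<le> v k" and sum: "summable (\<lambda>k. v k / (real k + 1)\<^sup>2)"
  shows "summable (\<lambda>i. (\<Sum>k<2 ^ Suc i. v k) / 4 ^ i)"
proof (rule summableI_nonneg_bounded)
  let ?w = "\<lambda>k. v k / (real k + 1)\<^sup>2"
  let ?a = "\<lambda>i. (\<Sum>k<2 ^ Suc i. v k) / (4::real) ^ i"
  show "0 \<le> ?a i" for i using v by (simp add: sum_nonneg)
  have step: "?a (Suc i) \<le> ?a i / 4 + 4 * (\<Sum>k=2^Suc i..<2^Suc (Suc i). ?w k)" for i
  proof -
    have "v k / 4 ^ Suc i \<le> 4 * ?w k" if "k \<in> {2^Suc i..<2^Suc (Suc i)}" for k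
    proof -
      have "real k + 1 \<le> 2 ^ Suc (Suc i)"
        using that by (metis Suc_leI atLeastLessThan_iff of_nat_Suc of_nat_le_iff of_nat_numeral of_nat_power add.commute)
      then have "(real k + 1)\<^sup>2 \<le> (2 ^ Suc (Suc i))\<^sup>2" by (intro power_mono) auto
      also have "(2 ^ Suc (Suc i))\<^sup>2 = (4::real) * 4 ^ Suc i"
        by (simp add: power_mult_distrib power2_eq_square flip: power_mult_distrib)
      finally have "v k * (real k + 1)\<^sup>2 \<le> v k * (4 * 4 ^ Suc i)" using v by (intro mult_left_mono) auto
      then show ?thesis by (simp add: field_simps)
    qed
    then have "(\<Sum>k=2^Suc i..<2^Suc (Suc i). v k / 4 ^ Suc i) \<le> 4 * (\<Sum>k=2^Suc i..<2^Suc (Suc i). ?w k)"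
      unfolding sum_distrib_left by (rule sum_mono)
    moreover have "(\<Sum>k<2 ^ Suc (Suc i). v k) = (\<Sum>k<2 ^ Suc i. v k) + (\<Sum>k=2^Suc i..<2^Suc (Suc i). v k)"
      unfolding lessThan_atLeast0 by (rule sum.atLeastLessThan_concat[symmetric]) auto
    ultimately show ?thesis by (simp add: add_divide_distrib sum_divide_distrib mult.commute)
  qed
  have bound: "(\<Sum>i<I. ?a i) + (4/3) * ?a I \<le> (4/3) * ?a 0 + (16/3) * (\<Sum>k<2^Suc I. ?w k)" for I
  proof (induction I)
    case 0
    then show ?case using v by (simp add: sum_nonneg)
  next
    case (Suc I)
    have "(\<Sum>k<2 ^ Suc (Suc I). ?w k) = (\<Sum>k<2 ^ Suc I. ?w k) + (\<Sum>k=2^Suc I..<2^Suc (Suc I). ?w k)"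
      unfolding lessThan_atLeast0 by (rule sum.atLeastLessThan_concat[symmetric]) auto
    then show ?case using Suc step[of I] by (simp only: sum.lessThan_Suc) argo
  qed
  show "(\<Sum>i<I. ?a i) \<le> (4/3) * ?a 0 + (16/3) * (\<Sum>k. ?w k)" for I
  proof -
    have "0 \<le> ?a I" using v by (simp add: sum_nonneg)
    moreover have "(\<Sum>k<2^Suc I. ?w k) \<le> (\<Sum>k. ?w k)"
      using v by (intro sum_le_suminf[OF sum]) auto
    ultimately show ?thesis using bound[of I] by argo
  qed
qed

text \<open>Between two powers of two the normalized sum is controlled by the maximum over the dyadic block. The
probabilities that these maxima exceed \<open>e 2\<^sup>i\<close> are summable in \<open>i\<close>, and the Borel--Cantelli lemma applies.\<close>

lemma strong_law_square_summable:
  assumes d: "\<And>n. d n \<in> borel_measurable (F (Suc n))"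
    and bd: "\<And>n. AE \<omega> in M. \<bar>d n \<omega>\<bar> \<le> B n"
    and zero: "\<And>n. AE \<omega> in M. real_cond_exp M (F n) (d n) \<omega> = 0"
    and sum: "summable (\<lambda>k. (\<integral>\<omega>. (d k \<omega>)\<^sup>2 \<partial>M) / (real k + 1)\<^sup>2)"
  shows "AE \<omega> in M. (\<lambda>n. (\<Sum>k<n. d k \<omega>) / real n) \<longlonglongrightarrow> 0"
proof -
  have dM[measurable]: "d k \<in> borel_measurable M" for k by (rule measurable_base[OF d])
  have ev: "AE \<omega> in M. \<forall>\<^sub>F i in sequentially. \<forall>m\<le>2^Suc i. \<bar>\<Sum>k<m. d k \<omega>\<bar> < e * 2 ^ i" if e: "0 < e" for e
  proof -
    let ?A = "\<lambda>i. {\<omega>\<in>space M. \<exists>m\<le>2^Suc i. e * 2 ^ i \<le> \<bar>\<Sum>k<m. d k \<omega>\<bar>}"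
    have "summable (\<lambda>i. (1 / e\<^sup>2) * ((\<Sum>k<2 ^ Suc i. \<integral>\<omega>. (d k \<omega>)\<^sup>2 \<partial>M) / 4 ^ i))"
      by (intro summable_mult summable_dyadic_blocks sum) simp
    moreover have "norm (prob (?A i)) \<le> (1 / e\<^sup>2) * ((\<Sum>k<2 ^ Suc i. \<integral>\<omega>. (d k \<omega>)\<^sup>2 \<partial>M) / 4 ^ i)" for i
    proof -
      have "prob (?A i) \<le> (\<Sum>k<2 ^ Suc i. \<integral>\<omega>. (d k \<omega>)\<^sup>2 \<partial>M) / (e * 2 ^ i)\<^sup>2"
        using e by (intro maximal_inequality[OF d bd zero]) auto
      also have "(e * 2 ^ i)\<^sup>2 = e\<^sup>2 * 4 ^ i"
        by (simp add: power_mult_distrib power2_eq_square flip: power_mult_distrib)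
      finally show ?thesis by simp
    qed
    ultimately have "summable (\<lambda>i. prob (?A i))" by (rule summable_comparison_test')
    then have "AE \<omega> in M. \<forall>\<^sub>F i in sequentially. \<omega> \<in> space M - ?A i"
      by (intro borel_cantelli_AE1) (auto simp: emeasure_eq_measure)
    then show ?thesis
      by eventually_elim (erule eventually_mono, simp, meson linorder_not_le)
  qed
  have "AE \<omega> in M. \<forall>j::nat. \<forall>\<^sub>F i in sequentially. \<forall>m\<le>2^Suc i. \<bar>\<Sum>k<m. d k \<omega>\<bar> < (1 / (real j + 1)) * 2 ^ i"
    unfolding AE_all_countable by (intro allI ev) simp
  then show ?thesis
  proof eventually_elim
    case (elim \<omega>)
    show ?case
    proof (rule LIMSEQ_I)
      fix r :: real assume "0 < r"
      then obtain j where j: "1 / (real j + 1) < r"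
        using reals_Archimedean[OF \<open>0 < r\<close>] by (auto simp: inverse_eq_divide add.commute)
      obtain i0 where i0: "\<And>i m. i \<ge> i0 \<Longrightarrow> m \<le> 2^Suc i \<Longrightarrow> \<bar>\<Sum>k<m. d k \<omega>\<bar> < (1 / (real j + 1)) * 2 ^ i"
        using spec[OF elim, of j] by (auto simp: eventually_sequentially)
      have "\<bar>(\<Sum>k<n. d k \<omega>) / real n\<bar> < r" if n: "n \<ge> 2 ^ i0" for n
      proof -
        have "0 < n" using n by (metis gr0I less_irrefl order_less_le_trans zero_less_numeral zero_less_power)
        then obtain i where i: "2 ^ i \<le> n" "n < 2 ^ Suc i"
          using ex_power_ivl1[where b=2 and k=n] by auto
        have "i0 \<le> i"
        proof (rule ccontr)
          assume "\<not> i0 \<le> i"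
          then have "(2::nat) ^ Suc i \<le> 2 ^ i0" by (intro power_increasing) auto
          then show False using i n by simp
        qed
        then have "\<bar>\<Sum>k<n. d k \<omega>\<bar> < (1 / (real j + 1)) * 2 ^ i" using i by (intro i0) auto
        also have "\<dots> \<le> (1 / (real j + 1)) * real n"
        proof (rule mult_left_mono)
          show "2 ^ i \<le> real n" using i(1) by (metis of_nat_le_iff of_nat_numeral of_nat_power)
        qed simp
        also have "\<dots> < r * real n" using j \<open>0 < n\<close> by (intro mult_strict_right_mono) auto
        finally show ?thesis using \<open>0 < n\<close> by (simp add: field_simps)
      qed
      then show "\<exists>no. \<forall>n\<ge>no. norm ((\<Sum>k<n. d k \<omega>) / real n - 0) < r" by auto
    qed
  qed
qed


end

section \<open>Truncation and tail sums\<close>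

text \<open>The case of nonnegative terms of Kronecker's lemma: beyond \<open>N\<close>, dividing \<open>a\<^sub>k\<close> by \<open>n > k\<close> only decreases
the summand of the given convergent series.\<close>

lemma Cesaro_tendsto_0:
  fixes a :: "nat \<Rightarrow> real"
  assumes a: "\<And>k. 0 \<le> a k" and sum: "summable (\<lambda>k. a k / (real k + 1))"
  shows "(\<lambda>n. (\<Sum>k<n. a k) / real n) \<longlonglongrightarrow> 0"
proof (rule LIMSEQ_I)
  fix r :: real assume r: "0 < r"
  obtain N where N: "\<And>n. n \<ge> N \<Longrightarrow> norm (\<Sum>k. a (k + n) / (real (k + n) + 1)) < r / 2"
    using suminf_exist_split[of "r / 2", OF _ sum] r by auto
  have "(\<lambda>n. (\<Sum>k<N. a k) / real n) \<longlonglongrightarrow> 0" by (rule lim_const_over_n)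
  then obtain N' where N': "\<And>n. n \<ge> N' \<Longrightarrow> norm ((\<Sum>k<N. a k) / real n) < r / 2"
    using LIMSEQ_D[of _ 0 "r / 2"] r by fastforce
  have "(\<Sum>k<n. a k) / real n < r" if n: "n \<ge> max (max N N') 1" for n
  proof -
    have "(\<Sum>k=N..<n. a k) / real n \<le> (\<Sum>k=N..<n. a k / (real k + 1))"
      unfolding sum_divide_distrib using a by (intro sum_mono divide_left_mono) auto
    also have "\<dots> = (\<Sum>k<n - N. a (k + N) / (real (k + N) + 1))"
      using n sum.shift_bounds_nat_ivl[of "\<lambda>k. a k / (real k + 1)" 0 N "n - N"]
      by (simp add: lessThan_atLeast0)
    also have "\<dots> \<le> (\<Sum>k. a (k + N) / (real (k + N) + 1))"
      using a summable_ignore_initial_segment[OF sum, of N] by (intro sum_le_suminf) auto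
    also have "\<dots> < r / 2" using N[of N] by simp
    finally have "(\<Sum>k=N..<n. a k) / real n < r / 2" .
    moreover have "(\<Sum>k<n. a k) = (\<Sum>k<N. a k) + (\<Sum>k=N..<n. a k)"
      using n unfolding lessThan_atLeast0 by (intro sum.atLeastLessThan_concat[symmetric]) auto
    moreover have "(\<Sum>k<N. a k) / real n < r / 2"
      by (rule le_less_trans[OF abs_ge_self]) (use N'[of n] n in \<open>simp only: real_norm_def max.bounded_iff\<close>)
    ultimately show ?thesis by (simp only: add_divide_distrib)
  qed
  moreover have "norm ((\<Sum>k<n. a k) / real n - 0) = (\<Sum>k<n. a k) / real n" for n
    using a by (simp add: sum_nonneg)
  ultimately show "\<exists>no. \<forall>n\<ge>no. norm ((\<Sum>k<n. a k) / real n - 0) < r"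
    by (intro exI[of _ "max (max N N') 1"]) (simp only:, blast)
qed

text \<open>A discrete layer cake formula: the weights \<open>2m + 1\<close> of the levels below \<open>x\<close> add up to a square that
dominates \<open>x\<^sup>2\<close>.\<close>

lemma square_le_sum_levels:
  fixes x :: real
  assumes "0 \<le> x" "x \<le> real n"
  shows "x\<^sup>2 \<le> (\<Sum>m<n. (2 * real m + 1) * of_bool (x > real m))"
  using assms(2)
proof (induction n)
  case 0
  then show ?case using assms(1) by simp
next
  case (Suc n)
  show ?case
  proof (cases "x \<le> real n")
    case True
    then show ?thesis using Suc.IH by simp
  next
    case False
    then have "(\<Sum>m<Suc n. (2 * real m + 1) * of_bool (x > real m)) = (\<Sum>m<Suc n. 2 * real m + 1)"
      by (intro sum.cong) auto
    also have "\<dots> = (real (Suc n))\<^sup>2" by (induction n) (auto simp: power2_eq_square algebra_simps)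
    finally show ?thesis using Suc.prems assms(1) by (metis power_mono)
  qed
qed

lemma excess_le_sum_levels:
  fixes x :: real
  assumes "0 \<le> x" "x \<le> real (T + n)"
  shows "max (x - real T) 0 \<le> (\<Sum>m<n. of_bool (x > real (m + T)))"
  using assms(2)
proof (induction n)
  case (Suc n)
  show ?case
  proof (cases "x \<le> real (T + n)")
    case True
    then show ?thesis using Suc.IH by simp
  next
    case False
    then have "(\<Sum>m<Suc n. of_bool (x > real (m + T))) = (\<Sum>m<Suc n. 1::real)"
      by (intro sum.cong) auto
    then show ?thesis using Suc.prems by simp
  qed
qed simp

lemma (in prob_space) expectation_level:
  fixes X :: "'a \<Rightarrow> real"
  assumes [measurable]: "X \<in> borel_measurable M"
  shows "integrable M (\<lambda>\<omega>. of_bool (X \<omega> > c) :: real)"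
    and "(\<integral>\<omega>. of_bool (X \<omega> > c) \<partial>M) = prob {\<omega>\<in>space M. X \<omega> > c}"
proof -
  have "(\<lambda>\<omega>. of_bool (X \<omega> > c) :: real) \<in> borel_measurable M"
    unfolding of_bool_def by measurable
  then show "integrable M (\<lambda>\<omega>. of_bool (X \<omega> > c) :: real)"
    by (rule integrable_const_bound[rotated, where B=1]) simp
  have "(\<integral>\<omega>. of_bool (X \<omega> > c) \<partial>M) = (\<integral>\<omega>. indicator {\<omega>\<in>space M. X \<omega> > c} \<omega> \<partial>M)"
    by (intro Bochner_Integration.integral_cong) (auto simp: indicator_def)
  also have "\<dots> = prob {\<omega>\<in>space M. X \<omega> > c}"
    by (auto simp: Int_def intro!: arg_cong[where f=prob])
  finally show "(\<integral>\<omega>. of_bool (X \<omega> > c) \<partial>M) = prob {\<omega>\<in>space M. X \<omega> > c}" .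
qed

lemma (in prob_space) expectation_excess_le:
  fixes X :: "'a \<Rightarrow> real"
  assumes int: "integrable M X" and nonneg: "\<And>\<omega>. \<omega> \<in> space M \<Longrightarrow> 0 \<le> X \<omega>"
    and tail: "\<And>m. prob {\<omega>\<in>space M. X \<omega> > real m} \<le> p m" and sum: "summable p"
  shows "(\<integral>\<omega>. max (X \<omega> - real T) 0 \<partial>M) \<le> (\<Sum>m. p (m + T))"
proof -
  have [measurable]: "X \<in> borel_measurable M" using int by simp
  have p0: "0 \<le> p m" for m using tail[of m] measure_nonneg order_trans by blast
  have sumT: "summable (\<lambda>m. p (m + T))" using summable_ignore_initial_segment[OF sum] .
  have le: "(\<integral>\<omega>. max (min (X \<omega>) (real (T + n)) - real T) 0 \<partial>M) \<le> (\<Sum>m. p (m + T))" for n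
  proof -
    have "(\<integral>\<omega>. max (min (X \<omega>) (real (T + n)) - real T) 0 \<partial>M)
        \<le> (\<integral>\<omega>. (\<Sum>m<n. of_bool (X \<omega> > real (m + T))) \<partial>M)"
    proof (rule integral_mono)
      show "integrable M (\<lambda>\<omega>. max (min (X \<omega>) (real (T + n)) - real T) 0)"
        using nonneg by (intro integrable_const_bound[where B="real n"]) auto
      show "integrable M (\<lambda>\<omega>. \<Sum>m<n. of_bool (X \<omega> > real (m + T)) :: real)"
        by (intro Bochner_Integration.integrable_sum expectation_level) simp
      fix \<omega> assume "\<omega> \<in> space M"
      then have "max (min (X \<omega>) (real (T + n)) - real T) 0
          \<le> (\<Sum>m<n. of_bool (min (X \<omega>) (real (T + n)) > real (m + T)))"
        using nonneg by (intro excess_le_sum_levels) auto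
      also have "\<dots> \<le> (\<Sum>m<n. of_bool (X \<omega> > real (m + T)))"
        by (intro sum_mono) auto
      finally show "max (min (X \<omega>) (real (T + n)) - real T) 0 \<le> (\<Sum>m<n. of_bool (X \<omega> > real (m + T)))" .
    qed
    also have "\<dots> = (\<Sum>m<n. prob {\<omega>\<in>space M. X \<omega> > real (m + T)})"
      by (subst Bochner_Integration.integral_sum) (simp_all add: expectation_level)
    also have "\<dots> \<le> (\<Sum>m<n. p (m + T))" by (intro sum_mono tail)
    also have "\<dots> \<le> (\<Sum>m. p (m + T))" using p0 by (intro sum_le_suminf sumT) auto
    finally show ?thesis .
  qed
  have lim: "(\<lambda>n. \<integral>\<omega>. max (min (X \<omega>) (real (T + n)) - real T) 0 \<partial>M) \<longlonglongrightarrow> (\<integral>\<omega>. max (X \<omega> - real T) 0 \<partial>M)"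
  proof (rule integral_dominated_convergence[where w=X])
    show "AE \<omega> in M. (\<lambda>n. max (min (X \<omega>) (real (T + n)) - real T) 0) \<longlonglongrightarrow> max (X \<omega> - real T) 0"
    proof (rule AE_I2)
      fix \<omega>
      obtain N :: nat where "X \<omega> \<le> real N" using real_arch_simple by blast
      then have "\<forall>n\<ge>N. max (X \<omega> - real T) 0 = max (min (X \<omega>) (real (T + n)) - real T) 0" by auto
      then show "(\<lambda>n. max (min (X \<omega>) (real (T + n)) - real T) 0) \<longlonglongrightarrow> max (X \<omega> - real T) 0"
        by (intro Lim_transform_eventually[OF tendsto_const]) (auto simp: eventually_sequentially)
    qed
  qed (use int nonneg in auto)
  show ?thesis by (rule LIMSEQ_le_const2[OF lim]) (use le in blast)
qed

text \<open>Exchanging the sums, the total weight of \<open>p\<^sub>m\<close> is \<open>(2m + 1) \<Sum>\<^bsub>k\<ge>m\<^esub> 1 / (k + 1)\<^sup>2\<close>, which is bounded. The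
induction below performs this exchange: the extra term \<open>2 Q\<^sub>n / (n + 1)\<close> pays for the contribution of the terms
up to \<open>n\<close> to all later summands.\<close>

lemma summable_truncated_squares:
  fixes p :: "nat \<Rightarrow> real"
  assumes p: "\<And>m. 0 \<le> p m" and sum: "summable p"
  shows "summable (\<lambda>k. (\<Sum>m<Suc k. (2 * real m + 1) * p m) / (real k + 1)\<^sup>2)"
proof (rule summableI_nonneg_bounded)
  let ?Q = "\<lambda>n. \<Sum>m<n. (2 * real m + 1) * p m"
  have Q: "0 \<le> ?Q n" for n using p by (simp add: sum_nonneg)
  show "0 \<le> ?Q (Suc k) / (real k + 1)\<^sup>2" for k using Q[of "Suc k"] by simp
  have bound: "(\<Sum>k<n. ?Q (Suc k) / (real k + 1)\<^sup>2) + 2 * ?Q n / (real n + 1) \<le> 6 * (\<Sum>m<n. p m)" for n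
  proof (induction n)
    case (Suc n)
    define q where "q = ?Q n"
    define N where "N = real n + 1"
    have N: "1 \<le> N" by (simp add: N_def)
    have "1 / N\<^sup>2 + 2 / (N + 1) \<le> 2 / N"
    proof -
      have "N + 1 + 2 * N\<^sup>2 \<le> 2 * N * (N + 1)" using N by (simp add: power2_eq_square algebra_simps)
      then have "(N + 1 + 2 * N\<^sup>2) / (N\<^sup>2 * (N + 1)) \<le> 2 * N * (N + 1) / (N\<^sup>2 * (N + 1))"
        using N by (intro divide_right_mono) auto
      also have "(N + 1 + 2 * N\<^sup>2) / (N\<^sup>2 * (N + 1)) = 1 / N\<^sup>2 + 2 / (N + 1)"
        using N by (simp add: divide_simps)
      also have "2 * N * (N + 1) / (N\<^sup>2 * (N + 1)) = 2 / N"
        using N by (simp add: power2_eq_square)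
      finally show ?thesis .
    qed
    then have w: "1 / N\<^sup>2 + 2 / (N + 1) \<le> 2 / N" .
    have eqQ: "?Q (Suc n) = q + (2 * N - 1) * p n" by (simp add: q_def N_def)
    have fac: "X / N\<^sup>2 + 2 * X / (N + 1) = X * (1 / N\<^sup>2 + 2 / (N + 1))" for X :: real
      by (simp add: distrib_left)
    have "?Q (Suc n) / N\<^sup>2 + 2 * ?Q (Suc n) / (N + 1) = (q + (2 * N - 1) * p n) * (1 / N\<^sup>2 + 2 / (N + 1))"
      by (simp only: fac eqQ)
    also have "\<dots> = q * (1 / N\<^sup>2 + 2 / (N + 1)) + ((2 * N - 1) * (1 / N\<^sup>2 + 2 / (N + 1))) * p n"
      by (simp only: distrib_right) (simp only: mult_ac)
    also have "\<dots> \<le> q * (2 / N) + 6 * p n"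
    proof (intro add_mono mult_left_mono mult_right_mono w p)
      have "(2 * N - 1) * (1 / N\<^sup>2 + 2 / (N + 1)) \<le> (2 * N) * (2 / N)"
        using N w by (intro mult_mono) auto
      then show "(2 * N - 1) * (1 / N\<^sup>2 + 2 / (N + 1)) \<le> 6" using N by simp
      show "0 \<le> q" using Q[of n] by (simp add: q_def)
    qed
    also have "\<dots> = 2 * ?Q n / N + 6 * p n" by (simp add: q_def mult.commute)
    finally have "?Q (Suc n) / N\<^sup>2 + 2 * ?Q (Suc n) / (N + 1) \<le> 2 * ?Q n / N + 6 * p n" .
    then have "?Q (Suc n) / (real n + 1)\<^sup>2 + 2 * ?Q (Suc n) / (real (Suc n) + 1)
        \<le> 2 * ?Q n / (real n + 1) + 6 * p n"
      by (simp add: N_def add_ac)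
    then show ?case using Suc
      unfolding sum.lessThan_Suc[of "\<lambda>k. ?Q (Suc k) / (real k + 1)\<^sup>2"] sum.lessThan_Suc[of p]
      by argo
  qed simp
  show "(\<Sum>k<n. ?Q (Suc k) / (real k + 1)\<^sup>2) \<le> 6 * (\<Sum>m. p m)" for n
  proof -
    have "0 \<le> 2 * ?Q n / (real n + 1)" using Q[of n] by simp
    moreover have "(\<Sum>m<n. p m) \<le> (\<Sum>m. p m)" using p by (intro sum_le_suminf sum) auto
    ultimately show ?thesis using bound[of n] by argo
  qed
qed

text \<open>Summation by parts turns the factors \<open>1 / (k + 1)\<close> into harmonic numbers. This is where the logarithm
in the moment condition comes from.\<close>

lemma summable_tails:
  fixes p :: "nat \<Rightarrow> real"
  assumes p: "\<And>m. 0 \<le> p m" and sum: "summable p" and sumh: "summable (\<lambda>m. harm m * p m)"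
  shows "summable (\<lambda>k. (\<Sum>m. p (m + Suc k)) / (real k + 1))"
proof (rule summableI_nonneg_bounded)
  let ?t = "\<lambda>k. \<Sum>m. p (m + k)"
  have st: "summable (\<lambda>m. p (m + k))" for k by (rule summable_ignore_initial_segment[OF sum])
  show "0 \<le> ?t (Suc k) / (real k + 1)" for k using p st[of "Suc k"] by (simp add: suminf_nonneg)
  have h0: "0 \<le> (harm n :: real)" for n by (simp add: harm_nonneg)
  have id: "(\<Sum>k<n. ?t (Suc k) / (real k + 1)) = harm n * ?t n + (\<Sum>k<n. harm k * p k)" for n
  proof (induction n)
    case (Suc n)
    have "?t n = p n + ?t (Suc n)" using suminf_split_head[OF st[of n]] by simp
    moreover have "harm (Suc n) = harm n + 1 / (real n + 1)" by (simp add: harm_Suc inverse_eq_divide add.commute)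
    ultimately show ?case using Suc by (simp add: algebra_simps)
  qed (simp add: harm_def)
  show "(\<Sum>k<n. ?t (Suc k) / (real k + 1)) \<le> (\<Sum>m. harm m * p m)" for n
  proof -
    have sh: "summable (\<lambda>m. harm (m + n) * p (m + n))"
      using summable_ignore_initial_segment[OF sumh, of n] .
    have "harm n * ?t n = (\<Sum>m. harm n * p (m + n))" by (rule suminf_mult[OF st, symmetric])
    also have "\<dots> \<le> (\<Sum>m. harm (m + n) * p (m + n))"
      using p by (intro suminf_le sh summable_mult st mult_right_mono harm_mono) auto
    finally show ?thesis
      unfolding id using suminf_split_initial_segment[OF sumh, of n] by simp
  qed
qed

lemma (in prob_space) AE_summable_of_summable_integral:
  fixes f :: "nat \<Rightarrow> 'a \<Rightarrow> real"
  assumes int: "\<And>k. integrable M (f k)" and nonneg: "\<And>k. AE \<omega> in M. 0 \<le> f k \<omega>"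
    and sum: "summable (\<lambda>k. \<integral>\<omega>. f k \<omega> \<partial>M)"
  shows "AE \<omega> in M. summable (\<lambda>k. f k \<omega>)"
proof -
  have [measurable]: "f k \<in> borel_measurable M" for k using int by simp
  have "(\<integral>\<^sup>+\<omega>. (\<Sum>k. ennreal (f k \<omega>)) \<partial>M) = (\<Sum>k. \<integral>\<^sup>+\<omega>. ennreal (f k \<omega>) \<partial>M)"
    by (rule nn_integral_suminf) simp
  also have "\<dots> = (\<Sum>k. ennreal (\<integral>\<omega>. f k \<omega> \<partial>M))"
    using int nonneg by (simp add: nn_integral_eq_integral)
  also have "\<dots> \<noteq> \<infinity>"
    using sum nonneg by (subst suminf_ennreal2) (auto intro: integral_nonneg_AE)
  finally have "AE \<omega> in M. (\<Sum>k. ennreal (f k \<omega>)) \<noteq> \<infinity>"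
    by (intro nn_integral_PInf_AE) auto
  moreover have "AE \<omega> in M. \<forall>k. 0 \<le> f k \<omega>" using nonneg by (simp add: AE_all_countable)
  ultimately show ?thesis
    by eventually_elim (rule summable_suminf_not_top, auto)
qed


context discrete_filtration
begin

text \<open>Split \<open>X\<^sub>n = L\<^sub>n + U\<^sub>n\<close> at the level \<open>n + 1\<close>. The centered variables \<open>L\<^sub>n - E(L\<^sub>n | F\<^sub>n)\<close> obey
\<open>strong_law_square_summable\<close>, almost surely only finitely many \<open>U\<^sub>n\<close> are nonzero, and the conditional means of the \<open>U\<^sub>n\<close>
divided by \<open>n + 1\<close> have a summable sequence of expectations, so that \<open>Cesaro_tendsto_0\<close> applies to them
almost surely.\<close>

theorem strong_law_conditionally_centered:
  assumes X: "\<And>n. X n \<in> borel_measurable (F (Suc n))" and int: "\<And>n. integrable M (X n)"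
    and nonneg: "\<And>n \<omega>. \<omega> \<in> space M \<Longrightarrow> 0 \<le> X n \<omega>"
    and tail: "\<And>n m. prob {\<omega>\<in>space M. X n \<omega> > real m} \<le> p m"
    and sum: "summable p" and sumh: "summable (\<lambda>m. harm m * p m)"
  shows "AE \<omega> in M. (\<lambda>n. (\<Sum>k<n. X k \<omega> - real_cond_exp M (F k) (X k) \<omega>) / real n) \<longlonglongrightarrow> 0"
proof -
  have XM[measurable]: "X n \<in> borel_measurable M" for n by (rule measurable_base[OF X])
  have p0: "0 \<le> p m" for m using order_trans[OF measure_nonneg tail[of m 0]] .
  have sumS: "summable (\<lambda>m. p (m + k))" for k by (rule summable_ignore_initial_segment[OF sum])
  define L where "L = (\<lambda>n \<omega>. if X n \<omega> \<le> real (Suc n) then X n \<omega> else 0)"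
  define U where "U = (\<lambda>n \<omega>. X n \<omega> - L n \<omega>)"
  have LF: "L n \<in> borel_measurable (F (Suc n))" for n
  proof -
    note X[measurable]
    show ?thesis unfolding L_def by measurable
  qed
  have LM[measurable]: "L n \<in> borel_measurable M" for n by (rule measurable_base[OF LF])
  have UM[measurable]: "U n \<in> borel_measurable M" for n unfolding U_def by measurable
  have L: "0 \<le> L n \<omega>" "L n \<omega> \<le> real (Suc n)" if "\<omega> \<in> space M" for n \<omega>
    using nonneg[OF that, of n] by (auto simp: L_def)
  have U: "0 \<le> U n \<omega>" if "\<omega> \<in> space M" for n \<omega>
    using nonneg[OF that, of n] by (auto simp: U_def L_def)
  have intL: "integrable M (L n)" for n
    using L by (intro integrable_const_bound[where B="real (Suc n)"]) auto
  have intU: "integrable M (U n)" for n unfolding U_def using int intL by simp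
  define E where "E = (\<lambda>n. real_cond_exp M (F n) (L n))"
  define EU where "EU = (\<lambda>n. real_cond_exp M (F n) (U n))"
  have EF: "E n \<in> borel_measurable (F n)" for n
    unfolding E_def by (rule borel_measurable_cond_exp)
  have EM[measurable]: "E n \<in> borel_measurable M" for n by (rule measurable_base[OF EF])
  define d where "d = (\<lambda>n \<omega>. L n \<omega> - E n \<omega>)"
  have dM[measurable]: "d n \<in> borel_measurable M" for n unfolding d_def by measurable
  have E: "AE \<omega> in M. 0 \<le> E n \<omega>" "AE \<omega> in M. E n \<omega> \<le> real (Suc n)" "integrable M (E n)"
      "AE \<omega> in M. real_cond_exp M (F n) (d n) \<omega> = 0"
      "(\<integral>\<omega>. (d n \<omega>)\<^sup>2 \<partial>M) \<le> (\<integral>\<omega>. (L n \<omega>)\<^sup>2 \<partial>M)" for n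
  proof -
    interpret sigma_finite_subalgebra M "F n" by (rule sigma_finite_subalgebra)
    show a: "AE \<omega> in M. 0 \<le> E n \<omega>" "AE \<omega> in M. E n \<omega> \<le> real (Suc n)"
      unfolding E_def
      by (rule real_cond_exp_ge_c[OF intL AE_I2] real_cond_exp_le_c[OF intL AE_I2], erule L)+
    show iE: "integrable M (E n)" unfolding E_def by (rule real_cond_exp_int[OF intL])
    have "AE \<omega> in M. real_cond_exp M (F n) (d n) \<omega> = E n \<omega> - real_cond_exp M (F n) (E n) \<omega>"
      unfolding d_def E_def by (rule real_cond_exp_diff[OF intL iE[unfolded E_def]])
    moreover have "AE \<omega> in M. real_cond_exp M (F n) (E n) \<omega> = E n \<omega>"
      by (rule real_cond_exp_F_meas[OF iE EF])
    ultimately show "AE \<omega> in M. real_cond_exp M (F n) (d n) \<omega> = 0"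
      by eventually_elim simp
    have aE: "AE \<omega> in M. \<bar>E n \<omega>\<bar> \<le> real (Suc n)" using a by eventually_elim simp
    have aL: "AE \<omega> in M. \<bar>L n \<omega>\<bar> \<le> real (Suc n)" using L by (intro AE_I2) auto
    have "AE \<omega> in M. \<bar>E n \<omega> * E n \<omega>\<bar> \<le> real (Suc n) * real (Suc n)"
      using aE by eventually_elim (simp only: abs_mult, intro mult_mono, auto)
    then have iEE: "integrable M (\<lambda>\<omega>. E n \<omega> * E n \<omega>)" by (rule integrable_AE_bounded[rotated]) measurable
    have "AE \<omega> in M. \<bar>E n \<omega> * L n \<omega>\<bar> \<le> real (Suc n) * real (Suc n)"
      using aE aL by eventually_elim (simp only: abs_mult, intro mult_mono, auto)
    then have iEL: "integrable M (\<lambda>\<omega>. E n \<omega> * L n \<omega>)" by (rule integrable_AE_bounded[rotated]) measurable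
    have "AE \<omega> in M. \<bar>L n \<omega> * L n \<omega>\<bar> \<le> real (Suc n) * real (Suc n)"
      using aL by eventually_elim (simp only: abs_mult, intro mult_mono, auto)
    then have iLL: "integrable M (\<lambda>\<omega>. L n \<omega> * L n \<omega>)" by (rule integrable_AE_bounded[rotated]) measurable
    have EL: "(\<integral>\<omega>. E n \<omega> * L n \<omega> \<partial>M) = (\<integral>\<omega>. E n \<omega> * E n \<omega> \<partial>M)"
      unfolding E_def using real_cond_exp_intg(2)[OF iEL EF LM] by (simp add: E_def)
    have "(\<integral>\<omega>. (d n \<omega>)\<^sup>2 \<partial>M) = (\<integral>\<omega>. L n \<omega> * L n \<omega> - 2 * (E n \<omega> * L n \<omega>) + E n \<omega> * E n \<omega> \<partial>M)"
      by (intro Bochner_Integration.integral_cong) (auto simp: d_def power2_eq_square algebra_simps)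
    also have "\<dots> = (\<integral>\<omega>. (L n \<omega>)\<^sup>2 \<partial>M) - (\<integral>\<omega>. E n \<omega> * E n \<omega> \<partial>M)"
      using iLL iEL iEE EL by (simp add: power2_eq_square)
    also have "\<dots> \<le> (\<integral>\<omega>. (L n \<omega>)\<^sup>2 \<partial>M)" by simp
    finally show "(\<integral>\<omega>. (d n \<omega>)\<^sup>2 \<partial>M) \<le> (\<integral>\<omega>. (L n \<omega>)\<^sup>2 \<partial>M)" .
  qed
  have "(\<integral>\<omega>. (L n \<omega>)\<^sup>2 \<partial>M) \<le> (\<Sum>m<Suc n. (2 * real m + 1) * p m)" for n
  proof -
    have "(\<integral>\<omega>. (L n \<omega>)\<^sup>2 \<partial>M) \<le> (\<integral>\<omega>. (\<Sum>m<Suc n. (2 * real m + 1) * of_bool (X n \<omega> > real m)) \<partial>M)"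
    proof (rule integral_mono)
      show "integrable M (\<lambda>\<omega>. (L n \<omega>)\<^sup>2)"
        using L by (intro integrable_const_bound[where B="(real (Suc n))\<^sup>2"]) (auto intro!: AE_I2 power_mono simp del: of_nat_Suc)
      show "integrable M (\<lambda>\<omega>. \<Sum>m<Suc n. (2 * real m + 1) * of_bool (X n \<omega> > real m))"
        by (intro Bochner_Integration.integrable_sum integrable_mult_right expectation_level) simp
      fix \<omega> assume w: "\<omega> \<in> space M"
      have "(L n \<omega>)\<^sup>2 \<le> (\<Sum>m<Suc n. (2 * real m + 1) * of_bool (L n \<omega> > real m))"
        using L[OF w] by (intro square_le_sum_levels) auto
      also have "\<dots> \<le> (\<Sum>m<Suc n. (2 * real m + 1) * of_bool (X n \<omega> > real m))"
        by (intro sum_mono mult_left_mono) (auto simp: L_def)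
      finally show "(L n \<omega>)\<^sup>2 \<le> (\<Sum>m<Suc n. (2 * real m + 1) * of_bool (X n \<omega> > real m))" .
    qed
    also have "\<dots> = (\<Sum>m<Suc n. (2 * real m + 1) * prob {\<omega>\<in>space M. X n \<omega> > real m})"
      by (subst Bochner_Integration.integral_sum) (simp_all add: expectation_level)
    also have "\<dots> \<le> (\<Sum>m<Suc n. (2 * real m + 1) * p m)"
      by (intro sum_mono mult_left_mono tail) simp
    finally show ?thesis .
  qed
  then have v: "(\<integral>\<omega>. (d n \<omega>)\<^sup>2 \<partial>M) \<le> (\<Sum>m<Suc n. (2 * real m + 1) * p m)" for n
    using E(5) order_trans by blast
  have "AE \<omega> in M. (\<lambda>n. (\<Sum>k<n. d k \<omega>) / real n) \<longlonglongrightarrow> 0"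
  proof (rule strong_law_square_summable[where B="\<lambda>n. real (Suc n)"])
    show "d n \<in> borel_measurable (F (Suc n))" for n
      unfolding d_def using LF measurable_lift[OF EF, of n "Suc n"] by (intro borel_measurable_diff) auto
    show "AE \<omega> in M. \<bar>d n \<omega>\<bar> \<le> real (Suc n)" for n
      using E(1,2)[of n] AE_space
    proof eventually_elim
      case (elim \<omega>)
      then show ?case using L[of \<omega> n] unfolding d_def by linarith
    qed
    show "AE \<omega> in M. real_cond_exp M (F n) (d n) \<omega> = 0" for n by (rule E)
    show "summable (\<lambda>k. (\<integral>\<omega>. (d k \<omega>)\<^sup>2 \<partial>M) / (real k + 1)\<^sup>2)"
    proof (rule summable_comparison_test'[OF summable_truncated_squares[OF p0 sum]])
      fix k :: nat
      show "norm ((\<integral>\<omega>. (d k \<omega>)\<^sup>2 \<partial>M) / (real k + 1)\<^sup>2)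
          \<le> (\<Sum>m<Suc k. (2 * real m + 1) * p m) / (real k + 1)\<^sup>2"
        using v[of k] by (simp add: divide_right_mono del: sum.lessThan_Suc)
    qed
  qed
  moreover have "AE \<omega> in M. (\<lambda>n. (\<Sum>k<n. U k \<omega>) / real n) \<longlonglongrightarrow> 0"
  proof -
    have "summable (\<lambda>k. prob {\<omega>\<in>space M. X k \<omega> > real (Suc k)})"
      by (rule summable_comparison_test'[OF sumS[of 1]]) (use tail[of "Suc _"] in simp)
    then have "AE \<omega> in M. \<forall>\<^sub>F k in sequentially. \<omega> \<in> space M - {\<omega>\<in>space M. X k \<omega> > real (Suc k)}"
      by (intro borel_cantelli_AE1) (auto simp: emeasure_eq_measure)
    then show ?thesis using AE_space
    proof eventually_elim
      case (elim \<omega>)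
      have "\<forall>\<^sub>F k in sequentially. U k \<omega> / (real k + 1) = 0"
        using elim(1) by eventually_elim (auto simp: U_def L_def)
      then have "summable (\<lambda>k. U k \<omega> / (real k + 1))"
        using summable_cong[of "\<lambda>k. U k \<omega> / (real k + 1)" "\<lambda>k. 0"] by simp
      then show ?case using U elim(2) by (intro Cesaro_tendsto_0) auto
    qed
  qed
  moreover have "AE \<omega> in M. (\<lambda>n. (\<Sum>k<n. EU k \<omega>) / real n) \<longlonglongrightarrow> 0"
  proof -
    have EU: "AE \<omega> in M. 0 \<le> EU n \<omega>" "integrable M (EU n)"
        "(\<integral>\<omega>. EU n \<omega> \<partial>M) = (\<integral>\<omega>. U n \<omega> \<partial>M)" for n
    proof -
      interpret sigma_finite_subalgebra M "F n" by (rule sigma_finite_subalgebra)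
      show "AE \<omega> in M. 0 \<le> EU n \<omega>" unfolding EU_def using U by (intro real_cond_exp_pos AE_I2) auto
      show "integrable M (EU n)" "(\<integral>\<omega>. EU n \<omega> \<partial>M) = (\<integral>\<omega>. U n \<omega> \<partial>M)"
        unfolding EU_def by (rule real_cond_exp_int[OF intU])+
    qed
    have Ub: "(\<integral>\<omega>. U n \<omega> \<partial>M) \<le> (real n + 1) * p (Suc n) + (\<Sum>m. p (m + Suc n))" for n
    proof -
      have imax: "integrable M (\<lambda>\<omega>. max (X n \<omega> - real (Suc n)) 0)" using int by simp
      have iob: "integrable M (\<lambda>\<omega>. real (Suc n) * of_bool (X n \<omega> > real (Suc n)))"
        by (intro integrable_mult_right expectation_level) simp
      have "(\<integral>\<omega>. U n \<omega> \<partial>M) \<le> (\<integral>\<omega>. real (Suc n) * of_bool (X n \<omega> > real (Suc n)) + max (X n \<omega> - real (Suc n)) 0 \<partial>M)"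
        using intU imax iob by (intro integral_mono) (auto simp: U_def L_def)
      also have "\<dots> = (real n + 1) * prob {\<omega>\<in>space M. X n \<omega> > real (Suc n)} + (\<integral>\<omega>. max (X n \<omega> - real (Suc n)) 0 \<partial>M)"
        using imax iob expectation_level(2)[of "X n" "real (Suc n)"] by (simp add: add.commute)
      also have "\<dots> \<le> (real n + 1) * p (Suc n) + (\<Sum>m. p (m + Suc n))"
        by (intro add_mono mult_left_mono tail expectation_excess_le int nonneg sum) auto
      finally show ?thesis .
    qed
    have "summable (\<lambda>k. \<integral>\<omega>. EU k \<omega> / (real k + 1) \<partial>M)"
    proof (rule summable_comparison_test'[OF summable_add[OF sumS[of 1] summable_tails[OF p0 sum sumh]]])
      fix k :: nat
      have "0 \<le> (\<integral>\<omega>. EU k \<omega> \<partial>M)" using EU(1) by (rule integral_nonneg_AE)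
      then have "norm (\<integral>\<omega>. EU k \<omega> / (real k + 1) \<partial>M) = (\<integral>\<omega>. U k \<omega> \<partial>M) / (real k + 1)"
        using EU(3)[of k] by simp
      also have "\<dots> \<le> ((real k + 1) * p (Suc k) + (\<Sum>m. p (m + Suc k))) / (real k + 1)"
        using Ub by (intro divide_right_mono) auto
      also have "\<dots> = p (k + 1) + (\<Sum>m. p (m + Suc k)) / (real k + 1)"
        by (simp add: add_divide_distrib)
      finally show "norm (\<integral>\<omega>. EU k \<omega> / (real k + 1) \<partial>M) \<le> p (k + 1) + (\<Sum>m. p (m + Suc k)) / (real k + 1)" .
    qed
    then have "AE \<omega> in M. summable (\<lambda>k. EU k \<omega> / (real k + 1))"
    proof (rule AE_summable_of_summable_integral[rotated 2])
      show "integrable M (\<lambda>\<omega>. EU k \<omega> / (real k + 1))" for k using EU(2) by simp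
      show "AE \<omega> in M. 0 \<le> EU k \<omega> / (real k + 1)" for k
        using EU(1)[of k] by eventually_elim simp
    qed
    moreover have "AE \<omega> in M. \<forall>k. 0 \<le> EU k \<omega>" using EU(1) by (simp add: AE_all_countable)
    ultimately show ?thesis by eventually_elim (rule Cesaro_tendsto_0, auto)
  qed
  moreover have "AE \<omega> in M. \<forall>n. real_cond_exp M (F n) (X n) \<omega> = E n \<omega> + EU n \<omega>"
  proof (subst AE_all_countable, rule allI)
    fix n
    interpret sigma_finite_subalgebra M "F n" by (rule sigma_finite_subalgebra)
    have "X n = (\<lambda>\<omega>. L n \<omega> + U n \<omega>)" by (auto simp: U_def)
    then show "AE \<omega> in M. real_cond_exp M (F n) (X n) \<omega> = E n \<omega> + EU n \<omega>"
      unfolding E_def EU_def using real_cond_exp_add[OF intL[of n] intU[of n]] by simp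
  qed
  ultimately show ?thesis
  proof eventually_elim
    case (elim \<omega>)
    have "(\<lambda>n. (\<Sum>k<n. d k \<omega>) / real n + (\<Sum>k<n. U k \<omega>) / real n - (\<Sum>k<n. EU k \<omega>) / real n) \<longlonglongrightarrow> 0 + 0 - 0"
      by (intro tendsto_intros elim)
    moreover have "(\<Sum>k<n. X k \<omega> - real_cond_exp M (F k) (X k) \<omega>) / real n
        = (\<Sum>k<n. d k \<omega>) / real n + (\<Sum>k<n. U k \<omega>) / real n - (\<Sum>k<n. EU k \<omega>) / real n" for n
      unfolding add_divide_distrib[symmetric] diff_divide_distrib[symmetric]
        sum.distrib[symmetric] sum_subtractf[symmetric]
      by (intro arg_cong2[where f="(/)"] sum.cong) (auto simp: elim(4) d_def U_def)
    ultimately show ?case by simp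
  qed
qed

end

section \<open>Conditional independence\<close>

text \<open>Conditional independence is a statement about events. To pass to the integrable function \<open>g(Y)\<close>, fix a
set \<open>B\<close> of \<open>F\<close> and compare the laws of \<open>Y\<close> under the densities \<open>1\<^sub>B 1\<^sub>A(X)\<close> and \<open>1\<^sub>B P(X \<in> A | F)\<close>: they agree on
events, hence integrate \<open>g\<close> to the same value.\<close>

lemma (in prob_space) cond_exp_indicator_mult:
  fixes X :: "'a \<Rightarrow> 'b" and Y :: "'a \<Rightarrow> 'c" and g :: "'c \<Rightarrow> real"
  assumes F: "subalgebra M F"
    and ci: "cond_indep_var M F S X T Y"
    and X[measurable]: "X \<in> measurable M S" and Y[measurable]: "Y \<in> measurable M T"
    and g[measurable]: "g \<in> borel_measurable T" and int: "integrable M (\<lambda>\<omega>. g (Y \<omega>))"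
    and A[measurable]: "A \<in> sets S"
  shows "AE \<omega> in M. real_cond_exp M F (\<lambda>\<omega>. indicator {\<omega>\<in>space M. X \<omega> \<in> A} \<omega> * g (Y \<omega>)) \<omega> =
    real_cond_exp M F (indicator {\<omega>\<in>space M. X \<omega> \<in> A}) \<omega> * real_cond_exp M F (\<lambda>\<omega>. g (Y \<omega>)) \<omega>"
proof -
  interpret finite_measure_subalgebra M F by unfold_locales (rule F)
  let ?a = "indicator {\<omega>\<in>space M. X \<omega> \<in> A} :: 'a \<Rightarrow> real"
  let ?\<alpha> = "real_cond_exp M F ?a"
  let ?gY = "\<lambda>\<omega>. g (Y \<omega>)"
  have aM[measurable]: "?a \<in> borel_measurable M" by measurable
  have \<alpha>F[measurable]: "?\<alpha> \<in> borel_measurable F" by (rule borel_measurable_cond_exp)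
  have \<alpha>M[measurable]: "?\<alpha> \<in> borel_measurable M" by (rule borel_measurable_cond_exp2)
  have gYM[measurable]: "?gY \<in> borel_measurable M" by measurable
  have inta: "integrable M ?a" by (rule integrable_const_bound[where B=1]) auto
  have \<alpha>01: "AE \<omega> in M. 0 \<le> ?\<alpha> \<omega>" "AE \<omega> in M. ?\<alpha> \<omega> \<le> 1"
    by (rule real_cond_exp_ge_c[OF inta] real_cond_exp_le_c[OF inta], simp)+
  have a01: "AE \<omega> in M. 0 \<le> ?a \<omega>" "AE \<omega> in M. ?a \<omega> \<le> 1" by (auto simp: indicator_def)
  have bounded: "integrable M (\<lambda>\<omega>. indicator B \<omega> * (\<phi> \<omega> * h \<omega>))"
    if "B \<in> sets M" "integrable M h" "\<phi> \<in> borel_measurable M"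
      and "AE \<omega> in M. 0 \<le> \<phi> \<omega>" "AE \<omega> in M. \<phi> \<omega> \<le> 1" for B and h \<phi> :: "'a \<Rightarrow> real"
  proof (rule Bochner_Integration.integrable_bound[OF that(2)])
    show "(\<lambda>\<omega>. indicator B \<omega> * (\<phi> \<omega> * h \<omega>)) \<in> borel_measurable M"
      using that by measurable
    show "AE \<omega> in M. norm (indicator B \<omega> * (\<phi> \<omega> * h \<omega>)) \<le> norm (h \<omega>)"
      using that(4,5) by eventually_elim (auto simp: indicator_def abs_mult mult_left_le_one_le)
  qed
  have key: "(\<integral>\<omega>. indicator B \<omega> * (?a \<omega> * ?gY \<omega>) \<partial>M) = (\<integral>\<omega>. indicator B \<omega> * (?\<alpha> \<omega> * ?gY \<omega>) \<partial>M)"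
    if BF[measurable]: "B \<in> sets F" for B
  proof -
    have BM[measurable]: "B \<in> sets M" using BF F by (auto simp: subalgebra_def)
    let ?d1 = "density M (\<lambda>\<omega>. ennreal (indicator B \<omega> * ?a \<omega>))"
    let ?d2 = "density M (\<lambda>\<omega>. ennreal (indicator B \<omega> * ?\<alpha> \<omega>))"
    have "distr ?d1 T Y = distr ?d2 T Y"
    proof (rule measure_eqI)
      fix V assume "V \<in> sets (distr ?d1 T Y)"
      then have V[measurable]: "V \<in> sets T" by simp
      let ?b = "indicator {\<omega>\<in>space M. Y \<omega> \<in> V} :: 'a \<Rightarrow> real"
      let ?ab = "indicator {\<omega>\<in>space M. X \<omega> \<in> A \<and> Y \<omega> \<in> V} :: 'a \<Rightarrow> real"
      have intb: "integrable M ?b" "integrable M ?ab"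
        by (rule integrable_const_bound[where B=1]; simp)+
      have e: "emeasure (distr (density M (\<lambda>\<omega>. ennreal (indicator B \<omega> * \<phi> \<omega>))) T Y) V
          = ennreal (\<integral>\<omega>. indicator B \<omega> * (\<phi> \<omega> * ?b \<omega>) \<partial>M)"
        if [measurable]: "\<phi> \<in> borel_measurable M" and \<phi>: "AE \<omega> in M. 0 \<le> \<phi> \<omega>" "AE \<omega> in M. \<phi> \<omega> \<le> 1"
        for \<phi> :: "'a \<Rightarrow> real"
      proof -
        have "emeasure (distr (density M (\<lambda>\<omega>. ennreal (indicator B \<omega> * \<phi> \<omega>))) T Y) V
            = (\<integral>\<^sup>+\<omega>. ennreal (indicator B \<omega> * \<phi> \<omega>) * indicator (Y -` V \<inter> space M) \<omega> \<partial>M)"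
          by (simp add: emeasure_distr emeasure_density)
        also have "\<dots> = (\<integral>\<^sup>+\<omega>. ennreal (indicator B \<omega> * (\<phi> \<omega> * ?b \<omega>)) \<partial>M)"
          by (intro nn_integral_cong) (auto simp: indicator_def)
        also have "\<dots> = ennreal (\<integral>\<omega>. indicator B \<omega> * (\<phi> \<omega> * ?b \<omega>) \<partial>M)"
          using \<phi>(1) by (intro nn_integral_eq_integral bounded intb BM that) (auto elim: eventually_mono)
        finally show ?thesis .
      qed
      have fm: "(\<lambda>\<omega>. indicator B \<omega> * ?\<alpha> \<omega>) \<in> borel_measurable F" by measurable
      have im: "integrable M (\<lambda>\<omega>. (indicator B \<omega> * ?\<alpha> \<omega>) * ?b \<omega>)"
        using bounded[OF BM intb(1) \<alpha>M \<alpha>01] by (simp add: mult.assoc)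
      have "(\<integral>\<omega>. (indicator B \<omega> * ?\<alpha> \<omega>) * ?b \<omega> \<partial>M)
          = (\<integral>\<omega>. (indicator B \<omega> * ?\<alpha> \<omega>) * real_cond_exp M F ?b \<omega> \<partial>M)"
        by (rule real_cond_exp_intg(2)[symmetric, OF im fm]) measurable
      also have "\<dots> = (\<integral>\<omega>. indicator B \<omega> * real_cond_exp M F ?ab \<omega> \<partial>M)"
      proof (rule integral_cong_AE)
        have "AE \<omega> in M. real_cond_exp M F ?ab \<omega> = ?\<alpha> \<omega> * real_cond_exp M F ?b \<omega>"
          using ci A V unfolding cond_indep_var_def by blast
        then show "AE \<omega> in M. (indicator B \<omega> * ?\<alpha> \<omega>) * real_cond_exp M F ?b \<omega> = indicator B \<omega> * real_cond_exp M F ?ab \<omega>"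
          by eventually_elim simp
      qed (use borel_measurable_cond_exp2 in measurable)
      also have "\<dots> = (\<integral>\<omega>. indicator B \<omega> * ?ab \<omega> \<partial>M)"
      proof (rule real_cond_exp_intg(2))
        show "integrable M (\<lambda>\<omega>. indicator B \<omega> * ?ab \<omega> :: real)"
          using integrable_mult_indicator[OF BM intb(2)] by simp
      qed measurable
      also have "\<dots> = (\<integral>\<omega>. indicator B \<omega> * (?a \<omega> * ?b \<omega>) \<partial>M)"
        by (intro Bochner_Integration.integral_cong) (auto simp: indicator_def)
      finally show "emeasure (distr ?d1 T Y) V = emeasure (distr ?d2 T Y) V"
        unfolding e[OF aM a01] e[OF \<alpha>M \<alpha>01] by (simp add: mult.assoc)
    qed simp
    then have "integral\<^sup>L (distr ?d1 T Y) g = integral\<^sup>L (distr ?d2 T Y) g" by simp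
    moreover have "integral\<^sup>L (distr ?d1 T Y) g = (\<integral>\<omega>. indicator B \<omega> * (?a \<omega> * ?gY \<omega>) \<partial>M)"
      by (subst integral_distr) (simp_all add: integral_density mult.assoc)
    moreover have "integral\<^sup>L (distr ?d2 T Y) g = (\<integral>\<omega>. indicator B \<omega> * (?\<alpha> \<omega> * ?gY \<omega>) \<partial>M)"
    proof -
      have "AE \<omega> in M. 0 \<le> indicator B \<omega> * ?\<alpha> \<omega>" using \<alpha>01(1) by eventually_elim simp
      then show ?thesis by (subst integral_distr) (simp_all add: integral_density mult.assoc)
    qed
    ultimately show ?thesis by simp
  qed
  show ?thesis
  proof (rule real_cond_exp_charact)
    have full: "space M \<in> sets M" by simp
    show "integrable M (\<lambda>\<omega>. ?a \<omega> * ?gY \<omega>)"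
      by (rule Bochner_Integration.integrable_bound[OF int]) (auto simp: indicator_def)
    have "integrable M (real_cond_exp M F ?gY)" by (rule real_cond_exp_int[OF int])
    then show "integrable M (\<lambda>\<omega>. ?\<alpha> \<omega> * real_cond_exp M F ?gY \<omega>)"
      by (rule Bochner_Integration.integrable_cong[THEN iffD1, rotated 2, OF bounded[OF full _ \<alpha>M \<alpha>01]]) auto
    show "(\<lambda>\<omega>. ?\<alpha> \<omega> * real_cond_exp M F ?gY \<omega>) \<in> borel_measurable F"
      by (intro borel_measurable_times borel_measurable_cond_exp)
    fix B assume B[measurable]: "B \<in> sets F"
    then have BM: "B \<in> sets M" using F by (auto simp: subalgebra_def)
    have fm: "(\<lambda>\<omega>. indicator B \<omega> * ?\<alpha> \<omega>) \<in> borel_measurable F" by measurable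
    have "(\<integral>\<omega>. (indicator B \<omega> * ?\<alpha> \<omega>) * ?gY \<omega> \<partial>M)
        = (\<integral>\<omega>. (indicator B \<omega> * ?\<alpha> \<omega>) * real_cond_exp M F ?gY \<omega> \<partial>M)"
      using bounded[OF BM int \<alpha>M \<alpha>01] by (intro real_cond_exp_intg(2)[symmetric] fm gYM) (simp add: mult.assoc)
    then show "(\<integral>\<omega>\<in>B. (?a \<omega> * ?gY \<omega>) \<partial>M) = (\<integral>\<omega>\<in>B. (?\<alpha> \<omega> * real_cond_exp M F ?gY \<omega>) \<partial>M)"
      unfolding set_lebesgue_integral_def using key[OF B] by (simp add: mult.assoc)
  qed
qed

section \<open>The urn and its conditional increments\<close>

lemma harm_le_ln: "m \<ge> 1 \<Longrightarrow> harm m \<le> 1 + ln (real m)"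
proof (induction m rule: nat_induct_at_least)
  case (Suc m)
  have "ln (real m / real (Suc m)) \<le> real m / real (Suc m) - 1"
    using Suc.hyps by (intro ln_le_minus_one) simp
  also have "\<dots> = - inverse (real (Suc m))" by (simp add: field_simps)
  finally have "ln (real m) - ln (real (Suc m)) \<le> - inverse (real (Suc m))"
    using Suc.hyps by (simp add: ln_div)
  then show ?case using Suc.IH by (simp add: harm_Suc)
qed (simp add: harm_def)

text \<open>Inside the expectation, at most \<open>D\<close> levels lie below \<open>D\<close>, and each has weight at most
\<open>2 + log D\<close>.\<close>

lemma (in prob_space) summable_harm_tail:
  assumes D[measurable]: "D \<in> borel_measurable M" and pos: "\<And>\<omega>. \<omega> \<in> space M \<Longrightarrow> 0 < D \<omega>"
    and int: "integrable M D" "integrable M (\<lambda>\<omega>. D \<omega> * log_plus (D \<omega>))"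
  shows "summable (\<lambda>m. (1 + harm (Suc m)) * prob {\<omega>\<in>space M. D \<omega> > real (Suc m)})"
proof (rule summableI_nonneg_bounded)
  have h: "0 \<le> (harm n :: real)" for n by (simp add: harm_nonneg)
  show "0 \<le> (1 + harm (Suc m)) * prob {\<omega>\<in>space M. D \<omega> > real (Suc m)}" for m
    using h[of "Suc m"] by simp
  show "(\<Sum>m<n. (1 + harm (Suc m)) * prob {\<omega>\<in>space M. D \<omega> > real (Suc m)})
      \<le> (\<integral>\<omega>. 2 * D \<omega> + D \<omega> * log_plus (D \<omega>) \<partial>M)" for n
  proof -
    have "(\<Sum>m<n. (1 + harm (Suc m)) * prob {\<omega>\<in>space M. D \<omega> > real (Suc m)})
        = (\<integral>\<omega>. (\<Sum>m<n. (1 + harm (Suc m)) * of_bool (D \<omega> > real (Suc m))) \<partial>M)"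
      by (subst Bochner_Integration.integral_sum) (simp_all add: expectation_level del: of_nat_Suc)
    also have "\<dots> \<le> (\<integral>\<omega>. 2 * D \<omega> + D \<omega> * log_plus (D \<omega>) \<partial>M)"
    proof (rule integral_mono)
      show "integrable M (\<lambda>\<omega>. \<Sum>m<n. (1 + harm (Suc m)) * of_bool (D \<omega> > real (Suc m)) :: real)"
        by (intro Bochner_Integration.integrable_sum integrable_mult_right expectation_level D)
      show "integrable M (\<lambda>\<omega>. 2 * D \<omega> + D \<omega> * log_plus (D \<omega>))" using int by simp
      fix \<omega> assume "\<omega> \<in> space M"
      then have D0: "0 < D \<omega>" by (rule pos)
      define K where "K = {m. m < n \<and> D \<omega> > real (Suc m)}"
      have "(\<Sum>m<n. (1 + harm (Suc m)) * of_bool (D \<omega> > real (Suc m)) :: real) = (\<Sum>m\<in>K. 1 + harm (Suc m))"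
        unfolding K_def by (intro sum.mono_neutral_cong_right) auto
      also have "\<dots> \<le> (\<Sum>m\<in>K. 2 + log_plus (D \<omega>))"
      proof (rule sum_mono)
        fix m assume "m \<in> K"
        then have "ln (real (Suc m)) \<le> ln (D \<omega>)" using D0 by (simp add: K_def)
        then show "1 + harm (Suc m) \<le> 2 + log_plus (D \<omega>)"
          using harm_le_ln[of "Suc m"] by (simp add: log_plus_def)
      qed
      also have "\<dots> = real (card K) * (2 + log_plus (D \<omega>))" by simp
      also have "\<dots> \<le> D \<omega> * (2 + log_plus (D \<omega>))"
      proof (rule mult_right_mono)
        have "K \<subseteq> {..<nat \<lfloor>D \<omega>\<rfloor>}"
        proof
          fix m assume "m \<in> K"
          then have "Suc m \<le> nat \<lfloor>D \<omega>\<rfloor>" by (intro le_nat_floor) (simp add: K_def)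
          then show "m \<in> {..<nat \<lfloor>D \<omega>\<rfloor>}" by simp
        qed
        then have "card K \<le> nat \<lfloor>D \<omega>\<rfloor>" by (metis card_lessThan card_mono finite_lessThan)
        then show "real (card K) \<le> D \<omega>" using D0 by linarith
      qed (simp add: log_plus_def)
      finally show "(\<Sum>m<n. (1 + harm (Suc m)) * of_bool (D \<omega> > real (Suc m))) \<le> 2 * D \<omega> + D \<omega> * log_plus (D \<omega>)"
        by (simp add: algebra_simps)
    qed
    finally show ?thesis .
  qed
qed

lemma borel_measurable_vec_mat:
  fixes f :: "'a \<Rightarrow> real^'k" and B :: "'a \<Rightarrow> real^'k^'k"
  assumes "f \<in> borel_measurable M" "B \<in> borel_measurable M"
  shows "(\<lambda>\<omega>. f \<omega> v* B \<omega>) \<in> borel_measurable M"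
  by (rule borel_measurable_continuous_Pair[OF assms])
     (intro continuous_on_vec_mat continuous_on_fst continuous_on_snd continuous_on_id)

lemma row_sum_norm_eq_Max: "row_sum_norm A = Max ((\<lambda>i. \<Sum>j\<in>UNIV. \<bar>A $ i $ j\<bar>) ` UNIV)"
  by (simp add: row_sum_norm_def)

lemma borel_measurable_row_sum_norm:
  assumes "f \<in> borel_measurable M"
  shows "(\<lambda>\<omega>. row_sum_norm (f \<omega>)) \<in> borel_measurable M"
  unfolding row_sum_norm_eq_Max
  by (intro borel_measurable_Max borel_measurable_sum borel_measurable_abs measurable_vec_nth assms) auto

context randomized_urn
begin

abbreviation F where "F \<equiv> urn_filtration M C0 drawn R"
abbreviation Cn where "Cn \<equiv> urn_config C0 drawn R"
abbreviation Sn where "Sn \<equiv> urn_total C0 drawn R"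
abbreviation Hn where "Hn \<equiv> urn_mean_replacement M C0 drawn R"

definition urn_generator :: "nat \<Rightarrow> 'a set set" where
  "urn_generator n =
    {C0 -` A \<inter> space M | A. A \<in> sets borel} \<union>
    {R m -` A \<inter> space M | A m. A \<in> sets borel \<and> m \<in> {1..n}} \<union>
    {drawn m -` A \<inter> space M | A m. A \<in> sets borel \<and> m \<in> {1..n}}"

lemma sets_F: "sets (F n) = sigma_sets (space M) (urn_generator n)"
proof -
  have "urn_generator n \<subseteq> Pow (space M)" by (auto simp: urn_generator_def)
  then show ?thesis unfolding urn_filtration_def urn_generator_def[symmetric] by (rule sets_measure_of)
qed

lemma space_F: "space (F n) = space M"
  using subalgebra_urn_filtration by (simp add: subalgebra_def)

sublocale filt: discrete_filtration M F
proof
  fix n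
  have 1: "{R m -` A \<inter> space M | A m. A \<in> sets borel \<and> m \<in> {1..n}}
      \<subseteq> {R m -` A \<inter> space M | A m. A \<in> sets borel \<and> m \<in> {1..Suc n}}"
    by (intro Collect_mono impI, elim exE conjE, intro exI conjI, assumption+) simp
  have 2: "{drawn m -` A \<inter> space M | A m. A \<in> sets borel \<and> m \<in> {1..n}}
      \<subseteq> {drawn m -` A \<inter> space M | A m. A \<in> sets borel \<and> m \<in> {1..Suc n}}"
    by (intro Collect_mono impI, elim exE conjE, intro exI conjI, assumption+) simp
  have "urn_generator n \<subseteq> urn_generator (Suc n)"
    unfolding urn_generator_def by (intro Un_mono subset_refl 1 2)
  then show "sets (F n) \<subseteq> sets (F (Suc n))" unfolding sets_F by (rule sigma_sets_mono')
qed (rule subalgebra_urn_filtration)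

lemma measurable_F:
  "C0 \<in> borel_measurable (F n)"
  "m \<ge> 1 \<Longrightarrow> m \<le> n \<Longrightarrow> R m \<in> borel_measurable (F n)"
  "m \<ge> 1 \<Longrightarrow> m \<le> n \<Longrightarrow> drawn m \<in> borel_measurable (F n)"
proof -
  show "C0 \<in> borel_measurable (F n)"
    by (rule measurableI) (auto simp: space_F sets_F urn_generator_def intro!: sigma_sets.Basic)
  show "R m \<in> borel_measurable (F n)" if "m \<ge> 1" "m \<le> n"
    using that by (intro measurableI) (auto simp: space_F sets_F urn_generator_def intro!: sigma_sets.Basic)
  show "drawn m \<in> borel_measurable (F n)" if "m \<ge> 1" "m \<le> n"
    using that by (intro measurableI) (auto simp: space_F sets_F urn_generator_def intro!: sigma_sets.Basic)
qed

lemma config_measurable: "Cn n \<in> borel_measurable (F n)"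
proof (induction n)
  case 0
  have "Cn 0 = C0" by (simp add: fun_eq_iff)
  then show ?case using measurable_F(1) by simp
next
  case (Suc n)
  have "Cn (Suc n) = (\<lambda>\<omega>. Cn n \<omega> + drawn (Suc n) \<omega> v* R (Suc n) \<omega>)" by (simp add: fun_eq_iff)
  moreover have "Cn n \<in> borel_measurable (F (Suc n))"
    using Suc filt.mono[of n] space_F by (auto simp: measurable_def)
  ultimately show ?case
    using measurable_F by (simp add: borel_measurable_add borel_measurable_vec_mat)
qed

lemma config_measurable_M: "Cn n \<in> borel_measurable M"
  by (rule measurable_from_subalg[OF subalgebra_urn_filtration config_measurable])

lemma drawn_eq_indicator:
  assumes "n \<ge> 1" "\<omega> \<in> space M"
  shows "drawn n \<omega> $ i = indicator {\<omega>\<in>space M. drawn n \<omega> = axis i 1} \<omega>"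
proof -
  obtain j where "drawn n \<omega> = axis j 1" using drawn_range[OF assms] by auto
  then show ?thesis using assms(2) by (auto simp: indicator_def axis_def vec_eq_iff)
qed

lemma drawn_simplex: "n \<ge> 1 \<Longrightarrow> \<omega> \<in> space M \<Longrightarrow> drawn n \<omega> \<in> prob_simplex"
  using drawn_range[of n \<omega>] by (auto simp: prob_simplex_def axis_def)

abbreviation share :: "nat \<Rightarrow> 'a \<Rightarrow> real^'k" where
  "share n \<omega> \<equiv> Cn n \<omega> /\<^sub>R Sn n \<omega>"

lemma draw_prob_Suc:
  "AE \<omega> in M. real_cond_exp M (F n) (indicator {\<omega>\<in>space M. drawn (Suc n) \<omega> = axis i 1}) \<omega>
     = share n \<omega> $ i"
  using draw_prob[of "Suc n" i] by (simp add: divide_inverse mult.commute)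

lemma cond_exp_drawn:
  "AE \<omega> in M. real_cond_exp M (F n) (\<lambda>\<omega>. drawn (Suc n) \<omega> $ i) \<omega> = share n \<omega> $ i"
proof -
  interpret sigma_finite_subalgebra M "F n" by (rule filt.sigma_finite_subalgebra)
  have [measurable]: "drawn (Suc n) \<in> borel_measurable M" by (rule measurable_drawn) simp
  have "AE \<omega> in M. real_cond_exp M (F n) (\<lambda>\<omega>. drawn (Suc n) \<omega> $ i) \<omega>
      = real_cond_exp M (F n) (indicator {\<omega>\<in>space M. drawn (Suc n) \<omega> = axis i 1}) \<omega>"
    by (intro real_cond_exp_cong AE_I2 drawn_eq_indicator measurable_vec_nth) auto
  then show ?thesis using draw_prob_Suc[of n i] by eventually_elim simp
qed

lemma integrable_entry: "integrable M (\<lambda>\<omega>. R (Suc n) \<omega> $ i $ j)"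
proof (rule Bochner_Integration.integrable_bound[OF R_integrable[of "Suc n"]])
  show "(\<lambda>\<omega>. R (Suc n) \<omega> $ i $ j) \<in> borel_measurable M"
    by (intro measurable_vec_nth measurable_R) simp
  show "AE \<omega> in M. norm (R (Suc n) \<omega> $ i $ j) \<le> norm (R (Suc n) \<omega>)"
    by (intro AE_I2 order_trans[OF Finite_Cartesian_Product.norm_nth_le Finite_Cartesian_Product.norm_nth_le])
qed simp

lemma cond_exp_increment:
  "AE \<omega> in M. real_cond_exp M (F n) (\<lambda>\<omega>. (drawn (Suc n) \<omega> v* R (Suc n) \<omega>) $ j) \<omega>
     = (share n \<omega> v* Hn n \<omega>) $ j"
proof -
  interpret sigma_finite_subalgebra M "F n" by (rule filt.sigma_finite_subalgebra)
  have dM[measurable]: "drawn (Suc n) \<in> borel_measurable M" by (rule measurable_drawn) simp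
  have RM[measurable]: "R (Suc n) \<in> borel_measurable M" by (rule measurable_R) simp
  let ?a = "\<lambda>i. indicator {\<omega>\<in>space M. drawn (Suc n) \<omega> \<in> {axis i 1}} :: 'a \<Rightarrow> real"
  have 1: "AE \<omega> in M. real_cond_exp M (F n) (\<lambda>\<omega>. ?a i \<omega> * R (Suc n) \<omega> $ i $ j) \<omega>
      = share n \<omega> $ i * Hn n \<omega> $ i $ j" for i
  proof -
    have "AE \<omega> in M. real_cond_exp M (F n) (\<lambda>\<omega>. ?a i \<omega> * R (Suc n) \<omega> $ i $ j) \<omega>
      = real_cond_exp M (F n) (?a i) \<omega> * real_cond_exp M (F n) (\<lambda>\<omega>. R (Suc n) \<omega> $ i $ j) \<omega>"
      using draw_indep[of "Suc n"]
      by (intro cond_exp_indicator_mult[where S=borel and T=borel and g="\<lambda>B. B $ i $ j"]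
          subalgebra_urn_filtration integrable_entry dM RM measurable_vec_nth measurable_ident_sets[OF refl]) auto
    then show ?thesis
      using draw_prob_Suc[of n i]
      by eventually_elim (simp add: urn_mean_replacement_def matrix_cond_exp_def)
  qed
  have inta: "integrable M (\<lambda>\<omega>. ?a i \<omega> * R (Suc n) \<omega> $ i $ j)" for i
    using borel_measurable_integrable[OF integrable_entry[of n i j]]
    by (intro Bochner_Integration.integrable_bound[OF integrable_entry[of n i j]]) (auto simp: indicator_def)
  have 2: "AE \<omega> in M. real_cond_exp M (F n) (\<lambda>\<omega>. \<Sum>i\<in>UNIV. ?a i \<omega> * R (Suc n) \<omega> $ i $ j) \<omega>
      = (\<Sum>i\<in>UNIV. real_cond_exp M (F n) (\<lambda>\<omega>. ?a i \<omega> * R (Suc n) \<omega> $ i $ j) \<omega>)"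
    by (rule real_cond_exp_sum) (rule inta)
  have 3: "AE \<omega> in M. real_cond_exp M (F n) (\<lambda>\<omega>. (drawn (Suc n) \<omega> v* R (Suc n) \<omega>) $ j) \<omega>
      = real_cond_exp M (F n) (\<lambda>\<omega>. \<Sum>i\<in>UNIV. ?a i \<omega> * R (Suc n) \<omega> $ i $ j) \<omega>"
  proof (rule real_cond_exp_cong)
    show "AE \<omega> in M. (drawn (Suc n) \<omega> v* R (Suc n) \<omega>) $ j = (\<Sum>i\<in>UNIV. ?a i \<omega> * R (Suc n) \<omega> $ i $ j)"
      by (intro AE_I2) (simp add: vec_mat_component drawn_eq_indicator)
    show "(\<lambda>\<omega>. (drawn (Suc n) \<omega> v* R (Suc n) \<omega>) $ j) \<in> borel_measurable M"
      by (intro measurable_vec_nth borel_measurable_vec_mat dM RM)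
    show "(\<lambda>\<omega>. \<Sum>i\<in>UNIV. ?a i \<omega> * R (Suc n) \<omega> $ i $ j) \<in> borel_measurable M"
      using inta by (intro borel_measurable_sum) auto
  qed
  have "AE \<omega> in M. \<forall>i\<in>UNIV. real_cond_exp M (F n) (\<lambda>\<omega>. ?a i \<omega> * R (Suc n) \<omega> $ i $ j) \<omega>
      = share n \<omega> $ i * Hn n \<omega> $ i $ j"
    by (intro AE_finite_allI 1) simp
  with 2 3 show ?thesis by eventually_elim (simp add: vec_mat_component)
qed

end

section \<open>Convergence in mean\<close>

lemma (in prob_space) Fatou_bound:
  fixes f :: "nat \<Rightarrow> 'a \<Rightarrow> real"
  assumes int: "\<And>n. integrable M (f n)" and nonneg: "\<And>n. AE \<omega> in M. 0 \<le> f n \<omega>"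
    and g[measurable]: "g \<in> borel_measurable M"
    and lim: "AE \<omega> in M. (\<lambda>n. f n \<omega>) \<longlonglongrightarrow> g \<omega>"
    and bound: "\<And>n. (\<integral>\<omega>. f n \<omega> \<partial>M) \<le> c"
  shows "integrable M g" "(\<integral>\<omega>. g \<omega> \<partial>M) \<le> c"
proof -
  have [measurable]: "f n \<in> borel_measurable M" for n using int by simp
  have "AE \<omega> in M. \<forall>n. 0 \<le> f n \<omega>" using nonneg by (simp add: AE_all_countable)
  with lim have g0: "AE \<omega> in M. 0 \<le> g \<omega>"
    by eventually_elim (rule LIMSEQ_le_const, auto)
  have c0: "0 \<le> c" using integral_nonneg_AE[OF nonneg[of 0]] bound[of 0] by linarith
  have "(\<integral>\<^sup>+\<omega>. ennreal (g \<omega>) \<partial>M) = (\<integral>\<^sup>+\<omega>. liminf (\<lambda>n. ennreal (f n \<omega>)) \<partial>M)"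
  proof (rule nn_integral_cong_AE)
    show "AE \<omega> in M. ennreal (g \<omega>) = liminf (\<lambda>n. ennreal (f n \<omega>))"
      using lim by eventually_elim (rule lim_imp_Liminf[symmetric], auto intro: tendsto_ennrealI)
  qed
  also have "\<dots> \<le> liminf (\<lambda>n. \<integral>\<^sup>+\<omega>. ennreal (f n \<omega>) \<partial>M)"
    by (rule nn_integral_liminf) simp
  also have "\<dots> \<le> liminf (\<lambda>n. ennreal c)"
  proof (intro Liminf_mono always_eventually allI)
    fix n
    show "(\<integral>\<^sup>+\<omega>. ennreal (f n \<omega>) \<partial>M) \<le> ennreal c"
      unfolding nn_integral_eq_integral[OF int nonneg] using bound by (rule ennreal_leI)
  qed
  also have "\<dots> = ennreal c" by (simp add: Liminf_const)
  finally have le: "(\<integral>\<^sup>+\<omega>. ennreal (g \<omega>) \<partial>M) \<le> ennreal c" .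
  show int_g: "integrable M g"
    using le g0 by (intro integrableI_nonneg) (auto simp: less_top[symmetric] top_unique)
  show "(\<integral>\<omega>. g \<omega> \<partial>M) \<le> c"
    using le c0 unfolding nn_integral_eq_integral[OF int_g g0] by simp
qed

lemma (in prob_space) tendsto_L1_bounded:
  fixes X :: "nat \<Rightarrow> 'a \<Rightarrow> 'b::{banach, second_countable_topology}"
  assumes X[measurable]: "\<And>n. X n \<in> borel_measurable M" and Y[measurable]: "Y \<in> borel_measurable M"
    and bound: "\<And>n. AE \<omega> in M. norm (X n \<omega>) \<le> B"
    and lim: "tendsto_AE M X Y"
  shows "tendsto_L1 M X Y"
proof -
  have "AE \<omega> in M. \<forall>n. norm (X n \<omega>) \<le> B" using bound by (simp add: AE_all_countable)
  with lim[unfolded tendsto_AE_def] have YB: "AE \<omega> in M. norm (Y \<omega>) \<le> B"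
    by eventually_elim (rule Lim_norm_ubound[of sequentially], auto)
  have "(\<lambda>n. \<integral>\<omega>. norm (X n \<omega> - Y \<omega>) \<partial>M) \<longlonglongrightarrow> (\<integral>\<omega>. 0 \<partial>M)"
  proof (rule integral_dominated_convergence[where w="\<lambda>\<omega>. B + B"])
    show "AE \<omega> in M. (\<lambda>n. norm (X n \<omega> - Y \<omega>)) \<longlonglongrightarrow> 0"
      using lim[unfolded tendsto_AE_def] by eventually_elim (simp add: LIM_zero tendsto_norm_zero)
    show "AE \<omega> in M. norm (norm (X n \<omega> - Y \<omega>)) \<le> B + B" for n
      using bound[of n] YB
      by eventually_elim (simp, rule order_trans[OF norm_triangle_ineq4], simp)
  qed auto
  then show ?thesis
    unfolding tendsto_L1_def using integrable_const_bound[OF bound X] integrable_const_bound[OF YB Y] by simp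
qed

text \<open>Cut the variables at the level \<open>T + G\<close>. The cut variables converge in mean by dominated convergence, the
parts above the level contribute at most \<open>\<delta> T\<close>, and by Fatou's lemma so does the part of the limit.\<close>

lemma (in prob_space) tendsto_L1_of_excess_bound:
  fixes Z :: "nat \<Rightarrow> 'a \<Rightarrow> real"
  assumes Z: "\<And>n. integrable M (Z n)" and nonneg: "\<And>n. AE \<omega> in M. 0 \<le> Z n \<omega>"
    and L[measurable]: "L \<in> borel_measurable M" and lim: "tendsto_AE M Z L"
    and G: "integrable M G" "AE \<omega> in M. 0 \<le> G \<omega>"
    and excess: "\<And>n T. n \<ge> 1 \<Longrightarrow> (\<integral>\<omega>. max (Z n \<omega> - real T - G \<omega>) 0 \<partial>M) \<le> \<delta> T"
    and \<delta>: "\<delta> \<longlonglongrightarrow> 0"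
  shows "tendsto_L1 M Z L"
proof -
  have [measurable]: "Z n \<in> borel_measurable M" "G \<in> borel_measurable M" for n using Z G by auto
  have lim': "AE \<omega> in M. (\<lambda>n. Z n \<omega>) \<longlonglongrightarrow> L \<omega>" using lim by (simp add: tendsto_AE_def)
  have "AE \<omega> in M. \<forall>n. 0 \<le> Z n \<omega>" using nonneg by (simp add: AE_all_countable)
  with lim' have L0: "AE \<omega> in M. 0 \<le> L \<omega>"
    by eventually_elim (rule LIMSEQ_le_const, auto)
  have iex: "integrable M (\<lambda>\<omega>. max (Z n \<omega> - real T - G \<omega>) 0)" for n T using Z G by simp
  \<comment> \<open>The bound is assumed from \<open>n = 1\<close> on only, hence the shifted sequence.\<close>
  have exL: "integrable M (\<lambda>\<omega>. max (L \<omega> - real T - G \<omega>) 0)"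
      "(\<integral>\<omega>. max (L \<omega> - real T - G \<omega>) 0 \<partial>M) \<le> \<delta> T" for T
  proof -
    let ?f = "\<lambda>n \<omega>. max (Z (Suc n) \<omega> - real T - G \<omega>) 0"
    have conv: "AE \<omega> in M. (\<lambda>n. max (Z (Suc n) \<omega> - real T - G \<omega>) 0) \<longlonglongrightarrow> max (L \<omega> - real T - G \<omega>) 0"
      using lim' by eventually_elim (intro tendsto_intros LIMSEQ_Suc)
    have b: "(\<integral>\<omega>. ?f n \<omega> \<partial>M) \<le> \<delta> T" for n by (rule excess) simp
    have nn: "AE \<omega> in M. 0 \<le> ?f n \<omega>" for n by simp
    have m: "(\<lambda>\<omega>. max (L \<omega> - real T - G \<omega>) 0) \<in> borel_measurable M" by measurable
    show "integrable M (\<lambda>\<omega>. max (L \<omega> - real T - G \<omega>) 0)"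
      "(\<integral>\<omega>. max (L \<omega> - real T - G \<omega>) 0 \<partial>M) \<le> \<delta> T"
      by (rule Fatou_bound[where f="?f", OF iex nn m conv b])+
  qed
  have iL: "integrable M L"
  proof (rule Bochner_Integration.integrable_bound)
    show "integrable M (\<lambda>\<omega>. G \<omega> + max (L \<omega> - real 0 - G \<omega>) 0)" using G exL(1)[of 0] by simp
    show "AE \<omega> in M. norm (L \<omega>) \<le> norm (G \<omega> + max (L \<omega> - real 0 - G \<omega>) 0)"
      using L0 G(2) by eventually_elim auto
  qed simp
  let ?a = "\<lambda>T n \<omega>. \<bar>min (Z n \<omega>) (real T + G \<omega>) - min (L \<omega>) (real T + G \<omega>)\<bar>"
  have core: "(\<lambda>n. \<integral>\<omega>. ?a T n \<omega> \<partial>M) \<longlonglongrightarrow> 0" for T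
  proof -
    have "(\<lambda>n. \<integral>\<omega>. ?a T n \<omega> \<partial>M) \<longlonglongrightarrow> (\<integral>\<omega>. 0 \<partial>M)"
    proof (rule integral_dominated_convergence[where w="\<lambda>\<omega>. real T + G \<omega>"])
      show "integrable M (\<lambda>\<omega>. real T + G \<omega>)" using G by simp
      show "AE \<omega> in M. (\<lambda>n. ?a T n \<omega>) \<longlonglongrightarrow> 0"
        using lim'
      proof eventually_elim
        case (elim \<omega>)
        have "(\<lambda>n. ?a T n \<omega>)
            \<longlonglongrightarrow> \<bar>min (L \<omega>) (real T + G \<omega>) - min (L \<omega>) (real T + G \<omega>)\<bar>"
          by (intro tendsto_intros elim)
        then show ?case by simp
      qed
      show "AE \<omega> in M. norm (?a T n \<omega>) \<le> real T + G \<omega>" for n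
        using nonneg[of n] L0 G(2) by eventually_elim (auto simp: min_def)
    qed auto
    then show ?thesis by simp
  qed
  have "(\<lambda>n. \<integral>\<omega>. norm (Z n \<omega> - L \<omega>) \<partial>M) \<longlonglongrightarrow> 0"
  proof (rule LIMSEQ_I)
    fix r :: real assume r: "0 < r"
    obtain T where T: "\<bar>\<delta> T\<bar> < r / 4" using LIMSEQ_D[OF \<delta>, of "r / 4"] r by auto
    obtain N where N: "\<And>n. n \<ge> N \<Longrightarrow>
        \<bar>\<integral>\<omega>. ?a T n \<omega> \<partial>M\<bar> < r / 2"
      using LIMSEQ_D[OF core[of T], of "r / 2"] r by auto
    have "(\<integral>\<omega>. norm (Z n \<omega> - L \<omega>) \<partial>M) < r" if n: "n \<ge> max N 1" for n
    proof -
      let ?b = "\<lambda>\<omega>. max (Z n \<omega> - real T - G \<omega>) 0"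
      let ?c = "\<lambda>\<omega>. max (L \<omega> - real T - G \<omega>) 0"
      have ia: "integrable M (?a T n)" using Z G iL by simp
      have "(\<integral>\<omega>. norm (Z n \<omega> - L \<omega>) \<partial>M) \<le> (\<integral>\<omega>. ?a T n \<omega> + ?b \<omega> + ?c \<omega> \<partial>M)"
        using Z iL ia iex[of n T] exL(1)[of T] by (intro integral_mono) (auto simp: min_def max_def)
      also have "\<dots> = (\<integral>\<omega>. ?a T n \<omega> \<partial>M) + (\<integral>\<omega>. ?b \<omega> \<partial>M) + (\<integral>\<omega>. ?c \<omega> \<partial>M)"
        using ia iex[of n T] exL(1)[of T] by simp
      also have "\<dots> < r / 2 + r / 4 + r / 4"
        using N[of n] n excess[of n T] exL(2)[of T] T by auto
      finally show ?thesis by simp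
    qed
    moreover have "0 \<le> (\<integral>\<omega>. norm (Z n \<omega> - L \<omega>) \<partial>M)" for n by simp
    ultimately show "\<exists>no. \<forall>n\<ge>no. norm ((\<integral>\<omega>. norm (Z n \<omega> - L \<omega>) \<partial>M) - 0) < r"
      by (intro exI[of _ "max N 1"]) auto
  qed
  then show ?thesis unfolding tendsto_L1_def using Z iL by simp
qed

lemma row_sum_norm_le_sum: "row_sum_norm A \<le> (\<Sum>i\<in>UNIV. \<Sum>j\<in>UNIV. \<bar>A $ i $ j\<bar>)"
  unfolding row_sum_norm_def
proof (rule Max.boundedI)
  fix a assume "a \<in> range (\<lambda>i. \<Sum>j\<in>UNIV. \<bar>A $ i $ j\<bar>)"
  then obtain i where "a = (\<Sum>j\<in>UNIV. \<bar>A $ i $ j\<bar>)" by blast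
  also have "\<dots> \<le> (\<Sum>i\<in>UNIV. \<Sum>j\<in>UNIV. \<bar>A $ i $ j\<bar>)"
    by (rule member_le_sum) (auto intro: sum_nonneg)
  finally show "a \<le> (\<Sum>i\<in>UNIV. \<Sum>j\<in>UNIV. \<bar>A $ i $ j\<bar>)" .
qed auto

lemma simplex_vec_mat_le:
  assumes y: "y \<in> prob_simplex"
  shows "\<bar>(y v* B) $ j\<bar> \<le> row_sum_norm B"
proof -
  have "\<bar>(y v* B) $ j\<bar> \<le> (\<Sum>i\<in>UNIV. y $ i * \<bar>B $ i $ j\<bar>)"
    unfolding vec_mat_component using y
    by (intro order_trans[OF sum_abs]) (auto simp: prob_simplex_def abs_mult)
  also have "\<dots> \<le> (\<Sum>i\<in>UNIV. y $ i * row_sum_norm B)"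
    using y entry_le_row_sum_norm by (intro sum_mono mult_left_mono) (auto simp: prob_simplex_def)
  also have "\<dots> = row_sum_norm B"
    using y by (simp add: prob_simplex_def sum_distrib_right[symmetric])
  finally show ?thesis .
qed

lemma simplex_mass_vec_mat_le:
  assumes y: "y \<in> prob_simplex"
  shows "mass (y v* B) \<le> row_sum_norm B"
proof -
  have "mass (y v* B) \<le> (\<Sum>i\<in>UNIV. y $ i * row_sum_norm B)"
    unfolding mass_vec_mat
  proof (intro sum_mono mult_left_mono)
    fix i
    show "(\<Sum>j\<in>UNIV. B $ i $ j) \<le> row_sum_norm B"
      by (rule order_trans[OF sum_mono row_le_row_sum_norm]) (rule abs_ge_self)
  qed (use y in \<open>auto simp: prob_simplex_def\<close>)
  also have "\<dots> = row_sum_norm B"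
    using y by (simp add: prob_simplex_def sum_distrib_right[symmetric])
  finally show ?thesis .
qed

context randomized_urn
begin

abbreviation inc :: "nat \<Rightarrow> 'a \<Rightarrow> real^'k" where
  "inc n \<omega> \<equiv> drawn (Suc n) \<omega> v* R (Suc n) \<omega>"

lemma integrable_row_sum_norm: "integrable M (\<lambda>\<omega>. row_sum_norm (R (Suc n) \<omega>))"
proof (rule Bochner_Integration.integrable_bound)
  show "integrable M (\<lambda>\<omega>. \<Sum>i\<in>UNIV. \<Sum>j\<in>UNIV. \<bar>R (Suc n) \<omega> $ i $ j\<bar>)"
    by (intro Bochner_Integration.integrable_sum integrable_abs integrable_entry)
  show "(\<lambda>\<omega>. row_sum_norm (R (Suc n) \<omega>)) \<in> borel_measurable M"
    by (intro borel_measurable_row_sum_norm measurable_R) simp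
  show "AE \<omega> in M. norm (row_sum_norm (R (Suc n) \<omega>)) \<le> norm (\<Sum>i\<in>UNIV. \<Sum>j\<in>UNIV. \<bar>R (Suc n) \<omega> $ i $ j\<bar>)"
  proof (rule AE_I2)
    fix \<omega>
    show "norm (row_sum_norm (R (Suc n) \<omega>)) \<le> norm (\<Sum>i\<in>UNIV. \<Sum>j\<in>UNIV. \<bar>R (Suc n) \<omega> $ i $ j\<bar>)"
      using row_sum_norm_nonneg[of "R (Suc n) \<omega>"] row_sum_norm_le_sum[of "R (Suc n) \<omega>"] by simp
  qed
qed

lemma inc_bounds:
  assumes "\<omega> \<in> space M"
  shows "0 \<le> inc n \<omega> $ j" "inc n \<omega> $ j \<le> row_sum_norm (R (Suc n) \<omega>)"
    "mass (inc n \<omega>) \<le> row_sum_norm (R (Suc n) \<omega>)"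
proof -
  have d: "drawn (Suc n) \<omega> \<in> prob_simplex" using assms by (intro drawn_simplex) auto
  show "0 \<le> inc n \<omega> $ j"
    unfolding vec_mat_component using d R_nonneg[OF _ assms, of "Suc n"]
    by (intro sum_nonneg mult_nonneg_nonneg) (auto simp: prob_simplex_def nonneg_matrix_def)
  show "inc n \<omega> $ j \<le> row_sum_norm (R (Suc n) \<omega>)"
    using simplex_vec_mat_le[OF d, of "R (Suc n) \<omega>" j] by simp
  show "mass (inc n \<omega>) \<le> row_sum_norm (R (Suc n) \<omega>)" by (rule simplex_mass_vec_mat_le[OF d])
qed

lemma inc_measurable: "inc n \<in> borel_measurable (F (Suc n))"
  by (intro borel_measurable_vec_mat measurable_F) auto

lemma inc_measurable_M: "inc n \<in> borel_measurable M"
  by (rule measurable_from_subalg[OF subalgebra_urn_filtration inc_measurable])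

lemma increments_strong_law:
  assumes tail: "\<And>n m. prob {\<omega>\<in>space M. row_sum_norm (R (Suc n) \<omega>) > real m} \<le> p m"
    and sum: "summable p" "summable (\<lambda>m. harm m * p m)"
  shows "AE \<omega> in M. (\<lambda>n. (\<Sum>k<n. inc k \<omega> $ j - (share k \<omega> v* Hn k \<omega>) $ j) / real n) \<longlonglongrightarrow> 0"
proof -
  have "AE \<omega> in M. (\<lambda>n. (\<Sum>k<n. inc k \<omega> $ j - real_cond_exp M (F k) (\<lambda>\<omega>. inc k \<omega> $ j) \<omega>) / real n) \<longlonglongrightarrow> 0"
  proof (rule filt.strong_law_conditionally_centered[where p=p])
    have m: "(\<lambda>\<omega>. row_sum_norm (R (Suc n) \<omega>)) \<in> borel_measurable M" for n
      by (intro borel_measurable_row_sum_norm measurable_R) simp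
    show "(\<lambda>\<omega>. inc n \<omega> $ j) \<in> borel_measurable (F (Suc n))" for n
      by (intro measurable_vec_nth inc_measurable)
    show "integrable M (\<lambda>\<omega>. inc n \<omega> $ j)" for n
    proof (rule Bochner_Integration.integrable_bound[OF integrable_row_sum_norm[of n]])
      show "(\<lambda>\<omega>. inc n \<omega> $ j) \<in> borel_measurable M" by (intro measurable_vec_nth inc_measurable_M)
      show "AE \<omega> in M. norm (inc n \<omega> $ j) \<le> norm (row_sum_norm (R (Suc n) \<omega>))"
        using inc_bounds(1,2) by (intro AE_I2) (simp add: row_sum_norm_nonneg)
    qed
    show "prob {\<omega>\<in>space M. inc n \<omega> $ j > real m} \<le> p m" for n m
    proof -
      have "prob {\<omega>\<in>space M. inc n \<omega> $ j > real m} \<le> prob {\<omega>\<in>space M. row_sum_norm (R (Suc n) \<omega>) > real m}"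
      proof (rule finite_measure_mono)
        show "{\<omega>\<in>space M. inc n \<omega> $ j > real m} \<subseteq> {\<omega>\<in>space M. row_sum_norm (R (Suc n) \<omega>) > real m}"
          using inc_bounds(2) by (auto intro: less_le_trans)
      qed (use m in measurable)
      then show ?thesis using tail order_trans by blast
    qed
  qed (use inc_bounds(1) sum in auto)
  moreover have "AE \<omega> in M. \<forall>k. real_cond_exp M (F k) (\<lambda>\<omega>. inc k \<omega> $ j) \<omega> = (share k \<omega> v* Hn k \<omega>) $ j"
    unfolding AE_all_countable by (intro allI cond_exp_increment)
  ultimately show ?thesis by eventually_elim simp
qed

text \<open>The variables are bounded by one, so only the level \<open>m = 0\<close> carries any tail.\<close>

lemma draws_strong_law:
  "AE \<omega> in M. (\<lambda>n. (\<Sum>k<n. drawn (Suc k) \<omega> $ i - share k \<omega> $ i) / real n) \<longlonglongrightarrow> 0"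
proof -
  have d: "0 \<le> drawn (Suc n) \<omega> $ i" "drawn (Suc n) \<omega> $ i \<le> 1" if "\<omega> \<in> space M" for n \<omega>
    using drawn_simplex[OF _ that, of "Suc n"] prob_simplex_le_1[of "drawn (Suc n) \<omega>" i]
    by (auto simp: prob_simplex_def)
  have "AE \<omega> in M. (\<lambda>n. (\<Sum>k<n. drawn (Suc k) \<omega> $ i - real_cond_exp M (F k) (\<lambda>\<omega>. drawn (Suc k) \<omega> $ i) \<omega>) / real n) \<longlonglongrightarrow> 0"
  proof (rule filt.strong_law_conditionally_centered[where p="\<lambda>m. of_bool (m = 0)"])
    show dF: "(\<lambda>\<omega>. drawn (Suc n) \<omega> $ i) \<in> borel_measurable (F (Suc n))" for n
      by (intro measurable_vec_nth measurable_F) auto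
    show "integrable M (\<lambda>\<omega>. drawn (Suc n) \<omega> $ i)" for n
      using d filt.measurable_base[OF dF] by (intro integrable_const_bound[where B=1] AE_I2) auto
    show "prob {\<omega>\<in>space M. drawn (Suc n) \<omega> $ i > real m} \<le> of_bool (m = 0)" for n m
    proof (cases "m = 0")
      case False
      have "\<not> real m < drawn (Suc n) \<omega> $ i" if "\<omega> \<in> space M" for \<omega>
        using d(2)[OF that, of n] False by simp
      then have "{\<omega>\<in>space M. drawn (Suc n) \<omega> $ i > real m} = {}" by blast
      then show ?thesis by (simp only: measure_empty) simp
    qed simp
    show "summable (\<lambda>m. of_bool (m = (0::nat)) :: real)" "summable (\<lambda>m. harm m * of_bool (m = (0::nat)) :: real)"
      by (rule summable_finite[of "{0}"]; simp)+
  qed (use d in auto)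
  moreover have "AE \<omega> in M. \<forall>k. real_cond_exp M (F k) (\<lambda>\<omega>. drawn (Suc k) \<omega> $ i) \<omega> = share k \<omega> $ i"
    unfolding AE_all_countable by (intro allI cond_exp_drawn)
  ultimately show ?thesis by eventually_elim simp
qed

lemma config_eq_sum: "Cn n \<omega> = C0 \<omega> + (\<Sum>k<n. inc k \<omega>)"
  by (induction n) (simp_all add: add.assoc)

lemma urn_bounds:
  assumes C0: "C0 \<omega> \<noteq> 0" "\<And>i. 0 \<le> C0 \<omega> $ i" and w: "\<omega> \<in> space M"
  shows "0 < Sn n \<omega>" "share n \<omega> \<in> prob_simplex"
    "Sn n \<omega> \<le> mass (C0 \<omega>) + (\<Sum>k<n. row_sum_norm (R (Suc k) \<omega>))"
proof -
  obtain i where "0 < C0 \<omega> $ i" using C0 by (metis order_le_less vec_eq_iff zero_index)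
  then have t0: "0 < mass (C0 \<omega>)" using C0(2) by (intro sum_pos2[where i=i]) auto
  have S: "Sn n \<omega> = mass (C0 \<omega>) + (\<Sum>k<n. mass (inc k \<omega>))"
    unfolding urn_total_def config_eq_sum mass_linear sum_component by (simp add: sum.swap[of _ UNIV])
  have ti: "0 \<le> mass (inc k \<omega>)" for k using inc_bounds(1)[OF w] by (intro sum_nonneg)
  show S0: "0 < Sn n \<omega>" unfolding S using t0 ti by (simp add: add_pos_nonneg sum_nonneg)
  show "Sn n \<omega> \<le> mass (C0 \<omega>) + (\<Sum>k<n. row_sum_norm (R (Suc k) \<omega>))"
    unfolding S using inc_bounds(3)[OF w] by (intro add_left_mono sum_mono)
  have "0 \<le> Cn n \<omega> $ i" for i
    unfolding config_eq_sum using C0(2) inc_bounds(1)[OF w] by (simp add: sum_nonneg)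
  then show "share n \<omega> \<in> prob_simplex"
    unfolding prob_simplex_def mem_Collect_eq mass_linear using S0 by (auto simp: urn_total_def)
qed

text \<open>The difference \<open>C\<^sub>n / n - x\<^sub>n A\<close> consists of \<open>C\<^sub>0 / n\<close>, the average of the centered increments, and the average of
\<open>Y\<^sub>k (H\<^sub>k - A)\<close>, which is bounded by that of the norms of \<open>H\<^sub>k - A\<close>. So it vanishes in the limit, and \<open>averaged_urn_limit\<close> applies to the path.\<close>

lemma pathwise_limits:
  assumes C0: "C0 \<omega> \<noteq> 0" "\<And>i. 0 \<le> C0 \<omega> $ i" and w: "\<omega> \<in> space M"
    and A: "irreducible_matrix A"
    and H: "(\<lambda>n. (1 / real n) * (\<Sum>k<n. row_sum_norm (Hn k \<omega> - A))) \<longlonglongrightarrow> 0"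
    and inc: "\<And>j. (\<lambda>n. (\<Sum>k<n. inc k \<omega> $ j - (share k \<omega> v* Hn k \<omega>) $ j) / real n) \<longlonglongrightarrow> 0"
    and draws: "\<And>i. (\<lambda>n. (\<Sum>k<n. drawn (Suc k) \<omega> $ i - share k \<omega> $ i) / real n) \<longlonglongrightarrow> 0"
  shows "(\<lambda>n. share n \<omega>) \<longlonglongrightarrow> left_perron_vector A"
    "(\<lambda>n. Sn n \<omega> / real n) \<longlonglongrightarrow> dominant_eigenvalue A"
    "(\<lambda>n. Cn n \<omega> /\<^sub>R real n) \<longlonglongrightarrow> dominant_eigenvalue A *\<^sub>R left_perron_vector A"
    "(\<lambda>n. urn_count drawn n \<omega> /\<^sub>R real n) \<longlonglongrightarrow> left_perron_vector A"
proof -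
  note b = urn_bounds[OF C0 w]
  obtain l p u where "perron_triple A l p u" using exists_perron_triple[OF A] .
  then interpret P: perron_triple A l p u .
  let ?x = "\<lambda>n. (\<Sum>k<n. share k \<omega>) /\<^sub>R real n"
  have drift: "(\<lambda>n. Cn n \<omega> /\<^sub>R real n - ?x n v* A) \<longlonglongrightarrow> 0"
  proof (rule vec_tendstoI)
    fix j
    have 1: "(\<lambda>n. (\<Sum>k<n. (share k \<omega> v* (Hn k \<omega> - A)) $ j) / real n) \<longlonglongrightarrow> 0"
    proof (rule Lim_null_comparison[OF always_eventually H], rule allI)
      fix n
      have "\<bar>\<Sum>k<n. (share k \<omega> v* (Hn k \<omega> - A)) $ j\<bar> \<le> (\<Sum>k<n. row_sum_norm (Hn k \<omega> - A))"
        by (rule order_trans[OF sum_abs]) (intro sum_mono simplex_vec_mat_le b)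
      then show "norm ((\<Sum>k<n. (share k \<omega> v* (Hn k \<omega> - A)) $ j) / real n)
          \<le> (1 / real n) * (\<Sum>k<n. row_sum_norm (Hn k \<omega> - A))"
        by (simp add: divide_right_mono)
    qed
    have 2: "(\<lambda>n. C0 \<omega> $ j / real n) \<longlonglongrightarrow> 0" by (rule lim_const_over_n)
    have "(\<Sum>k<n. share k \<omega>) v* A = (\<Sum>k<n. share k \<omega> v* A)" for n
      by (induction n) (simp_all add: vector_matrix_left_distrib)
    then have xA: "(?x n v* A) $ j = (\<Sum>k<n. (share k \<omega> v* A) $ j) / real n" for n
      unfolding scaleR_vector_matrix_assoc by (simp add: divide_inverse mult.commute)
    have "(Cn n \<omega> /\<^sub>R real n - ?x n v* A) $ j = C0 \<omega> $ j / real n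
        + (\<Sum>k<n. inc k \<omega> $ j - (share k \<omega> v* Hn k \<omega>) $ j) / real n
        + (\<Sum>k<n. (share k \<omega> v* (Hn k \<omega> - A)) $ j) / real n" for n
    proof -
      have "Cn n \<omega> $ j = C0 \<omega> $ j + (\<Sum>k<n. inc k \<omega> $ j)" by (simp add: config_eq_sum[of n])
      then have "(Cn n \<omega> /\<^sub>R real n - ?x n v* A) $ j
          = (C0 \<omega> $ j + (\<Sum>k<n. inc k \<omega> $ j)) / real n - (\<Sum>k<n. (share k \<omega> v* A) $ j) / real n"
        by (simp only: vector_minus_component xA vector_scaleR_component) (simp add: divide_inverse)
      moreover have "(\<Sum>k<n. (share k \<omega> v* (Hn k \<omega> - A)) $ j)
          = (\<Sum>k<n. (share k \<omega> v* Hn k \<omega>) $ j) - (\<Sum>k<n. (share k \<omega> v* A) $ j)"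
        by (simp only: vector_matrix_mult_diff_rdistrib vector_minus_component sum_subtractf)
      moreover have "(\<Sum>k<n. inc k \<omega> $ j - (share k \<omega> v* Hn k \<omega>) $ j)
          = (\<Sum>k<n. inc k \<omega> $ j) - (\<Sum>k<n. (share k \<omega> v* Hn k \<omega>) $ j)"
        by (rule sum_subtractf)
      ultimately show ?thesis by (simp only: add_divide_distrib diff_divide_distrib)
    qed
    then show "(\<lambda>n. (Cn n \<omega> /\<^sub>R real n - ?x n v* A) $ j) \<longlonglongrightarrow> 0 $ j"
      using tendsto_add[OF tendsto_add[OF 2 inc[of j]] 1] by simp
  qed
  have tot: "mass (Cn n \<omega>) = Sn n \<omega>" for n by (simp add: urn_total_def)
  have C: "Cn n \<omega> = mass (Cn n \<omega>) *\<^sub>R share n \<omega>" "0 < mass (Cn n \<omega>)" for n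
    unfolding tot using b(1)[of n] by auto
  note lim = P.averaged_urn_limit[where C="\<lambda>n. Cn n \<omega>" and Y="\<lambda>n. share n \<omega>", OF b(2) C drift]
  show s: "(\<lambda>n. share n \<omega>) \<longlonglongrightarrow> left_perron_vector A"
    using lim(2) by (simp add: P.left_perron_vector_eq)
  show t: "(\<lambda>n. Sn n \<omega> / real n) \<longlonglongrightarrow> dominant_eigenvalue A"
    using lim(3) by (simp add: P.dominant_eigenvalue_eq tot)
  have eq: "Cn n \<omega> /\<^sub>R real n = (Sn n \<omega> / real n) *\<^sub>R share n \<omega>" for n
    using b(1)[of n] by (simp add: divide_inverse)
  show "(\<lambda>n. Cn n \<omega> /\<^sub>R real n) \<longlonglongrightarrow> dominant_eigenvalue A *\<^sub>R left_perron_vector A"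
    unfolding eq by (rule tendsto_scaleR[OF t s])
  have "(\<lambda>n. urn_count drawn n \<omega> /\<^sub>R real n - ?x n) \<longlonglongrightarrow> 0"
  proof (rule vec_tendstoI)
    fix i
    have "(urn_count drawn n \<omega> /\<^sub>R real n - ?x n) $ i = (\<Sum>k<n. drawn (Suc k) \<omega> $ i - share k \<omega> $ i) / real n" for n
      unfolding urn_count_def One_nat_def sum.atLeast1_atMost_eq
      by (simp add: sum_subtractf divide_inverse algebra_simps)
    then show "(\<lambda>n. (urn_count drawn n \<omega> /\<^sub>R real n - ?x n) $ i) \<longlonglongrightarrow> 0 $ i"
      using draws[of i] by simp
  qed
  from tendsto_add[OF this lim(1)] show "(\<lambda>n. urn_count drawn n \<omega> /\<^sub>R real n) \<longlonglongrightarrow> left_perron_vector A"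
    by (simp add: P.left_perron_vector_eq)
qed


lemma total_measurable: "Sn n \<in> borel_measurable M"
  unfolding urn_total_def[abs_def]
  by (intro borel_measurable_sum measurable_vec_nth config_measurable_M)

lemma integrable_mass_C0: "integrable M (\<lambda>\<omega>. mass (C0 \<omega>))"
proof (rule Bochner_Integration.integrable_sum)
  fix i
  show "integrable M (\<lambda>\<omega>. C0 \<omega> $ i)"
  proof (rule Bochner_Integration.integrable_bound[OF C0_integrable])
    show "(\<lambda>\<omega>. C0 \<omega> $ i) \<in> borel_measurable M" by (intro measurable_vec_nth measurable_C0)
    show "AE \<omega> in M. norm (C0 \<omega> $ i) \<le> norm (C0 \<omega>)"
      by (intro AE_I2 Finite_Cartesian_Product.norm_nth_le)
  qed
qed

text \<open>Since \<open>S\<^sub>n\<close> grows by at most the norm of the replacement matrix in each step and the initial content, divided by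
\<open>n\<close>, is at most itself, the excess of \<open>S\<^sub>n / n\<close> over \<open>T\<close> plus that content is at most the average of the excesses of the norms over \<open>T\<close>.\<close>

lemma total_excess_bound:
  assumes tail: "\<And>n m. prob {\<omega>\<in>space M. row_sum_norm (R (Suc n) \<omega>) > real m} \<le> p m"
    and sum: "summable p" and n: "n \<ge> 1"
  shows "integrable M (\<lambda>\<omega>. Sn n \<omega> / real n)"
    "(\<integral>\<omega>. max (Sn n \<omega> / real n - real T - mass (C0 \<omega>)) 0 \<partial>M) \<le> (\<Sum>m. p (m + T))"
proof -
  let ?G = "\<lambda>\<omega>. mass (C0 \<omega>)"
  let ?\<rho> = "\<lambda>k \<omega>. row_sum_norm (R (Suc k) \<omega>)"
  have intG: "integrable M ?G" by (rule integrable_mass_C0)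
  have SM: "(\<lambda>\<omega>. Sn n \<omega> / real n) \<in> borel_measurable M"
    by (intro borel_measurable_divide total_measurable borel_measurable_const)
  have bound: "AE \<omega> in M. 0 \<le> Sn n \<omega> \<and> Sn n \<omega> \<le> ?G \<omega> + (\<Sum>k<n. ?\<rho> k \<omega>) \<and> 0 \<le> ?G \<omega>"
    using C0_nonneg AE_space
  proof eventually_elim
    case (elim \<omega>)
    then show ?case using urn_bounds(1,3)[of \<omega> n] by (auto intro: sum_nonneg less_imp_le)
  qed
  show iS: "integrable M (\<lambda>\<omega>. Sn n \<omega> / real n)"
  proof (rule Bochner_Integration.integrable_bound[OF _ SM])
    show "integrable M (\<lambda>\<omega>. (?G \<omega> + (\<Sum>k<n. ?\<rho> k \<omega>)) / real n)"
      using intG integrable_row_sum_norm by simp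
    show "AE \<omega> in M. norm (Sn n \<omega> / real n) \<le> norm ((?G \<omega> + (\<Sum>k<n. ?\<rho> k \<omega>)) / real n)"
      using bound by eventually_elim (simp add: divide_right_mono)
  qed
  have ie: "integrable M (\<lambda>\<omega>. max (?\<rho> k \<omega> - real T) 0)" for k using integrable_row_sum_norm by simp
  let ?X = "\<lambda>\<omega>. \<Sum>k<n. max (?\<rho> k \<omega> - real T) 0"
  have "(\<integral>\<omega>. max (Sn n \<omega> / real n - real T - ?G \<omega>) 0 \<partial>M) \<le> (\<integral>\<omega>. ?X \<omega> / real n \<partial>M)"
  proof (rule integral_mono_AE)
    show "integrable M (\<lambda>\<omega>. max (Sn n \<omega> / real n - real T - ?G \<omega>) 0)" using iS intG by simp
    show "integrable M (\<lambda>\<omega>. ?X \<omega> / real n)" using ie by simp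
    show "AE \<omega> in M. max (Sn n \<omega> / real n - real T - ?G \<omega>) 0 \<le> ?X \<omega> / real n"
      using bound
    proof eventually_elim
      case (elim \<omega>)
      have "(\<Sum>k<n. ?\<rho> k \<omega>) - real n * real T \<le> ?X \<omega>"
      proof -
        have "(\<Sum>k<n. ?\<rho> k \<omega>) - real n * real T = (\<Sum>k<n. ?\<rho> k \<omega> - real T)" by (simp add: sum_subtractf)
        also have "\<dots> \<le> ?X \<omega>" by (intro sum_mono) simp
        finally show ?thesis .
      qed
      moreover have "?G \<omega> \<le> real n * ?G \<omega>" using elim n mult_right_mono[of 1 "real n" "?G \<omega>"] by simp
      ultimately have "Sn n \<omega> \<le> ?X \<omega> + real n * real T + real n * ?G \<omega>"
        using elim by linarith
      also have "\<dots> = (?X \<omega> / real n + real T + ?G \<omega>) * real n"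
        using n by (simp add: distrib_right)
      finally have "Sn n \<omega> / real n \<le> ?X \<omega> / real n + real T + ?G \<omega>"
        using n by (simp add: pos_divide_le_eq)
      moreover have "0 \<le> ?X \<omega> / real n" by (simp add: sum_nonneg)
      ultimately show ?case by simp
    qed
  qed
  also have "\<dots> = (\<Sum>k<n. \<integral>\<omega>. max (?\<rho> k \<omega> - real T) 0 \<partial>M) / real n"
    using ie by (simp add: Bochner_Integration.integral_sum)
  also have "\<dots> \<le> (\<Sum>k<n. (\<Sum>m. p (m + T))) / real n"
    by (intro divide_right_mono sum_mono expectation_excess_le integrable_row_sum_norm
        row_sum_norm_nonneg tail sum) simp
  also have "\<dots> = (\<Sum>m. p (m + T))" using n by simp
  finally show "(\<integral>\<omega>. max (Sn n \<omega> / real n - real T - ?G \<omega>) 0 \<partial>M) \<le> (\<Sum>m. p (m + T))" .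
qed

end

lemma (in prob_space) tendsto_L1_cong_AE:
  assumes X: "tendsto_L1 M X L" and Y: "\<And>n. Y n \<in> borel_measurable M"
    and eq: "\<And>n. AE \<omega> in M. X n \<omega> = Y n \<omega>"
  shows "tendsto_L1 M Y L"
proof -
  have i: "integrable M (X n)" "integrable M L" for n using X by (auto simp: tendsto_L1_def)
  have [measurable]: "X n \<in> borel_measurable M" "Y n \<in> borel_measurable M" "L \<in> borel_measurable M" for n
    using i Y by auto
  have "integrable M (Y n)" for n by (rule integrable_cong_AE_imp[OF i(1) Y]) (use eq[of n] in auto)
  moreover have "(\<integral>\<omega>. norm (X n \<omega> - L \<omega>) \<partial>M) = (\<integral>\<omega>. norm (Y n \<omega> - L \<omega>) \<partial>M)" for n
    by (intro integral_cong_AE) (use eq[of n] in auto)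
  ultimately show ?thesis using X by (simp add: tendsto_L1_def)
qed

text \<open>Write \<open>Z P - L Q = (Z - L) P + L (P - Q)\<close>; the second term is dominated by \<open>2 |L|\<close>.\<close>

lemma (in prob_space) tendsto_L1_scaleR_bounded:
  fixes Z :: "nat \<Rightarrow> 'a \<Rightarrow> real" and P :: "nat \<Rightarrow> 'a \<Rightarrow> 'b::{banach, second_countable_topology}"
  assumes Z: "tendsto_L1 M Z L"
    and P[measurable]: "\<And>n. P n \<in> borel_measurable M" and Q[measurable]: "Q \<in> borel_measurable M"
    and lim: "tendsto_AE M P Q" and P1: "\<And>n. AE \<omega> in M. norm (P n \<omega>) \<le> 1"
  shows "tendsto_L1 M (\<lambda>n \<omega>. Z n \<omega> *\<^sub>R P n \<omega>) (\<lambda>\<omega>. L \<omega> *\<^sub>R Q \<omega>)"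
proof -
  have iZ: "integrable M (Z n)" "integrable M L" for n using Z by (auto simp: tendsto_L1_def)
  then have [measurable]: "Z n \<in> borel_measurable M" "L \<in> borel_measurable M" for n by auto
  have "AE \<omega> in M. \<forall>n. norm (P n \<omega>) \<le> 1" using P1 by (simp add: AE_all_countable)
  with lim[unfolded tendsto_AE_def] have Q1: "AE \<omega> in M. norm (Q \<omega>) \<le> 1"
    by eventually_elim (rule Lim_norm_ubound[of sequentially], auto)
  have iZP: "integrable M (\<lambda>\<omega>. Z n \<omega> *\<^sub>R P n \<omega>)" for n
  proof (rule Bochner_Integration.integrable_bound[OF iZ(1)[of n]])
    show "AE \<omega> in M. norm (Z n \<omega> *\<^sub>R P n \<omega>) \<le> norm (Z n \<omega>)"
      using P1[of n] by eventually_elim (simp add: mult_left_le)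
  qed simp
  have iLQ: "integrable M (\<lambda>\<omega>. L \<omega> *\<^sub>R Q \<omega>)"
  proof (rule Bochner_Integration.integrable_bound[OF iZ(2)])
    show "AE \<omega> in M. norm (L \<omega> *\<^sub>R Q \<omega>) \<le> norm (L \<omega>)"
      using Q1 by eventually_elim (simp add: mult_left_le)
  qed simp
  let ?e = "\<lambda>n \<omega>. \<bar>L \<omega>\<bar> * norm (P n \<omega> - Q \<omega>)"
  let ?d = "\<lambda>n \<omega>. norm (Z n \<omega> *\<^sub>R P n \<omega> - L \<omega> *\<^sub>R Q \<omega>)"
  have dom: "(\<lambda>n. \<integral>\<omega>. ?e n \<omega> \<partial>M) \<longlonglongrightarrow> (\<integral>\<omega>. 0 \<partial>M)"
    and iLP: "\<And>n. integrable M (\<lambda>\<omega>. ?e n \<omega>)"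
  proof -
    have b: "AE \<omega> in M. norm (?e n \<omega>) \<le> \<bar>L \<omega>\<bar> * 2" for n
      using P1[of n] Q1
    proof eventually_elim
      case (elim \<omega>)
      have "norm (P n \<omega> - Q \<omega>) \<le> 2" using norm_triangle_ineq4[of "P n \<omega>" "Q \<omega>"] elim by simp
      then show ?case by (simp add: abs_mult mult_left_mono)
    qed
    have w: "integrable M (\<lambda>\<omega>. \<bar>L \<omega>\<bar> * 2)" using iZ(2) by simp
    show "(\<lambda>n. \<integral>\<omega>. ?e n \<omega> \<partial>M) \<longlonglongrightarrow> (\<integral>\<omega>. 0 \<partial>M)"
    proof (rule integral_dominated_convergence[OF _ _ w])
      show "AE \<omega> in M. (\<lambda>n. ?e n \<omega>) \<longlonglongrightarrow> 0"
        using lim[unfolded tendsto_AE_def]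
        by eventually_elim (intro tendsto_mult_right_zero tendsto_norm_zero LIM_zero)
    qed (use b in auto)
    show "integrable M (\<lambda>\<omega>. ?e n \<omega>)" for n
      by (rule Bochner_Integration.integrable_bound[OF w])
        (use b[of n] in \<open>auto elim!: eventually_mono\<close>)
  qed
  have "(\<lambda>n. \<integral>\<omega>. ?d n \<omega> \<partial>M) \<longlonglongrightarrow> 0"
  proof (rule tendsto_sandwich[OF _ _ tendsto_const])
    show "(\<lambda>n. (\<integral>\<omega>. norm (Z n \<omega> - L \<omega>) \<partial>M) + (\<integral>\<omega>. ?e n \<omega> \<partial>M)) \<longlonglongrightarrow> 0"
      using tendsto_add[OF _ dom] Z by (fastforce simp: tendsto_L1_def)
    show "\<forall>\<^sub>F n in sequentially. (\<integral>\<omega>. ?d n \<omega> \<partial>M)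
        \<le> (\<integral>\<omega>. norm (Z n \<omega> - L \<omega>) \<partial>M) + (\<integral>\<omega>. ?e n \<omega> \<partial>M)"
    proof (intro always_eventually allI)
      fix n
      have iN: "integrable M (\<lambda>\<omega>. norm (Z n \<omega> - L \<omega>))" using iZ by simp
      have "(\<integral>\<omega>. ?d n \<omega> \<partial>M)
          \<le> (\<integral>\<omega>. norm (Z n \<omega> - L \<omega>) + ?e n \<omega> \<partial>M)"
      proof (rule integral_mono_AE)
        show "AE \<omega> in M. ?d n \<omega>
            \<le> norm (Z n \<omega> - L \<omega>) + ?e n \<omega>"
          using P1[of n]
        proof eventually_elim
          case (elim \<omega>)
          have "Z n \<omega> *\<^sub>R P n \<omega> - L \<omega> *\<^sub>R Q \<omega> = (Z n \<omega> - L \<omega>) *\<^sub>R P n \<omega> + L \<omega> *\<^sub>R (P n \<omega> - Q \<omega>)"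
            by (simp add: algebra_simps)
          then have "?d n \<omega>
              \<le> norm (Z n \<omega> - L \<omega>) * norm (P n \<omega>) + ?e n \<omega>"
            by (metis norm_triangle_ineq norm_scaleR real_norm_def)
          moreover have "norm (Z n \<omega> - L \<omega>) * norm (P n \<omega>) \<le> norm (Z n \<omega> - L \<omega>)"
            using elim by (simp add: mult_left_le)
          ultimately show ?case by linarith
        qed
      qed (use iZP iLQ iN iLP in auto)
      also have "\<dots> = (\<integral>\<omega>. norm (Z n \<omega> - L \<omega>) \<partial>M) + (\<integral>\<omega>. ?e n \<omega> \<partial>M)"
        by (rule Bochner_Integration.integral_add[OF iN iLP])
      finally show "(\<integral>\<omega>. ?d n \<omega> \<partial>M)
        \<le> (\<integral>\<omega>. norm (Z n \<omega> - L \<omega>) \<partial>M) + (\<integral>\<omega>. ?e n \<omega> \<partial>M)" .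
    qed
  qed simp
  then show ?thesis unfolding tendsto_L1_def using iZP iLQ by simp
qed

theorem corollary2p5:
  fixes M :: "'a measure"
    and C0 :: "'a \<Rightarrow> real^'k"
    and drawn :: "nat \<Rightarrow> 'a \<Rightarrow> real^'k"
    and R :: "nat \<Rightarrow> 'a \<Rightarrow> real^'k^'k"
    and H :: "'a \<Rightarrow> real^'k^'k"
    and c :: real
    and D :: "'a \<Rightarrow> real"
  assumes urn: "randomized_urn M C0 drawn R"
    and H_measurable: "H \<in> borel_measurable M"
    and H_nonneg: "\<And>\<omega>. \<omega> \<in> space M \<Longrightarrow> nonneg_matrix (H \<omega>)"
    and H_irreducible: "AE \<omega> in M. irreducible_matrix (H \<omega>)"
    and H_limit: "AE \<omega> in M.
          (\<lambda>n. (1 / real n) *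
             (\<Sum>k<n. row_sum_norm (urn_mean_replacement M C0 drawn R k \<omega> - H \<omega>))) \<longlonglongrightarrow> 0"
    and c_pos: "0 < c"
    and D_measurable: "D \<in> borel_measurable M"
    and D_pos: "\<And>\<omega>. \<omega> \<in> space M \<Longrightarrow> 0 < D \<omega>"
    and D_integrable: "integrable M D"
    and D_log_integrable: "integrable M (\<lambda>\<omega>. D \<omega> * log_plus (D \<omega>))"
    and R_tail: "\<And>x n. 0 < x \<Longrightarrow> n \<ge> 1 \<Longrightarrow>
          \<P>(\<omega> in M. row_sum_norm (R n \<omega>) > x) \<le> c * \<P>(\<omega> in M. D \<omega> > x)"
  shows
    "tendsto_AE M (\<lambda>n \<omega>. urn_config C0 drawn R n \<omega> /\<^sub>R urn_total C0 drawn R n \<omega>)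
       (\<lambda>\<omega>. left_perron_vector (H \<omega>)) \<and>
     tendsto_L1 M (\<lambda>n \<omega>. urn_config C0 drawn R n \<omega> /\<^sub>R urn_total C0 drawn R n \<omega>)
       (\<lambda>\<omega>. left_perron_vector (H \<omega>)) \<and>
     tendsto_AE M (\<lambda>n \<omega>. urn_total C0 drawn R n \<omega> / real n)
       (\<lambda>\<omega>. dominant_eigenvalue (H \<omega>)) \<and>
     tendsto_L1 M (\<lambda>n \<omega>. urn_total C0 drawn R n \<omega> / real n)
       (\<lambda>\<omega>. dominant_eigenvalue (H \<omega>)) \<and>
     tendsto_AE M (\<lambda>n \<omega>. urn_config C0 drawn R n \<omega> /\<^sub>R real n)
       (\<lambda>\<omega>. dominant_eigenvalue (H \<omega>) *\<^sub>R left_perron_vector (H \<omega>)) \<and>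
     tendsto_L1 M (\<lambda>n \<omega>. urn_config C0 drawn R n \<omega> /\<^sub>R real n)
       (\<lambda>\<omega>. dominant_eigenvalue (H \<omega>) *\<^sub>R left_perron_vector (H \<omega>)) \<and>
     tendsto_AE M (\<lambda>n \<omega>. urn_count drawn n \<omega> /\<^sub>R real n)
       (\<lambda>\<omega>. left_perron_vector (H \<omega>)) \<and>
     tendsto_L1 M (\<lambda>n \<omega>. urn_count drawn n \<omega> /\<^sub>R real n)
       (\<lambda>\<omega>. left_perron_vector (H \<omega>))"
proof -
  interpret randomized_urn M C0 drawn R by (rule urn)
  \<comment> \<open>The tail assumption speaks of positive levels only; at level 0 the trivial bound serves.\<close>
  define p :: "nat \<Rightarrow> real" where "p = (\<lambda>m. if m = 0 then 1 else c * prob {\<omega>\<in>space M. D \<omega> > real m})"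
  have tail: "prob {\<omega>\<in>space M. row_sum_norm (R (Suc n) \<omega>) > real m} \<le> p m" for n m
    using R_tail[of "real m" "Suc n"] by (cases "m = 0") (simp_all add: p_def)
  have h0: "0 \<le> (harm n :: real)" for n by (simp add: harm_nonneg)
  have "summable (\<lambda>m. c * ((1 + harm (Suc m)) * prob {\<omega>\<in>space M. D \<omega> > real (Suc m)}))"
    by (intro summable_mult summable_harm_tail D_measurable D_pos D_integrable D_log_integrable)
  then have w: "summable (\<lambda>m. (1 + harm (Suc m)) * p (Suc m))"
    by (simp add: p_def mult.left_commute)
  have p0: "0 \<le> p m" for m using c_pos by (simp add: p_def)
  have "summable (\<lambda>m. p (Suc m))"
    by (rule summable_comparison_test'[OF w]) (use p0 h0 in \<open>simp add: mult_le_cancel_right1 distrib_right\<close>)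
  then have sum_p: "summable p" by (simp only: summable_Suc_iff)
  have "summable (\<lambda>m. harm (Suc m) * p (Suc m))"
    by (rule summable_comparison_test'[OF w]) (use p0 h0 in \<open>simp add: abs_mult mult_right_mono\<close>)
  then have sum_hp: "summable (\<lambda>m. harm m * p m)" by (subst (asm) summable_Suc_iff)
  have "AE \<omega> in M. \<forall>j. (\<lambda>n. (\<Sum>k<n. inc k \<omega> $ j - (share k \<omega> v* Hn k \<omega>) $ j) / real n) \<longlonglongrightarrow> 0"
    by (intro eventually_all_finite increments_strong_law[OF tail sum_p sum_hp])
  moreover have "AE \<omega> in M. \<forall>i. (\<lambda>n. (\<Sum>k<n. drawn (Suc k) \<omega> $ i - share k \<omega> $ i) / real n) \<longlonglongrightarrow> 0"
    by (intro eventually_all_finite draws_strong_law)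
  ultimately have paths: "AE \<omega> in M. (\<lambda>n. share n \<omega>) \<longlonglongrightarrow> left_perron_vector (H \<omega>) \<and>
      (\<lambda>n. Sn n \<omega> / real n) \<longlonglongrightarrow> dominant_eigenvalue (H \<omega>) \<and>
      (\<lambda>n. Cn n \<omega> /\<^sub>R real n) \<longlonglongrightarrow> dominant_eigenvalue (H \<omega>) *\<^sub>R left_perron_vector (H \<omega>) \<and>
      (\<lambda>n. urn_count drawn n \<omega> /\<^sub>R real n) \<longlonglongrightarrow> left_perron_vector (H \<omega>)"
    using C0_nonneg AE_space H_irreducible H_limit
    by eventually_elim (intro conjI pathwise_limits; auto)
  have shareM: "share n \<in> borel_measurable M" for n
    by (intro borel_measurable_scaleR borel_measurable_inverse total_measurable config_measurable_M)
  have piM: "(\<lambda>\<omega>. left_perron_vector (H \<omega>)) \<in> borel_measurable M"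
    by (rule measurable_compose[OF H_measurable measurable_left_perron_vector])
  have lamM: "(\<lambda>\<omega>. dominant_eigenvalue (H \<omega>)) \<in> borel_measurable M"
    by (rule measurable_compose[OF H_measurable measurable_dominant_eigenvalue])
  have simplex: "AE \<omega> in M. 0 < Sn n \<omega> \<and> share n \<omega> \<in> prob_simplex" for n
    using C0_nonneg AE_space by eventually_elim (use urn_bounds in auto)
  have share1: "AE \<omega> in M. norm (share n \<omega>) \<le> 1" for n
    using simplex[of n] by eventually_elim (use prob_simplex_norm_le_1 in blast)
  have ae1: "tendsto_AE M share (\<lambda>\<omega>. left_perron_vector (H \<omega>))"
    and ae2: "tendsto_AE M (\<lambda>n \<omega>. Sn n \<omega> / real n) (\<lambda>\<omega>. dominant_eigenvalue (H \<omega>))"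
    and ae3: "tendsto_AE M (\<lambda>n \<omega>. Cn n \<omega> /\<^sub>R real n)
      (\<lambda>\<omega>. dominant_eigenvalue (H \<omega>) *\<^sub>R left_perron_vector (H \<omega>))"
    and ae4: "tendsto_AE M (\<lambda>n \<omega>. urn_count drawn n \<omega> /\<^sub>R real n) (\<lambda>\<omega>. left_perron_vector (H \<omega>))"
    unfolding tendsto_AE_def using paths by (auto elim: eventually_mono)
  have l1: "tendsto_L1 M share (\<lambda>\<omega>. left_perron_vector (H \<omega>))"
    by (rule tendsto_L1_bounded[OF shareM piM share1 ae1])
  have l2: "tendsto_L1 M (\<lambda>n \<omega>. Sn n \<omega> / real n) (\<lambda>\<omega>. dominant_eigenvalue (H \<omega>))"
  proof (rule tendsto_L1_of_excess_bound[OF _ _ lamM ae2 integrable_mass_C0])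
    show "integrable M (\<lambda>\<omega>. Sn n \<omega> / real n)" for n
      using total_excess_bound(1)[OF tail sum_p, of n] by (cases "n = 0") auto
    show "AE \<omega> in M. 0 \<le> Sn n \<omega> / real n" for n
      using simplex[of n] by eventually_elim simp
    show "AE \<omega> in M. 0 \<le> mass (C0 \<omega>)"
      using C0_nonneg by eventually_elim (auto intro: sum_nonneg)
    show "(\<integral>\<omega>. max (Sn n \<omega> / real n - real T - mass (C0 \<omega>)) 0 \<partial>M) \<le> (\<Sum>m. p (m + T))"
      if "n \<ge> 1" for n T by (rule total_excess_bound(2)[OF tail sum_p that])
    have "(\<lambda>T. (\<Sum>m. p m) - (\<Sum>m<T. p m)) \<longlonglongrightarrow> (\<Sum>m. p m) - (\<Sum>m. p m)"
      by (intro tendsto_intros summable_LIMSEQ sum_p)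
    then show "(\<lambda>T. \<Sum>m. p (m + T)) \<longlonglongrightarrow> 0"
      by (simp add: suminf_minus_initial_segment[OF sum_p])
  qed
  have l3: "tendsto_L1 M (\<lambda>n \<omega>. Cn n \<omega> /\<^sub>R real n)
      (\<lambda>\<omega>. dominant_eigenvalue (H \<omega>) *\<^sub>R left_perron_vector (H \<omega>))"
  proof -
    have CM: "(\<lambda>\<omega>. Cn n \<omega> /\<^sub>R real n) \<in> borel_measurable M" for n
      by (intro borel_measurable_scaleR borel_measurable_const config_measurable_M)
    note prod = tendsto_L1_scaleR_bounded[OF l2 shareM piM ae1 share1]
    have eq: "AE \<omega> in M. (Sn n \<omega> / real n) *\<^sub>R share n \<omega> = Cn n \<omega> /\<^sub>R real n" for n
      using simplex[of n] by eventually_elim (simp add: divide_inverse)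
    show ?thesis by (rule tendsto_L1_cong_AE[OF prod CM eq])
  qed
  have l4: "tendsto_L1 M (\<lambda>n \<omega>. urn_count drawn n \<omega> /\<^sub>R real n) (\<lambda>\<omega>. left_perron_vector (H \<omega>))"
  proof (rule tendsto_L1_bounded[where B=1, OF _ piM _ ae4])
    show "(\<lambda>\<omega>. urn_count drawn n \<omega> /\<^sub>R real n) \<in> borel_measurable M" for n
      unfolding urn_count_def
      by (intro borel_measurable_scaleR borel_measurable_const borel_measurable_sum measurable_drawn) simp
    show "AE \<omega> in M. norm (urn_count drawn n \<omega> /\<^sub>R real n) \<le> 1" for n
    proof (rule AE_I2)
      fix \<omega> assume w: "\<omega> \<in> space M"
      have "norm (urn_count drawn n \<omega>) \<le> (\<Sum>k=1..n. 1)"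
        unfolding urn_count_def
        by (rule order_trans[OF norm_sum], rule sum_mono)
          (use drawn_simplex[OF _ w] prob_simplex_norm_le_1 in auto)
      then show "norm (urn_count drawn n \<omega> /\<^sub>R real n) \<le> 1"
        by (cases "n = 0") (simp_all add: field_simps)
    qed
  qed
  show ?thesis using ae1 l1 ae2 l2 ae3 l3 ae4 l4 by blast
qed

end
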